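(* Let $(R,\mathfrak{m},k)$ be a local ring of prime characteristic $p>0$ and let $x\in\mathfrak{m}$ be a regular element. If $R/xR$ is $F$-split, then $R$ is $F$-injective.
   Context: All rings are commutative and noetherian. A regular element is a nonzerodivisor. For a ring $A$ of characteristic $p$, $F_*A$ denotes $A$ viewed as an $A$-module via the Frobenius map $a\mapsto a^p$; $A$ is $F$-split if the Frobenius map $A\to F_*A$ splits as a map of $A$-modules. A local ring $(A,\mathfrak{n})$ of prime characteristic $p>0$ is $F$-injective if for every $i\ge 0$ the Frobenius action on the local cohomology module $H^i_{\mathfrak{n}}(A)$ (the additive, $p$-linear map induced by the Frobenius map of $A$) is injective. *)

theory Defs
  imports "HOL-Algebra.Algebra" "HOL-Computational_Algebra.Primes"
begin

section \<open>Rings\<close>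

locale noetherian_local_ring = R?: cring R + noetherian_ring R + maximalideal \<mm> R
  for R (structure) and \<mm> +
  assumes maximal_unique: "maximalideal \<nn> R \<Longrightarrow> \<nn> = \<mm>"

definition regular_element :: "('a, 'b) ring_scheme \<Rightarrow> 'a \<Rightarrow> bool" where
  "regular_element R x \<longleftrightarrow>
     x \<in> carrier R \<and> (\<forall>a \<in> carrier R. x \<otimes>\<^bsub>R\<^esub> a = \<zero>\<^bsub>R\<^esub> \<longrightarrow> a = \<zero>\<^bsub>R\<^esub>)"

text \<open>For a ring with nonzero unit and prime \<open>p\<close>, the condition \<open>p \<cdot> 1 = 0\<close> says that the
  characteristic is exactly \<open>p\<close>.\<close>

definition has_prime_char :: "nat \<Rightarrow> ('a, 'b) ring_scheme \<Rightarrow> bool" where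
  "has_prime_char p R \<longleftrightarrow>
     Factorial_Ring.prime p \<and> \<one>\<^bsub>R\<^esub> \<noteq> \<zero>\<^bsub>R\<^esub> \<and> add_pow R p \<one>\<^bsub>R\<^esub> = \<zero>\<^bsub>R\<^esub>"


section \<open>F-split rings\<close>

definition module_homs ::
  "('a, 'r) ring_scheme \<Rightarrow> ('a, 'b, 'm) module_scheme \<Rightarrow> ('a, 'c, 'n) module_scheme \<Rightarrow> ('b \<Rightarrow> 'c) set"
  where
  "module_homs R M N =
     {h \<in> carrier M \<rightarrow> carrier N.
        (\<forall>x \<in> carrier M. \<forall>y \<in> carrier M. h (x \<oplus>\<^bsub>M\<^esub> y) = h x \<oplus>\<^bsub>N\<^esub> h y) \<and>
        (\<forall>a \<in> carrier R. \<forall>x \<in> carrier M. h (a \<odot>\<^bsub>M\<^esub> x) = a \<odot>\<^bsub>N\<^esub> h x)}"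

definition self_module :: "('a, 'b) ring_scheme \<Rightarrow> ('a, 'a) module" where
  "self_module A =
     \<lparr>carrier = carrier A, monoid.mult = monoid.mult A, one = \<one>\<^bsub>A\<^esub>,
      ring.zero = \<zero>\<^bsub>A\<^esub>, add = ring.add A,
      smult = (\<lambda>a b. a \<otimes>\<^bsub>A\<^esub> b)\<rparr>"

definition frobenius_pushforward :: "nat \<Rightarrow> ('a, 'b) ring_scheme \<Rightarrow> ('a, 'a) module" where
  "frobenius_pushforward p A =
     \<lparr>carrier = carrier A, monoid.mult = monoid.mult A, one = \<one>\<^bsub>A\<^esub>,
      ring.zero = \<zero>\<^bsub>A\<^esub>, add = ring.add A,
      smult = (\<lambda>a b. (a [^]\<^bsub>A\<^esub> p) \<otimes>\<^bsub>A\<^esub> b)\<rparr>"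

definition frobenius :: "nat \<Rightarrow> ('a, 'b) ring_scheme \<Rightarrow> 'a \<Rightarrow> 'a" where
  "frobenius p A a = a [^]\<^bsub>A\<^esub> p"

definition F_split :: "nat \<Rightarrow> ('a, 'b) ring_scheme \<Rightarrow> bool" where
  "F_split p A \<longleftrightarrow>
     (\<exists>\<phi> \<in> module_homs A (frobenius_pushforward p A) (self_module A).
        \<forall>a \<in> carrier A. \<phi> (frobenius p A a) = a)"


section \<open>Localization at a multiplicative submonoid\<close>

definition loc_rel :: "('a, 'b) ring_scheme \<Rightarrow> 'a set \<Rightarrow> (('a \<times> 'a) \<times> ('a \<times> 'a)) set" where
  "loc_rel R S =
     {((r, s), (r', s')). r \<in> carrier R \<and> s \<in> S \<and> r' \<in> carrier R \<and> s' \<in> S \<and>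
        (\<exists>t \<in> S. t \<otimes>\<^bsub>R\<^esub> (s' \<otimes>\<^bsub>R\<^esub> r \<ominus>\<^bsub>R\<^esub> s \<otimes>\<^bsub>R\<^esub> r') = \<zero>\<^bsub>R\<^esub>)}"

definition loc_frac :: "('a, 'b) ring_scheme \<Rightarrow> 'a set \<Rightarrow> 'a \<Rightarrow> 'a \<Rightarrow> ('a \<times> 'a) set" where
  "loc_frac R S r s = loc_rel R S `` {(r, s)}"

definition localization :: "('a, 'b) ring_scheme \<Rightarrow> 'a set \<Rightarrow> ('a, ('a \<times> 'a) set) module" where
  "localization R S =
     \<lparr>carrier = (carrier R \<times> S) // loc_rel R S,
      monoid.mult = (\<lambda>u v. \<Union>(r, s) \<in> u. \<Union>(r', s') \<in> v. loc_frac R S (r \<otimes>\<^bsub>R\<^esub> r') (s \<otimes>\<^bsub>R\<^esub> s')),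
      one = loc_frac R S \<one>\<^bsub>R\<^esub> \<one>\<^bsub>R\<^esub>,
      ring.zero = loc_frac R S \<zero>\<^bsub>R\<^esub> \<one>\<^bsub>R\<^esub>,
      add = (\<lambda>u v. \<Union>(r, s) \<in> u. \<Union>(r', s') \<in> v.
               loc_frac R S (s' \<otimes>\<^bsub>R\<^esub> r \<oplus>\<^bsub>R\<^esub> s \<otimes>\<^bsub>R\<^esub> r') (s \<otimes>\<^bsub>R\<^esub> s')),
      smult = (\<lambda>a u. \<Union>(r, s) \<in> u. loc_frac R S (a \<otimes>\<^bsub>R\<^esub> r) s)\<rparr>"

text \<open>For submonoids \<open>S \<subseteq> T\<close>, the canonical map from the localization at \<open>S\<close> to the localization
  at \<open>T\<close>; it sends the class of \<open>(r, s)\<close> to the class of \<open>(r, s)\<close>.\<close>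

definition loc_map :: "('a, 'b) ring_scheme \<Rightarrow> 'a set \<Rightarrow> ('a \<times> 'a) set \<Rightarrow> ('a \<times> 'a) set" where
  "loc_map R T u = loc_rel R T `` u"


section \<open>Cohomology of a cochain complex of modules\<close>

definition cocycles ::
  "(nat \<Rightarrow> ('a, 'c) module) \<Rightarrow> (nat \<Rightarrow> 'c \<Rightarrow> 'c) \<Rightarrow> nat \<Rightarrow> 'c set" where
  "cocycles C d i = {c \<in> carrier (C i). d i c = \<zero>\<^bsub>C (Suc i)\<^esub>}"

definition coboundaries ::
  "(nat \<Rightarrow> ('a, 'c) module) \<Rightarrow> (nat \<Rightarrow> 'c \<Rightarrow> 'c) \<Rightarrow> nat \<Rightarrow> 'c set" where
  "coboundaries C d i = (case i of 0 \<Rightarrow> {\<zero>\<^bsub>C 0\<^esub>} | Suc j \<Rightarrow> d j ` carrier (C j))"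

text \<open>The multiplicative fields of a module record carry no information.\<close>

definition cohomology ::
  "(nat \<Rightarrow> ('a, 'c) module) \<Rightarrow> (nat \<Rightarrow> 'c \<Rightarrow> 'c) \<Rightarrow> nat \<Rightarrow> ('a, 'c set) module" where
  "cohomology C d i =
     \<lparr>carrier = (\<lambda>z. coboundaries C d i +>\<^bsub>C i\<^esub> z) ` cocycles C d i,
      monoid.mult = undefined, one = undefined,
      ring.zero = coboundaries C d i,
      add = set_add (C i),
      smult = (\<lambda>a u. \<Union>z \<in> u. coboundaries C d i +>\<^bsub>C i\<^esub> (a \<odot>\<^bsub>C i\<^esub> z))\<rparr>"

text \<open>The map induced on cohomology by an additive endomorphism \<open>\<phi>\<close> of the complex, which sends
  the class of \<open>z\<close> to the class of \<open>\<phi> i z\<close>.\<close>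

definition cohomology_map ::
  "(nat \<Rightarrow> ('a, 'c) module) \<Rightarrow> (nat \<Rightarrow> 'c \<Rightarrow> 'c) \<Rightarrow> (nat \<Rightarrow> 'c \<Rightarrow> 'c) \<Rightarrow> nat \<Rightarrow> 'c set \<Rightarrow> 'c set"
  where
  "cohomology_map C d \<phi> i u = (\<Union>z \<in> u. coboundaries C d i +>\<^bsub>C i\<^esub> \<phi> i z)"


section \<open>Local cohomology by the Cech complex\<close>

text \<open>For a finite sequence \<open>f\<^sub>0, \<dots>, f\<^bsub>n-1\<^esub>\<close> in \<open>R\<close>, the degree \<open>i\<close> term of the Cech complex is the
  product, over the subsets \<open>I\<close> of \<open>{0, \<dots>, n-1}\<close> with \<open>i\<close> elements, of the localization of \<open>R\<close> at
  the submonoid generated by the \<open>f\<^sub>k\<close> with \<open>k \<in> I\<close>, that is, of \<open>R\<close> localized at the product of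
  these \<open>f\<^sub>k\<close>. In particular the degree \<open>0\<close> term is \<open>R\<close> localized at \<open>{1}\<close>.\<close>

definition cech_index :: "'a list \<Rightarrow> nat \<Rightarrow> nat set set" where
  "cech_index fs i = {I. I \<subseteq> {..<length fs} \<and> card I = i}"

definition cech_monoid :: "('a, 'b) ring_scheme \<Rightarrow> 'a list \<Rightarrow> nat set \<Rightarrow> 'a set" where
  "cech_monoid R fs I =
     range (\<lambda>e :: nat \<Rightarrow> nat. finprod R (\<lambda>k. (fs ! k) [^]\<^bsub>R\<^esub> e k) I)"

definition cech_loc ::
  "('a, 'b) ring_scheme \<Rightarrow> 'a list \<Rightarrow> nat set \<Rightarrow> ('a, ('a \<times> 'a) set) module" where
  "cech_loc R fs I = localization R (cech_monoid R fs I)"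

type_synonym 'a cech_cochain = "nat set \<Rightarrow> ('a \<times> 'a) set"

definition cech_complex ::
  "('a, 'b) ring_scheme \<Rightarrow> 'a list \<Rightarrow> nat \<Rightarrow> ('a, 'a cech_cochain) module" where
  "cech_complex R fs i =
     \<lparr>carrier = (\<Pi>\<^sub>E I \<in> cech_index fs i. carrier (cech_loc R fs I)),
      monoid.mult = undefined, one = undefined,
      ring.zero = (\<lambda>I \<in> cech_index fs i. \<zero>\<^bsub>cech_loc R fs I\<^esub>),
      add = (\<lambda>c c'. \<lambda>I \<in> cech_index fs i. c I \<oplus>\<^bsub>cech_loc R fs I\<^esub> c' I),
      smult = (\<lambda>a c. \<lambda>I \<in> cech_index fs i. a \<odot>\<^bsub>cech_loc R fs I\<^esub> c I)\<rparr>"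

text \<open>The component at \<open>J\<close> of the coboundary of \<open>c\<close> is the alternating sum over \<open>k \<in> J\<close> of the images
  of \<open>c (J - {k})\<close>, with sign determined by the position of \<open>k\<close> in \<open>J\<close>.\<close>

definition cech_diff ::
  "('a, 'b) ring_scheme \<Rightarrow> 'a list \<Rightarrow> nat \<Rightarrow> 'a cech_cochain \<Rightarrow> 'a cech_cochain" where
  "cech_diff R fs i c =
     (\<lambda>J \<in> cech_index fs (Suc i).
        finsum (cech_loc R fs J)
          (\<lambda>k. let y = loc_map R (cech_monoid R fs J) (c (J - {k}))
               in if even (card {l \<in> J. l < k}) then y else \<ominus>\<^bsub>cech_loc R fs J\<^esub> y)
          J)"

definition local_cohomology ::
  "('a, 'b) ring_scheme \<Rightarrow> 'a list \<Rightarrow> nat \<Rightarrow> ('a, 'a cech_cochain set) module" where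
  "local_cohomology R fs i = cohomology (cech_complex R fs) (cech_diff R fs) i"

text \<open>The Frobenius map of \<open>R\<close> induces the Frobenius map of every localization of \<open>R\<close>. These are
  compatible with the Cech differentials.\<close>

definition cech_frobenius ::
  "nat \<Rightarrow> ('a, 'b) ring_scheme \<Rightarrow> 'a list \<Rightarrow> nat \<Rightarrow> 'a cech_cochain \<Rightarrow> 'a cech_cochain" where
  "cech_frobenius p R fs i c = (\<lambda>I \<in> cech_index fs i. frobenius p (cech_loc R fs I) (c I))"

definition frobenius_action ::
  "nat \<Rightarrow> ('a, 'b) ring_scheme \<Rightarrow> 'a list \<Rightarrow> nat \<Rightarrow> 'a cech_cochain set \<Rightarrow> 'a cech_cochain set" where
  "frobenius_action p R fs i =
     cohomology_map (cech_complex R fs) (cech_diff R fs) (cech_frobenius p R fs) i"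

text \<open>The local cohomology of \<open>R\<close> at \<open>\<nn>\<close>, together with its Frobenius action, is up to canonical
  isomorphism independent of the finite generating sequence of \<open>\<nn>\<close>, so the definition
  quantifies over all of them. A noetherian ring has such a sequence.\<close>

definition F_injective :: "nat \<Rightarrow> ('a, 'b) ring_scheme \<Rightarrow> 'a set \<Rightarrow> bool" where
  "F_injective p R \<nn> \<longleftrightarrow>
     (\<forall>fs. set fs \<subseteq> carrier R \<and> genideal R (set fs) = \<nn> \<longrightarrow>
        (\<forall>i. inj_on (frobenius_action p R fs i) (carrier (local_cohomology R fs i))))"

end

theory Submission
  imports Defs "HOL-Library.Function_Algebras" "HOL-Library.Multiset" "HOL-Library.Poly_Mapping"
begin

text \<open>
  Write \<open>H(R/I)\<close> for the local cohomology of \<open>R/I\<close> at the maximal ideal. If \<open>\<phi>\<close> splits the Frobenius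
  \<open>F\<close> of \<open>R/x\<close>, then \<open>\<phi>\<close> maps the span of the image of \<open>F^(e+1)\<close> in \<open>H(R/x)\<close> onto the span of the
  image of \<open>F^e\<close>. Since \<open>H(R/x)\<close> is Artinian, all these spans equal \<open>H(R/x)\<close>. As \<open>F^e\<close> on \<open>H(R/x)\<close>
  factors through \<open>H(R/x^l)\<close> for \<open>l \<le> p^e\<close>, the maps \<open>H(R/x^l) \<rightarrow> H(R/x)\<close> are surjective; by the long
  exact sequences and \<open>x\<close>-torsion, \<open>H(R) \<rightarrow> H(R/x)\<close> is zero. Hence the connecting map
  \<open>\<delta> : H(R/x) \<rightarrow> H(R)\<close> is injective with image the kernel of \<open>x\<close>. If \<open>F(\<delta> a) = 0\<close>, then
  \<open>\<delta>(F a) = x^(p-1) F(\<delta> a) = 0\<close>, so \<open>F a = 0\<close> and \<open>a = \<phi>(F a) = 0\<close>. Therefore the kernel of \<open>F\<close> on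
  \<open>H(R)\<close> has no \<open>x\<close>-torsion, and it is zero because \<open>H(R)\<close> is \<open>x\<close>-torsion.

  To compute with Cech cochains without carrier sets, \<open>R\<close> is presented as a quotient of a polynomial
  ring that is a type, and modules over \<open>R\<close> become subquotients of one module over that type.
\<close>

section \<open>Ideals in commutative rings as types\<close>

text \<open>That \<open>H(R/x)\<close> is Artinian comes from Noetherian induction over all ideals
  \<open>I\<close>. If \<open>I\<close> is proper and not prime, some \<open>y\<close> outside
  \<open>I\<close> makes both \<open>I : y\<close> and \<open>I + y\<close> larger, and exactness in
  the middle suffices. If \<open>I\<close> is prime and not \<open>m\<close>, an element
  \<open>y\<close> of \<open>m\<close> outside \<open>I\<close> reduces the claim to
  \<open>I + y\<close>. The start is the residue field. Flatness of the Cech terms is recorded by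
  the axioms \<open>E_quotient\<close> and \<open>E_adjoin\<close>, so exact sequences and
  connecting maps become explicit divisions by \<open>y\<close> or \<open>x\<close>. The spans fill
  \<open>H(R/x)\<close> because an equality between the spans for \<open>k\<close> and
  \<open>k + e\<close>, valid for large \<open>k\<close>, is carried down by \<open>\<phi>\<close>
  to one between those for \<open>0\<close> and \<open>e\<close>. The factor \<open>x^(p-1)\<close>
  relating \<open>\<delta>\<close> and \<open>F\<close> comes from \<open>F (x z) = x^p F z\<close>.
  On the polynomial ring \<open>F\<close> and \<open>\<phi>\<close> are only lifts: additivity,
  compatibility with \<open>d\<close> and the splitting identity are congruences modulo
  \<open>E I0\<close> or \<open>E Ix\<close>.\<close>

definition is_ideal :: "'t::comm_ring_1 set \<Rightarrow> bool" where
  "is_ideal I \<longleftrightarrow> 0 \<in> I \<and> (\<forall>a\<in>I. \<forall>b\<in>I. a + b \<in> I) \<and> (\<forall>a. \<forall>b\<in>I. a * b \<in> I)"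

definition ideal_quotient :: "'t::comm_ring_1 set \<Rightarrow> 't \<Rightarrow> 't set" where
  "ideal_quotient I y = {a. y * a \<in> I}"

definition ideal_adjoin :: "'t::comm_ring_1 set \<Rightarrow> 't \<Rightarrow> 't set" where
  "ideal_adjoin I y = {a + y * b | a b. a \<in> I}"

context
  fixes I :: "'t::comm_ring_1 set"
  assumes I: "is_ideal I"
begin

lemma ideal_0: "0 \<in> I"
  using I by (simp add: is_ideal_def)

lemma ideal_add: "a \<in> I \<Longrightarrow> b \<in> I \<Longrightarrow> a + b \<in> I"
  using I by (simp add: is_ideal_def)

lemma ideal_mult: "b \<in> I \<Longrightarrow> a * b \<in> I"
  using I by (simp add: is_ideal_def)

lemma ideal_mult_right: "a \<in> I \<Longrightarrow> a * b \<in> I"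
  using ideal_mult[of a b] by (simp add: mult.commute)

lemma ideal_minus: "a \<in> I \<Longrightarrow> - a \<in> I"
  using ideal_mult[of a "- 1"] by simp

lemma ideal_diff: "a \<in> I \<Longrightarrow> b \<in> I \<Longrightarrow> a - b \<in> I"
  using ideal_add[of a "- b"] ideal_minus[of b] by simp

lemma ideal_sum: "(\<And>k. k \<in> K \<Longrightarrow> h k \<in> I) \<Longrightarrow> sum h K \<in> I"
  by (induction K rule: infinite_finite_induct) (auto intro: ideal_0 ideal_add)

lemma ideal_one: "1 \<in> I \<Longrightarrow> I = UNIV"
  using ideal_mult[of 1] by auto

lemma ideal_quotient: "is_ideal (ideal_quotient I y)"
  unfolding is_ideal_def ideal_quotient_def
  by (auto simp: ideal_0 distrib_left ideal_add mult.left_commute intro: ideal_mult)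

lemma ideal_quotient_ge: "I \<subseteq> ideal_quotient I y"
  by (auto simp: ideal_quotient_def ideal_mult)

lemma ideal_adjoin: "is_ideal (ideal_adjoin I y)"
proof -
  have "0 \<in> ideal_adjoin I y"
    unfolding ideal_adjoin_def using ideal_0 by (force intro: exI[of _ 0])
  moreover have "u + v \<in> ideal_adjoin I y" if "u \<in> ideal_adjoin I y" "v \<in> ideal_adjoin I y" for u v
  proof -
    from that obtain a b a' b' where *: "u = a + y * b" "v = a' + y * b'" "a \<in> I" "a' \<in> I"
      by (auto simp: ideal_adjoin_def)
    then have "u + v = (a + a') + y * (b + b')" "a + a' \<in> I"
      by (auto simp: algebra_simps ideal_add)
    then show ?thesis unfolding ideal_adjoin_def by blast
  qed
  moreover have "c * u \<in> ideal_adjoin I y" if "u \<in> ideal_adjoin I y" for u c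
  proof -
    from that obtain a b where *: "u = a + y * b" "a \<in> I"
      by (auto simp: ideal_adjoin_def)
    then have "c * u = c * a + y * (c * b)" "c * a \<in> I"
      by (auto simp: distrib_left mult.left_commute ideal_mult)
    then show ?thesis unfolding ideal_adjoin_def by blast
  qed
  ultimately show ?thesis by (simp add: is_ideal_def)
qed

lemma ideal_adjoin_ge: "I \<subseteq> ideal_adjoin I y"
  unfolding ideal_adjoin_def by (force intro: exI[of _ 0])

lemma mem_ideal_adjoin: "y \<in> ideal_adjoin I y"
  unfolding ideal_adjoin_def using ideal_0 by (force intro: exI[of _ 1])

end

lemma ideal_adjoin_power_mono:
  assumes "l \<le> k"
  shows "ideal_adjoin I (y ^ k) \<subseteq> ideal_adjoin I (y ^ l)"
proof -
  have "y ^ k * b = y ^ l * (y ^ (k - l) * b)" for b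
    using assms by (simp flip: power_add mult.assoc)
  then show ?thesis unfolding ideal_adjoin_def by fastforce
qed


section \<open>The complexes of an ideal-indexed filtration\<close>

text \<open>\<open>A\<close> is a total complex of flat modules over the ring modulo \<open>I0\<close>, with differential \<open>d\<close>,
  and \<open>E I\<close> plays the role of \<open>I A\<close>. The modules \<open>cyc I\<close> and \<open>bnd I\<close> are the preimages in \<open>A\<close> of
  the cocycles and coboundaries of \<open>A / I A\<close>, so \<open>cyc I / bnd I\<close> is the cohomology with
  coefficients in the quotient by \<open>I\<close>.\<close>

locale filtered_complex = Modules.module scale
  for scale :: "'t::comm_ring_1 \<Rightarrow> 'x::ab_group_add \<Rightarrow> 'x" (infixr "*s" 75) +
  fixes I0 m :: "'t set" and A :: "'x set" and E :: "'t set \<Rightarrow> 'x set" and d :: "'x \<Rightarrow> 'x"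
  assumes I0: "is_ideal I0"
    and noeth: "wf {(J, I). is_ideal I \<and> is_ideal J \<and> I0 \<subseteq> I \<and> I \<subset> J}"
    and proper_le_m: "is_ideal I \<Longrightarrow> I0 \<subseteq> I \<Longrightarrow> I \<noteq> UNIV \<Longrightarrow> I \<subseteq> m"
    and E_subspace: "is_ideal I \<Longrightarrow> I0 \<subseteq> I \<Longrightarrow> subspace (E I)"
    and E_UNIV: "E UNIV = A"
    and E_mono: "I \<subseteq> J \<Longrightarrow> E I \<subseteq> E J"
    and E_quotient: "is_ideal I \<Longrightarrow> I0 \<subseteq> I \<Longrightarrow> g \<in> A \<Longrightarrow> y *s g \<in> E I \<longleftrightarrow> g \<in> E (ideal_quotient I y)"
    and E_adjoin: "is_ideal I \<Longrightarrow> I0 \<subseteq> I \<Longrightarrow> g \<in> E (ideal_adjoin I y) \<Longrightarrow> \<exists>h\<in>A. g - y *s h \<in> E I"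
    and d_add: "d (g + h) = d g + d h"
    and d_scale: "d (a *s g) = a *s d g"
    and d_d: "d (d g) = 0"
    and d_E: "is_ideal I \<Longrightarrow> I0 \<subseteq> I \<Longrightarrow> g \<in> E I \<Longrightarrow> d g \<in> E I"
    and residue_simple: "subspace N \<Longrightarrow> E m \<subseteq> N \<Longrightarrow> N \<subseteq> A \<Longrightarrow> N = E m \<or> N = A"
    and torsion: "is_ideal I \<Longrightarrow> I0 \<subseteq> I \<Longrightarrow> y \<in> m \<Longrightarrow> g \<in> A \<Longrightarrow> d g \<in> E I \<Longrightarrow>
      \<exists>k. \<exists>h\<in>A. y ^ k *s g - d h \<in> E I"
begin

definition cyc :: "'t set \<Rightarrow> 'x set" where
  "cyc I = {g \<in> A. d g \<in> E I}"

definition bnd :: "'t set \<Rightarrow> 'x set" where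
  "bnd I = {e + d a | e a. e \<in> E I \<and> a \<in> A}"

text \<open>Submodules of the subquotient \<open>Z / B\<close> are represented by submodules of the
  ambient module between \<open>B\<close> and \<open>Z\<close>, so no quotient is formed.\<close>

definition artinian :: "'x set \<Rightarrow> 'x set \<Rightarrow> bool" where
  "artinian B Z \<longleftrightarrow> (\<forall>N. (\<forall>k. subspace (N k) \<and> B \<subseteq> N k \<and> N k \<subseteq> Z) \<longrightarrow> decseq N \<longrightarrow>
     (\<exists>k. \<forall>j\<ge>k. N k \<subseteq> N j))"

lemma artinianI:
  assumes "\<And>N. (\<And>k. subspace (N k)) \<Longrightarrow> (\<And>k. B \<subseteq> N k) \<Longrightarrow> (\<And>k. N k \<subseteq> Z) \<Longrightarrow>
    decseq N \<Longrightarrow> \<exists>k. \<forall>j\<ge>k. N k \<subseteq> N j"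
  shows "artinian B Z"
  using assms by (simp add: artinian_def)

lemma artinianD:
  assumes "artinian B Z" "\<And>k. subspace (N k)" "\<And>k. B \<subseteq> N k" "\<And>k. N k \<subseteq> Z" "decseq N"
  obtains k where "\<And>j. j \<ge> k \<Longrightarrow> N k \<subseteq> N j"
  using assms unfolding artinian_def by metis

lemma I0_UNIV: "is_ideal UNIV" "I0 \<subseteq> UNIV"
  by (auto simp: is_ideal_def)

lemma subspace_A: "subspace A"
  using E_subspace[OF I0_UNIV] by (simp add: E_UNIV)

lemma E_le_A: "E I \<subseteq> A"
  using E_mono[of I UNIV] by (simp add: E_UNIV)

lemma d_A: "a \<in> A \<Longrightarrow> d a \<in> A"
  using d_E[OF I0_UNIV] by (simp add: E_UNIV)

lemma d_zero: "d 0 = 0"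
  using d_scale[of 0 0] by simp

lemma d_diff: "d (g - h) = d g - d h"
  using d_add[of "g - h" h] by (simp add: algebra_simps)

lemmas A_intros = subspace_add[OF subspace_A] subspace_diff[OF subspace_A]
  subspace_scale[OF subspace_A] subspace_0[OF subspace_A] subspace_neg[OF subspace_A] d_A

lemma E_scale_mem: "is_ideal I \<Longrightarrow> I0 \<subseteq> I \<Longrightarrow> g \<in> A \<Longrightarrow> y \<in> I \<Longrightarrow> y *s g \<in> E I"
proof -
  assume *: "is_ideal I" "I0 \<subseteq> I" "g \<in> A" "y \<in> I"
  then have "ideal_quotient I y = UNIV"
    by (auto simp: ideal_quotient_def ideal_mult_right)
  then show ?thesis using E_quotient[of I g y] * E_UNIV by simp
qed

context
  fixes I
  assumes I: "is_ideal I" "I0 \<subseteq> I"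
begin

lemmas E_intros = subspace_add[OF E_subspace[OF I]] subspace_diff[OF E_subspace[OF I]]
  subspace_scale[OF E_subspace[OF I]] subspace_0[OF E_subspace[OF I]] subspace_neg[OF E_subspace[OF I]]
  d_E[OF I]

lemma bndI: "g - d a \<in> E I \<Longrightarrow> a \<in> A \<Longrightarrow> g \<in> bnd I"
  unfolding bnd_def by (rule CollectI, rule exI[of _ "g - d a"], rule exI[of _ a]) simp

lemma bndE:
  assumes "g \<in> bnd I"
  obtains a where "a \<in> A" "g - d a \<in> E I"
  using assms unfolding bnd_def by auto

lemma E_le_bnd: "E I \<subseteq> bnd I"
  by (auto intro!: bndI[of _ 0] A_intros simp: d_zero)

lemma d_in_bnd: "a \<in> A \<Longrightarrow> d a \<in> bnd I"
  using bndI[of "d a" a] E_intros(4) by simp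

lemma subspace_bnd: "subspace (bnd I)"
proof (rule subspaceI)
  show "0 \<in> bnd I" using E_le_bnd E_intros(4) by auto
next
  fix g h assume "g \<in> bnd I" "h \<in> bnd I"
  then obtain a b where "a \<in> A" "g - d a \<in> E I" "b \<in> A" "h - d b \<in> E I"
    by (elim bndE)
  then have "(g + h) - d (a + b) \<in> E I" "a + b \<in> A"
    using E_intros(1)[of "g - d a" "h - d b"] by (auto simp: d_add algebra_simps A_intros)
  then show "g + h \<in> bnd I" by (rule bndI)
next
  fix c g assume "g \<in> bnd I"
  then obtain a where "a \<in> A" "g - d a \<in> E I"
    by (elim bndE)
  then have "c *s g - d (c *s a) \<in> E I" "c *s a \<in> A"
    using E_intros(3)[of "g - d a" c] by (auto simp: d_scale algebra_simps A_intros)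
  then show "c *s g \<in> bnd I" by (rule bndI)
qed

lemma subspace_cyc: "subspace (cyc I)"
  by (rule subspaceI) (auto simp: cyc_def d_zero d_add d_scale A_intros E_intros)

lemma E_le_cyc: "E I \<subseteq> cyc I"
  using E_le_A by (auto simp: cyc_def E_intros)

lemma d_in_cyc: "a \<in> A \<Longrightarrow> d a \<in> cyc I"
  by (auto simp: cyc_def d_d E_intros A_intros)

lemma bnd_le_cyc: "bnd I \<subseteq> cyc I"
  unfolding bnd_def using subspace_add[OF subspace_cyc] E_le_cyc d_in_cyc by blast

end

lemma cyc_mono: "I \<subseteq> J \<Longrightarrow> cyc I \<subseteq> cyc J"
  using E_mono unfolding cyc_def by blast


section \<open>Artinian cohomology\<close>

text \<open>Exactness of \<open>H(R/(I:y)) \<rightarrow> H(R/I) \<rightarrow> H(R/(I+y))\<close>.\<close>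

lemma artinian_extension:
  assumes I: "is_ideal I" "I0 \<subseteq> I"
    and q: "artinian (bnd (ideal_quotient I y)) (cyc (ideal_quotient I y))"
    and a: "artinian (bnd (ideal_adjoin I y)) (cyc (ideal_adjoin I y))"
  shows "artinian (bnd I) (cyc I)"
proof (rule artinianI)
  fix N assume N: "\<And>k. subspace (N k)" "\<And>k. bnd I \<subseteq> N k" "\<And>k. N k \<subseteq> cyc I" "decseq N"
  let ?Q = "ideal_quotient I y" and ?P = "ideal_adjoin I y"
  have Q: "is_ideal ?Q" "I0 \<subseteq> ?Q" and P: "is_ideal ?P" "I0 \<subseteq> ?P"
    using I(2) ideal_quotient[OF I(1)] ideal_adjoin[OF I(1)]
      ideal_quotient_ge[OF I(1), of y] ideal_adjoin_ge[OF I(1), of y] by auto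
  \<comment> \<open>\<open>M1\<close> is the preimage of the chain under multiplication by
    \<open>y\<close> from \<open>H(R/(I:y))\<close>, and \<open>M2\<close> is its image in
    \<open>H(R/(I+y))\<close>. Both chains become constant.\<close>
  define M1 where "M1 k = {g \<in> A. y *s g \<in> N k}" for k
  define M2 where "M2 k = {u + v | u v. u \<in> N k \<and> v \<in> bnd ?P}" for k
  have N_mono: "N j \<subseteq> N k" if "k \<le> j" for j k using N(4) that by (auto simp: decseq_def)
  have "subspace (M1 k)" for k
  proof (rule subspaceI)
    show "c *s g \<in> M1 k" if "g \<in> M1 k" for c g
      using that subspace_scale[OF N(1), of "y *s g" k c] by (auto simp: M1_def A_intros mult.commute)
  qed (auto simp: M1_def A_intros scale_right_distrib subspace_0[OF N(1)] subspace_add[OF N(1)])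
  moreover have "bnd ?Q \<subseteq> M1 k" for k
  proof
    fix g assume "g \<in> bnd ?Q"
    then obtain a where a: "a \<in> A" "g - d a \<in> E ?Q" by (elim bndE[OF Q])
    then have g: "g \<in> A" using A_intros(1)[of "g - d a" "d a"] d_A E_le_A by auto
    have "y *s (g - d a) \<in> E I" using E_quotient[OF I] a(2) E_le_A by blast
    then have "y *s g - d (y *s a) \<in> E I" by (simp add: d_scale algebra_simps)
    then have "y *s g \<in> bnd I" using bndI[OF I] a(1) A_intros by blast
    then show "g \<in> M1 k" using g N(2) by (auto simp: M1_def)
  qed
  moreover have "M1 k \<subseteq> cyc ?Q" for k
  proof
    fix g assume "g \<in> M1 k"
    then have g: "g \<in> A" "y *s g \<in> cyc I" using N(3) by (auto simp: M1_def)
    then have "y *s d g \<in> E I" by (auto simp: cyc_def d_scale)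
    then show "g \<in> cyc ?Q" using E_quotient[OF I d_A] g by (auto simp: cyc_def)
  qed
  moreover have "decseq M1" unfolding decseq_def M1_def using N_mono by blast
  ultimately obtain k1 where k1: "\<And>j. j \<ge> k1 \<Longrightarrow> M1 k1 \<subseteq> M1 j"
    using artinianD[OF q, of M1] by blast
  have "subspace (M2 k)" for k
  proof -
    have *: "span (N k) = N k" "span (bnd ?P) = bnd ?P" using N(1) subspace_bnd[OF P] by simp_all
    show ?thesis using subspace_span[of "N k \<union> bnd ?P"] unfolding span_Un M2_def * .
  qed
  moreover have "bnd ?P \<subseteq> M2 k" for k
  proof
    fix v assume "v \<in> bnd ?P"
    then have "0 + v \<in> M2 k" using subspace_0[OF N(1)] unfolding M2_def by blast
    then show "v \<in> M2 k" by simp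
  qed
  moreover have "M2 k \<subseteq> cyc ?P" for k
  proof
    fix g assume "g \<in> M2 k"
    then obtain u v where uv: "g = u + v" "u \<in> N k" "v \<in> bnd ?P" by (auto simp: M2_def)
    have "u \<in> cyc ?P" using uv(2) N(3) cyc_mono[OF ideal_adjoin_ge[OF I(1)]] by blast
    then show "g \<in> cyc ?P"
      using uv bnd_le_cyc[OF P] subspace_add[OF subspace_cyc[OF P]] by blast
  qed
  moreover have "decseq M2" unfolding decseq_def M2_def using N_mono by blast
  ultimately obtain k2 where k2: "\<And>j. j \<ge> k2 \<Longrightarrow> M2 k2 \<subseteq> M2 j"
    using artinianD[OF a, of M2] by blast
  have M1_stable: "M1 (max k1 k2) \<subseteq> M1 j" and M2_stable: "M2 (max k1 k2) \<subseteq> M2 j"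
    if "j \<ge> max k1 k2" for j
    using k1[of j] k2[of j] that decseqD[OF \<open>decseq M1\<close>, of k1 "max k1 k2"]
      decseqD[OF \<open>decseq M2\<close>, of k2 "max k1 k2"] by auto
  have "N (max k1 k2) \<subseteq> N j" if j: "j \<ge> max k1 k2" for j
  proof
    let ?k = "max k1 k2"
    fix u assume u: "u \<in> N ?k"
    have "u + 0 \<in> M2 ?k"
      unfolding M2_def using u subspace_0[OF subspace_bnd[OF P]] by blast
    then obtain v w where vw: "u = v + w" "v \<in> N j" "w \<in> bnd ?P"
      using subsetD[OF M2_stable[OF j], of u] by (auto simp: M2_def)
    obtain a where a: "a \<in> A" "w - d a \<in> E ?P" using vw(3) by (elim bndE[OF P])
    obtain h where h: "h \<in> A" "w - d a - y *s h \<in> E I" using E_adjoin[OF I a(2)] by blast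
    \<comment> \<open>Modulo coboundaries the error \<open>w\<close> is a multiple
      \<open>y *s h\<close>, so it comes from \<open>H(R/(I:y))\<close>, where stability of
      \<open>M1\<close> applies.\<close>
    have "w - y *s h \<in> bnd I"
      using h a by (intro bndI[OF I, of _ a]) (auto simp: algebra_simps)
    then have "v + (w - y *s h) \<in> N j"
      using vw(2) N(2) subspace_add[OF N(1)] by blast
    then have v': "u - y *s h \<in> N j" by (simp add: vw(1) algebra_simps)
    then have "u - (u - y *s h) \<in> N ?k"
      using u N_mono[OF j] subspace_diff[OF N(1)] by blast
    then have "h \<in> M1 ?k" using h by (simp add: M1_def)
    then have "y *s h \<in> N j" using M1_stable[OF j] by (auto simp: M1_def)
    then show "u \<in> N j" using subspace_add[OF N(1) v', of "y *s h"] by simp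
  qed
  then show "\<exists>k. \<forall>j\<ge>k. N k \<subseteq> N j" by blast
qed

text \<open>Melkersson's argument: a \<open>y\<close>-torsion module is Artinian if the kernel of \<open>y\<close> is.\<close>

lemma artinian_of_kernel:
  assumes I: "is_ideal I" "I0 \<subseteq> I" and y: "y \<in> m"
    and K: "artinian (bnd I) {u \<in> cyc I. y *s u \<in> bnd I}"
  shows "artinian (bnd I) (cyc I)"
proof (rule artinianI)
  fix N assume N: "\<And>k. subspace (N k)" "\<And>k. bnd I \<subseteq> N k" "\<And>k. N k \<subseteq> cyc I" "decseq N"
  have N_mono: "N j \<subseteq> N k" if "k \<le> j" for j k using N(4) that by (auto simp: decseq_def)
  note b = subspace_bnd[OF I] and c = subspace_cyc[OF I]
  let ?K = "{u \<in> cyc I. y *s u \<in> bnd I}"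
  \<comment> \<open>\<open>L e k\<close> represents the intersection of \<open>y ^ k\<close> times
    \<open>N e\<close> with the kernel of \<open>y\<close> in cohomology; it shrinks in both
    indices.\<close>
  define L where "L e k = {v \<in> ?K. \<exists>u\<in>N e. v - y ^ k *s u \<in> bnd I}" for e k
  have L_sub: "subspace (L e k)" for e k
  proof (rule subspaceI)
    show "0 \<in> L e k"
      using subspace_0[OF N(1)] by (auto simp: L_def subspace_0[OF b] subspace_0[OF c] intro!: bexI[of _ 0])
  next
    fix v v' assume "v \<in> L e k" "v' \<in> L e k"
    then obtain u u' where u: "v \<in> ?K" "v' \<in> ?K" "u \<in> N e" "u' \<in> N e" "v - y ^ k *s u \<in> bnd I"
      "v' - y ^ k *s u' \<in> bnd I" by (auto simp: L_def)
    have "(v + v') - y ^ k *s (u + u') \<in> bnd I"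
      using subspace_add[OF b u(5,6)] by (simp add: algebra_simps)
    moreover have "y *s (v + v') \<in> bnd I"
      using u(1,2) subspace_add[OF b, of "y *s v" "y *s v'"] by (simp add: scale_right_distrib)
    ultimately show "v + v' \<in> L e k" using u subspace_add[OF N(1)] subspace_add[OF c]
      unfolding L_def by blast
  next
    fix a v assume "v \<in> L e k"
    then obtain u where u: "v \<in> ?K" "u \<in> N e" "v - y ^ k *s u \<in> bnd I"
      by (auto simp: L_def)
    have "a *s v - y ^ k *s (a *s u) \<in> bnd I"
      using subspace_scale[OF b u(3), of a] by (simp add: algebra_simps)
    moreover have "y *s (a *s v) \<in> bnd I"
      using subspace_scale[OF b, of "y *s v" a] u by (simp add: mult.commute)
    ultimately show "a *s v \<in> L e k" using u subspace_scale[OF N(1)] subspace_scale[OF c]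
      by (auto simp: L_def simp del: scale_scale)
  qed
  have L_ge: "bnd I \<subseteq> L e k" for e k
    using bnd_le_cyc[OF I] subspace_0[OF N(1)] subspace_scale[OF b]
    by (auto simp: L_def intro!: bexI[of _ 0])
  have L_le: "L e k \<subseteq> ?K" for e k by (auto simp: L_def)
  have L_mono: "L e' k' \<subseteq> L e k" if "e \<le> e'" "k \<le> k'" for e e' k k'
  proof
    fix v assume "v \<in> L e' k'"
    then obtain u where u: "v \<in> ?K" "u \<in> N e'" "v - y ^ k' *s u \<in> bnd I"
      by (auto simp: L_def)
    have "y ^ k' *s u = y ^ k *s (y ^ (k' - k) *s u)" using that by (simp flip: power_add)
    moreover have "y ^ (k' - k) *s u \<in> N e"
      using u(2) N_mono that subspace_scale[OF N(1)] by blast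
    ultimately show "v \<in> L e k" using u by (auto simp: L_def simp del: scale_scale)
  qed
  have dec: "decseq (\<lambda>k. L k k)" by (simp add: decseq_def L_mono)
  \<comment> \<open>The diagonal becomes constant at \<open>k0\<close>, which controls all
    \<open>k \<ge> k0\<close>. Each of the finitely many \<open>k < k0\<close> has its own bound
    \<open>e k\<close>, and \<open>s\<close> dominates all these bounds.\<close>
  obtain k0 where k0: "\<And>j. j \<ge> k0 \<Longrightarrow> L k0 k0 \<subseteq> L j j"
    by (rule artinianD[OF K, where N = "\<lambda>k. L k k", OF L_sub L_ge L_le dec]) blast
  have "\<exists>e. \<forall>j\<ge>e. L e k \<subseteq> L j k" for k
  proof -
    have dec: "decseq (\<lambda>e. L e k)" by (simp add: decseq_def L_mono)
    show ?thesis
      by (rule artinianD[OF K, where N = "\<lambda>e. L e k", OF L_sub L_ge L_le dec]) blast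
  qed
  then have "\<forall>k. \<exists>e. \<forall>j\<ge>e. L e k \<subseteq> L j k" by blast
  from choice[OF this] obtain e where e: "\<And>k j. j \<ge> e k \<Longrightarrow> L (e k) k \<subseteq> L j k" by blast
  define s where "s = Max (insert k0 (e ` {..<k0}))"
  have s_ge: "k0 \<le> s" "\<And>k. k < k0 \<Longrightarrow> e k \<le> s" by (auto simp: s_def)
  have L_stable: "L s k \<subseteq> L j k" if "j \<ge> s" for j k
  proof (cases "k < k0")
    case True
    then show ?thesis using e[of k j] L_mono[of "e k" s k k] s_ge(2)[of k] that by fastforce
  next
    case False
    then have "L s k \<subseteq> L k0 k0" using L_mono s_ge(1) by simp
    also have "\<dots> \<subseteq> L (max j k) (max j k)" using k0 False by simp
    also have "\<dots> \<subseteq> L j k" using L_mono by simp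
    finally show ?thesis .
  qed
  \<comment> \<open>Induction on the power of \<open>y\<close> that kills \<open>u\<close>: one
    power lower the multiple lies in the kernel of \<open>y\<close>, hence in \<open>L s k\<close>,
    so it is also \<open>y ^ k\<close> times some \<open>u'\<close> in \<open>N j\<close>. The
    difference \<open>u - u'\<close> is killed by \<open>y ^ k\<close>.\<close>
  have key: "u \<in> N j" if j: "j \<ge> s" and "u \<in> N s" "y ^ k *s u \<in> bnd I" for u k j
    using that(2,3)
  proof (induction k arbitrary: u)
    case 0
    then show ?case using N(2) by auto
  next
    case (Suc k)
    have "y ^ k *s u \<in> L s k"
      using Suc.prems N(3) subspace_scale[OF c] subspace_0[OF b]
      by (auto simp: L_def intro!: bexI[of _ u])
    then obtain u' where u': "u' \<in> N j" "y ^ k *s u - y ^ k *s u' \<in> bnd I"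
      using subsetD[OF L_stable[OF j], of "y ^ k *s u" k] by (auto simp: L_def)
    then have "u - u' \<in> N j"
      using Suc N_mono[OF j] subspace_diff[OF N(1)] by (simp add: scale_right_diff_distrib subset_iff)
    then show ?case using subspace_add[OF N(1) _ u'(1), of "u - u'"] by simp
  qed
  have "N s \<subseteq> N j" if j: "j \<ge> s" for j
  proof
    fix u assume u: "u \<in> N s"
    then have "u \<in> A" "d u \<in> E I" using N(3) by (auto simp: cyc_def)
    then obtain k h where "h \<in> A" "y ^ k *s u - d h \<in> E I" using torsion[OF I y] by blast
    then show "u \<in> N j" using key[OF j u] bndI[OF I] by blast
  qed
  then show "\<exists>k. \<forall>j\<ge>k. N k \<subseteq> N j" by blast
qed

text \<open>If \<open>y\<close> is regular modulo \<open>I\<close>, the connecting map sends \<open>H(R/(I+y))\<close> onto the kernel of \<open>y\<close>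
  on \<open>H(R/I)\<close>.\<close>

lemma artinian_kernel:
  assumes I: "is_ideal I" "I0 \<subseteq> I" and y: "ideal_quotient I y = I"
    and a: "artinian (bnd (ideal_adjoin I y)) (cyc (ideal_adjoin I y))"
  shows "artinian (bnd I) {u \<in> cyc I. y *s u \<in> bnd I}"
proof (rule artinianI)
  let ?K = "{u \<in> cyc I. y *s u \<in> bnd I}"
  fix N assume N: "\<And>k. subspace (N k)" "\<And>k. bnd I \<subseteq> N k" "\<And>k. N k \<subseteq> ?K" "decseq N"
  have N_mono: "N j \<subseteq> N k" if "k \<le> j" for j k using N(4) that by (auto simp: decseq_def)
  let ?P = "ideal_adjoin I y"
  have P: "is_ideal ?P" "I0 \<subseteq> ?P" using I(2) ideal_adjoin[OF I(1)] ideal_adjoin_ge[OF I(1), of y] by auto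
  note i = E_intros[OF I]
  \<comment> \<open>\<open>M k\<close> is the preimage of \<open>N k\<close> under the connecting
    map, which sends \<open>g\<close> to the \<open>u\<close> with \<open>d g = y *s u\<close>
    modulo \<open>E I\<close>.\<close>
  define M where "M k = {g \<in> A. \<exists>u\<in>N k. d g - y *s u \<in> E I}" for k
  have "subspace (M k)" for k
  proof (rule subspaceI)
    show "0 \<in> M k" using subspace_0[OF N(1)]
      by (auto simp: M_def d_zero A_intros i intro!: bexI[of _ 0])
  next
    fix g h assume "g \<in> M k" "h \<in> M k"
    then obtain u v where u: "g \<in> A" "h \<in> A" "u \<in> N k" "v \<in> N k" "d g - y *s u \<in> E I"
      "d h - y *s v \<in> E I" by (auto simp: M_def)
    have "d (g + h) - y *s (u + v) \<in> E I"
      using i(1)[OF u(5,6)] by (simp add: algebra_simps d_add)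
    then show "g + h \<in> M k" using u subspace_add[OF N(1)] by (auto simp: M_def A_intros)
  next
    fix a g assume "g \<in> M k"
    then obtain u where u: "g \<in> A" "u \<in> N k" "d g - y *s u \<in> E I" by (auto simp: M_def)
    have "d (a *s g) - y *s (a *s u) \<in> E I"
      using i(3)[OF u(3), of a] by (simp add: algebra_simps d_scale)
    then show "a *s g \<in> M k" using u subspace_scale[OF N(1)] by (auto simp: M_def A_intros simp del: scale_scale)
  qed
  moreover have "bnd ?P \<subseteq> M k" for k
  proof
    fix g assume "g \<in> bnd ?P"
    then obtain a where a: "a \<in> A" "g - d a \<in> E ?P" by (elim bndE[OF P])
    then have g: "g \<in> A" using A_intros(1)[of "g - d a" "d a"] d_A E_le_A by auto
    obtain h where h: "h \<in> A" "g - d a - y *s h \<in> E I" using E_adjoin[OF I a(2)] by blast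
    have "d g - y *s d h \<in> E I"
      using i(6)[OF h(2)] by (simp add: d_diff d_d d_scale)
    moreover have "d h \<in> N k" using N(2) d_in_bnd[OF I] h by blast
    ultimately show "g \<in> M k" using g by (auto simp: M_def)
  qed
  moreover have "M k \<subseteq> cyc ?P" for k
  proof
    fix g assume "g \<in> M k"
    then obtain u where u: "g \<in> A" "u \<in> N k" "d g - y *s u \<in> E I" by (auto simp: M_def)
    have uA: "u \<in> A" using u(2) N(3) by (auto simp: cyc_def)
    have "y *s u \<in> E ?P" using E_scale_mem[OF P uA] mem_ideal_adjoin[OF I(1)] by blast
    then have "d g - y *s u + y *s u \<in> E ?P"
      using u(3) E_mono[OF ideal_adjoin_ge[OF I(1)]] E_intros(1)[OF P] by blast
    then show "g \<in> cyc ?P" using u by (simp add: cyc_def)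
  qed
  moreover have "decseq M" unfolding decseq_def M_def using N_mono by blast
  ultimately obtain k where k: "\<And>j. j \<ge> k \<Longrightarrow> M k \<subseteq> M j"
    using artinianD[OF a, of M] by blast
  have "N k \<subseteq> N j" if j: "j \<ge> k" for j
  proof
    fix u assume u: "u \<in> N k"
    then have "u \<in> A" "y *s u \<in> bnd I" using N(3) by (auto simp: cyc_def)
    then obtain g where g: "g \<in> A" "y *s u - d g \<in> E I" by (elim bndE[OF I])
    have "d g - y *s u \<in> E I" using i(5)[OF g(2)] by simp
    then have "g \<in> M k" using g u by (auto simp: M_def)
    then obtain u' where u': "u' \<in> N j" "d g - y *s u' \<in> E I" using k[OF j] by (auto simp: M_def)
    have "u' \<in> A" using u'(1) N(3) by (auto simp: cyc_def)
    have "y *s (u - u') \<in> E I"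
      using i(1)[OF u'(2) g(2)] by (simp add: algebra_simps)
    \<comment> \<open>Regularity of \<open>y\<close> modulo \<open>I\<close> makes the division of
      \<open>d g\<close> by \<open>y\<close> unique modulo \<open>E I\<close>.\<close>
    then have "u - u' \<in> E I" using E_quotient[OF I, of "u - u'" y] y \<open>u \<in> A\<close> \<open>u' \<in> A\<close> A_intros by simp
    then have "u - u' \<in> N j" using N(2) E_le_bnd[OF I] by blast
    then show "u \<in> N j" using subspace_add[OF N(1) _ u'(1), of "u - u'"] by simp
  qed
  then show "\<exists>k. \<forall>j\<ge>k. N k \<subseteq> N j" by blast
qed

text \<open>Since \<open>A / E m\<close> is simple, each member of the chain is \<open>E m\<close>
  or \<open>A\<close>; once \<open>E m\<close> occurs the chain stays there, and otherwise it is
  constantly \<open>A\<close>.\<close>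

lemma artinian_residue: "artinian (bnd m) (cyc m)" if m: "is_ideal m" "I0 \<subseteq> m"
proof (rule artinianI)
  fix N assume N: "\<And>k. subspace (N k)" "\<And>k. bnd m \<subseteq> N k" "\<And>k. N k \<subseteq> cyc m" "decseq N"
  have "N k = E m \<or> N k = A" for k
  proof (rule residue_simple[OF N(1)])
    show "E m \<subseteq> N k" using E_le_bnd[OF m] N(2) by blast
    show "N k \<subseteq> A" using N(3)[of k] by (auto simp: cyc_def)
  qed
  moreover have "E m \<subseteq> N k" for k using E_le_bnd[OF m] N(2) by blast
  ultimately show "\<exists>k. \<forall>j\<ge>k. N k \<subseteq> N j"
    by (cases "\<exists>k. N k = E m") (blast, metis order_refl)
qed

text \<open>Well-foundedness of strict enlargement of ideals allows the claim to be assumed for all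
  larger ideals. In the third case every \<open>y\<close> outside \<open>I\<close> is regular modulo
  \<open>I\<close>, that is, \<open>I\<close> is prime; for \<open>I \<noteq> m\<close> the
  induction hypothesis for \<open>I + y\<close> bounds the kernel of \<open>y\<close>, and torsion
  does the rest.\<close>

theorem artinian_cohomology:
  assumes "is_ideal I" "I0 \<subseteq> I"
  shows "artinian (bnd I) (cyc I)"
  using noeth assms
proof (induction I rule: wf_induct_rule)
  case (less I)
  note I = less.prems
  have IH: "artinian (bnd J) (cyc J)" if "is_ideal J" "I \<subset> J" for J
    using less.IH[of J] that I by auto
  consider "I = UNIV" | y where "y \<notin> I" "ideal_quotient I y \<noteq> I"
    | "I \<noteq> UNIV" "\<And>y. y \<notin> I \<Longrightarrow> ideal_quotient I y = I" by blast
  then show ?case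
  proof cases
    case 1
    then have "bnd I = A" "cyc I = A"
      using E_le_bnd[OF I] bnd_le_cyc[OF I] E_UNIV by (auto simp: cyc_def)
    then have "\<forall>j\<ge>0. N 0 \<subseteq> N j" if "\<And>k. bnd I \<subseteq> N k" "\<And>k. N k \<subseteq> cyc I" for N :: "nat \<Rightarrow> 'x set"
      using that by blast
    then show ?thesis by (intro artinianI) blast
  next
    case 2
    have "artinian (bnd (ideal_quotient I y)) (cyc (ideal_quotient I y))"
      using IH 2 ideal_quotient[OF I(1)] ideal_quotient_ge[OF I(1)] by blast
    moreover have "artinian (bnd (ideal_adjoin I y)) (cyc (ideal_adjoin I y))"
      using IH 2 ideal_adjoin[OF I(1)] ideal_adjoin_ge[OF I(1)] mem_ideal_adjoin[OF I(1)] by blast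
    ultimately show ?thesis by (rule artinian_extension[OF I])
  next
    case 3
    show ?thesis
    proof (cases "I = m")
      case True
      then show ?thesis using artinian_residue I by simp
    next
      case False
      then obtain y where y: "y \<in> m" "y \<notin> I" using proper_le_m[OF I 3(1)] by blast
      have "artinian (bnd (ideal_adjoin I y)) (cyc (ideal_adjoin I y))"
        using IH y ideal_adjoin[OF I(1)] ideal_adjoin_ge[OF I(1)] mem_ideal_adjoin[OF I(1)] by blast
      then show ?thesis
        using artinian_of_kernel[OF I y(1)] artinian_kernel[OF I 3(2)[OF y(2)]] by blast
    qed
  qed
qed

end

section \<open>Frobenius actions and splittings\<close>

text \<open>\<open>F\<close> is a lift to \<open>A\<close> of the Frobenius action modulo \<open>I0\<close>, and \<open>\<phi>\<close> is a lift of the map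
  induced on \<open>A / (I0 + x) A\<close> by a splitting, whose values on scalars are lifted by \<open>\<phi>0\<close>.\<close>

locale frobenius_complex = filtered_complex scale I0 m A E d
  for scale :: "'t::comm_ring_1 \<Rightarrow> 'x::ab_group_add \<Rightarrow> 'x" (infixr "*s" 75) and I0 m A E d +
  fixes p :: nat and x :: 't and F \<phi> :: "'x \<Rightarrow> 'x" and \<phi>0 :: "'t \<Rightarrow> 't"
  assumes p: "1 < p"
    and x_m: "x \<in> m"
    and x_regular: "ideal_quotient I0 x = I0"
    and F_A: "g \<in> A \<Longrightarrow> F g \<in> A"
    and F_add: "g \<in> A \<Longrightarrow> h \<in> A \<Longrightarrow> F (g + h) - (F g + F h) \<in> E I0"
    and F_scale: "F (a *s g) = a ^ p *s F g"
    and F_E: "g \<in> E I0 \<Longrightarrow> F g \<in> E I0"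
    and F_d: "g \<in> A \<Longrightarrow> F (d g) - d (F g) \<in> E I0"
    and phi_A: "g \<in> A \<Longrightarrow> \<phi> g \<in> A"
    and phi_add: "g \<in> A \<Longrightarrow> h \<in> A \<Longrightarrow> \<phi> (g + h) - (\<phi> g + \<phi> h) \<in> E (ideal_adjoin I0 x)"
    and phi_E: "g \<in> E (ideal_adjoin I0 x) \<Longrightarrow> \<phi> g \<in> E (ideal_adjoin I0 x)"
    and phi_d: "g \<in> A \<Longrightarrow> \<phi> (d g) - d (\<phi> g) \<in> E (ideal_adjoin I0 x)"
    and phi_scale_F: "g \<in> A \<Longrightarrow> \<phi> (a *s F g) - \<phi>0 a *s g \<in> E (ideal_adjoin I0 x)"
    and phi_F: "g \<in> A \<Longrightarrow> \<phi> (F g) - g \<in> E (ideal_adjoin I0 x)"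
begin

section \<open>The Frobenius lift and the filtration by powers of \<open>x\<close>\<close>

abbreviation P :: "nat \<Rightarrow> 't set" where
  "P l \<equiv> ideal_adjoin I0 (x ^ l)"

abbreviation Ix :: "'t set" where
  "Ix \<equiv> ideal_adjoin I0 x"

lemma I0_self: "is_ideal I0" "I0 \<subseteq> I0"
  by (auto simp: I0)

lemma P: "is_ideal (P l)" "I0 \<subseteq> P l"
  using ideal_adjoin[OF I0] ideal_adjoin_ge[OF I0] by auto

lemma Ix: "is_ideal Ix" "I0 \<subseteq> Ix"
  using P[of 1] by simp_all

lemma E_I0_le: "E I0 \<subseteq> E (P l)" "E I0 \<subseteq> E Ix"
  using E_mono P Ix by blast+

lemma scale_mem_E_P: "h \<in> A \<Longrightarrow> x ^ l *s h \<in> E (P l)"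
  using E_scale_mem[OF P] mem_ideal_adjoin[OF I0] by blast

lemma E_PI: "g - x ^ l *s h \<in> E I0 \<Longrightarrow> h \<in> A \<Longrightarrow> g \<in> E (P l)"
  using E_intros(1)[OF P, of "g - x ^ l *s h" l "x ^ l *s h"] scale_mem_E_P E_I0_le(1) by auto

lemma P_le_Ix: "0 < l \<Longrightarrow> P l \<subseteq> Ix"
  using ideal_adjoin_power_mono[of 1 l I0 x] by simp

lemma F_cong: "g \<in> A \<Longrightarrow> h \<in> A \<Longrightarrow> g - h \<in> E I0 \<Longrightarrow> F g - F h \<in> E I0"
  using F_add[of "g - h" h] E_intros(1)[OF I0_self F_E, of "g - h" "F g - (F (g - h) + F h)"]
  by (simp add: A_intros algebra_simps)

text \<open>Since \<open>F (x ^ k *s h) = x ^ (k * p) *s F h\<close>, the Frobenius multiplies the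
  exponent of \<open>x\<close> by \<open>p\<close>. This is why its iterates on cocycles modulo
  \<open>x\<close> produce cocycles modulo high powers of \<open>x\<close>.\<close>

lemma F_E_P: "g \<in> E (P k) \<Longrightarrow> F g \<in> E (P (k * p))"
proof -
  assume g: "g \<in> E (P k)"
  then have "g \<in> A" using E_le_A by blast
  obtain h where h: "h \<in> A" "g - x ^ k *s h \<in> E I0" using E_adjoin[OF I0_self g] by blast
  then have "F g - F (x ^ k *s h) \<in> E I0" using F_cong[OF \<open>g \<in> A\<close> A_intros(3)[OF h(1)]] by simp
  then show ?thesis using E_PI[of "F g" "k * p" "F h"] F_A h(1) by (simp add: F_scale power_mult)
qed

lemma F_cyc: "g \<in> cyc (P k) \<Longrightarrow> F g \<in> cyc (P (k * p))"
proof -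
  assume "g \<in> cyc (P k)"
  then have g: "g \<in> A" "d g \<in> E (P k)" by (auto simp: cyc_def)
  have "F (d g) - (F (d g) - d (F g)) \<in> E (P (k * p))"
    using F_E_P[OF g(2)] subsetD[OF E_I0_le(1) F_d[OF g(1)]] by (rule E_intros(2)[OF P])
  then show ?thesis using F_A g(1) by (auto simp: cyc_def)
qed

lemma F_funpow_cyc: "g \<in> cyc Ix \<Longrightarrow> (F ^^ e) g \<in> cyc (P (p ^ e))"
  by (induction e) (use F_cyc[of _ "p ^ _"] in \<open>simp_all add: mult.commute\<close>)

lemma F_cyc_Ix: "g \<in> cyc Ix \<Longrightarrow> F g \<in> cyc Ix"
  using F_cyc[of g 1] cyc_mono[OF P_le_Ix[of p]] p by auto

lemma phi_bnd: "g \<in> bnd Ix \<Longrightarrow> \<phi> g \<in> bnd Ix"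
proof -
  assume "g \<in> bnd Ix"
  then obtain a where a: "a \<in> A" "g - d a \<in> E Ix" by (elim bndE[OF Ix])
  let ?e = "g - d a"
  note i = E_intros[OF Ix]
  have "\<phi> (?e + d a) - (\<phi> ?e + \<phi> (d a)) \<in> E Ix"
    using a(2) E_le_A by (intro phi_add d_A a) auto
  then have "\<phi> g - (\<phi> ?e + \<phi> (d a)) + \<phi> ?e + (\<phi> (d a) - d (\<phi> a)) \<in> E Ix"
    unfolding diff_add_cancel by (intro i(1) phi_E phi_d a)
  then show ?thesis using bndI[OF Ix, of "\<phi> g" "\<phi> a"] phi_A[OF a(1)] by (simp add: algebra_simps)
qed

text \<open>The image of a Frobenius power is not a submodule, as \<open>F\<close> is only
  \<open>p\<close>-linear; hence the span, taken together with the coboundaries modulo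
  \<open>x\<close>.\<close>

definition Fspan :: "nat \<Rightarrow> 'x set" where
  "Fspan e = span (bnd Ix \<union> (F ^^ e) ` cyc Ix)"

lemma Fspan: "subspace (Fspan e)" "bnd Ix \<subseteq> Fspan e" "E Ix \<subseteq> Fspan e" "z \<in> cyc Ix \<Longrightarrow> (F ^^ e) z \<in> Fspan e"
  using span_superset[of "bnd Ix \<union> (F ^^ e) ` cyc Ix"] E_le_bnd[OF Ix] by (auto simp: Fspan_def)

lemma F_funpow_cyc_Ix: "g \<in> cyc Ix \<Longrightarrow> (F ^^ e) g \<in> cyc Ix"
  by (induction e) (auto intro: F_cyc_Ix)

lemma Fspan_minimal:
  "subspace S \<Longrightarrow> bnd Ix \<subseteq> S \<Longrightarrow> (\<And>z. z \<in> cyc Ix \<Longrightarrow> (F ^^ e) z \<in> S) \<Longrightarrow> Fspan e \<subseteq> S"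
  unfolding Fspan_def by (rule span_minimal) auto

lemma Fspan_le_cyc: "Fspan e \<subseteq> cyc Ix"
  by (intro Fspan_minimal subspace_cyc[OF Ix] bnd_le_cyc[OF Ix] F_funpow_cyc_Ix)

lemma decseq_Fspan: "decseq Fspan"
proof (rule decseq_SucI)
  show "Fspan (Suc e) \<subseteq> Fspan e" for e
    by (intro Fspan_minimal Fspan) (auto simp: funpow_Suc_right simp del: funpow.simps intro!: Fspan F_cyc_Ix)
qed

text \<open>On a generator the splitting removes one Frobenius:
  \<open>\<phi> (a *s F ((F ^^ e) z))\<close> equals \<open>\<phi>0 a *s (F ^^ e) z\<close> modulo
  \<open>E Ix\<close>.\<close>

lemma phi_Fspan:
  assumes "u \<in> Fspan (Suc e)"
  shows "\<phi> u \<in> Fspan e"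
proof -
  note i = E_intros[OF Ix]
  \<comment> \<open>Because \<open>\<phi>\<close> is not linear over the ring, the condition on
    \<open>u\<close> alone is not visibly stable under scalars; quantifying over all multiples of
    \<open>u\<close> makes \<open>S\<close> a submodule.\<close>
  define S where "S = {u \<in> A. \<forall>a. \<phi> (a *s u) \<in> Fspan e}"
  have "Fspan (Suc e) \<subseteq> S"
  proof (rule Fspan_minimal)
    show "bnd Ix \<subseteq> S"
      using bnd_le_cyc[OF Ix] subspace_scale[OF subspace_bnd[OF Ix]] phi_bnd Fspan(2)
      by (fastforce simp: S_def cyc_def)
    show "subspace S"
    proof (rule subspaceI)
      show "0 \<in> S"
        using phi_bnd[of 0] subspace_0[OF subspace_bnd[OF Ix]] Fspan(2) by (auto simp: S_def A_intros)
    next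
      fix u v assume uv: "u \<in> S" "v \<in> S"
      have "\<phi> (a *s (u + v)) \<in> Fspan e" for a
      proof -
        have "\<phi> (a *s u + a *s v) - (\<phi> (a *s u) + \<phi> (a *s v)) \<in> E Ix"
          using uv by (intro phi_add) (auto simp: S_def A_intros)
        then have "\<phi> (a *s u + a *s v) - (\<phi> (a *s u) + \<phi> (a *s v)) + (\<phi> (a *s u) + \<phi> (a *s v)) \<in> Fspan e"
          using uv Fspan(3) by (intro subspace_add[OF Fspan(1)]) (auto simp: S_def)
        then show ?thesis by (simp add: scale_right_distrib)
      qed
      then show "u + v \<in> S" using uv by (auto simp: S_def A_intros)
    next
      fix a u assume "u \<in> S"
      then show "a *s u \<in> S" by (auto simp: S_def A_intros)
    qed
  next
    fix z assume z: "z \<in> cyc Ix"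
    then have zA: "(F ^^ e) z \<in> A" using F_funpow_cyc_Ix by (auto simp: cyc_def)
    have "\<phi> (a *s F ((F ^^ e) z)) - \<phi>0 a *s (F ^^ e) z + \<phi>0 a *s (F ^^ e) z \<in> Fspan e" for a
      using phi_scale_F[OF zA] Fspan(3) Fspan(4)[OF z] subspace_scale[OF Fspan(1)]
      by (intro subspace_add[OF Fspan(1)]) auto
    then show "(F ^^ Suc e) z \<in> S" using zA F_A by (simp add: S_def)
  qed
  then have "\<phi> (1 *s u) \<in> Fspan e" using assms unfolding S_def by blast
  then show ?thesis by simp
qed

text \<open>Apply \<open>\<phi>\<close> to \<open>F ((F ^^ i) z)\<close>: it returns the generator
  \<open>(F ^^ i) z\<close> modulo \<open>E Ix\<close>, and by \<open>phi_Fspan\<close> the result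
  lies in \<open>Fspan j\<close>.\<close>

lemma Fspan_shift: "Fspan (Suc i) \<subseteq> Fspan (Suc j) \<Longrightarrow> Fspan i \<subseteq> Fspan j"
proof (intro Fspan_minimal Fspan)
  fix z assume *: "Fspan (Suc i) \<subseteq> Fspan (Suc j)" and z: "z \<in> cyc Ix"
  let ?z = "(F ^^ i) z"
  have zA: "?z \<in> A" using F_funpow_cyc_Ix[OF z] by (auto simp: cyc_def)
  have "F ?z \<in> Fspan (Suc j)" using Fspan(4)[OF z, of "Suc i"] * by auto
  then have "\<phi> (F ?z) - (\<phi> (F ?z) - ?z) \<in> Fspan j"
    by (rule subspace_diff[OF Fspan(1) phi_Fspan subsetD[OF Fspan(3) phi_F[OF zA]]])
  then show "?z \<in> Fspan j" by simp
qed

text \<open>Stability at some \<open>k\<close> gives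
  \<open>Fspan k \<subseteq> Fspan (k + e)\<close>. Descending with \<open>Fspan_shift\<close>
  brings this to \<open>Fspan 0 \<subseteq> Fspan e\<close>, and \<open>Fspan 0\<close> contains
  every cocycle modulo \<open>x\<close>.\<close>

lemma cyc_le_Fspan: "cyc Ix \<subseteq> Fspan e"
proof -
  obtain k where k: "\<And>j. j \<ge> k \<Longrightarrow> Fspan k \<subseteq> Fspan j"
    by (rule artinianD[OF artinian_cohomology[OF Ix], of Fspan])
      (use Fspan(1,2) Fspan_le_cyc decseq_Fspan in auto)
  have "Fspan i \<subseteq> Fspan (i + e)" if "i \<le> k" for i
    using that
  proof (induction i rule: inc_induct)
    case base
    then show ?case using k by simp
  next
    case (step i)
    then show ?case using Fspan_shift[of i "i + e"] by simp
  qed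
  from this[of 0] show ?thesis using Fspan(4)[of _ 0] by auto
qed

text \<open>\<open>H(R/x\<^sup>l) \<rightarrow> H(R/x)\<close> is surjective, because the Frobenius power \<open>F ^^ e\<close> on \<open>H(R/x)\<close>, whose image
  generates, factors through \<open>H(R/x\<^sup>l)\<close>.\<close>

lemma cyc_lift:
  assumes g: "g \<in> cyc Ix"
  shows "\<exists>u\<in>cyc (P l). \<exists>c\<in>A. g = u + x *s c"
proof -
  note c = subspace_cyc[OF P, of l]
  \<comment> \<open>\<open>S\<close> is the preimage in \<open>A\<close> of the image of
    \<open>H(R/x^l)\<close> in \<open>H(R/x)\<close>.\<close>
  define S where "S = {u + x *s c | u c. u \<in> cyc (P l) \<and> c \<in> A}"
  \<comment> \<open>The iterate \<open>F ^^ l\<close> suffices: it yields cocycles modulo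
    \<open>x ^ (p ^ l)\<close>, and this exponent is at least \<open>l\<close>.\<close>
  have le: "l \<le> p ^ l" using p less_exp[of l] power_mono[of 2 p l] by simp
  have "Fspan l \<subseteq> S"
  proof (rule Fspan_minimal)
    show "subspace S"
    proof (rule subspaceI)
      have "0 + x *s 0 \<in> S" using subspace_0[OF c] A_intros(4) unfolding S_def by blast
      then show "0 \<in> S" by simp
    next
      fix u v assume "u \<in> S" "v \<in> S"
      then obtain a b a' b' where *: "u = a + x *s b" "v = a' + x *s b'" "a \<in> cyc (P l)" "b \<in> A"
        "a' \<in> cyc (P l)" "b' \<in> A" by (auto simp: S_def)
      then have "u + v = (a + a') + x *s (b + b')" by (simp add: algebra_simps)
      then show "u + v \<in> S" using subspace_add[OF c *(3,5)] A_intros(1)[OF *(4,6)] unfolding S_def by blast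
    next
      fix k u assume "u \<in> S"
      then obtain a b where *: "u = a + x *s b" "a \<in> cyc (P l)" "b \<in> A" by (auto simp: S_def)
      then have "k *s u = k *s a + x *s (k *s b)" by (simp add: algebra_simps)
      then show "k *s u \<in> S" using subspace_scale[OF c *(2)] A_intros(3)[OF *(3)] unfolding S_def by blast
    qed
    show "bnd Ix \<subseteq> S"
    proof
      fix v assume "v \<in> bnd Ix"
      then obtain a where a: "a \<in> A" "v - d a \<in> E Ix" by (elim bndE[OF Ix])
      obtain h where h: "h \<in> A" "v - d a - x *s h \<in> E I0" using E_adjoin[OF I0_self a(2)] by blast
      have "(v - d a - x *s h) + d a \<in> cyc (P l)"
        using h(2) E_I0_le(1) E_le_cyc[OF P, of l] by (intro subspace_add[OF c] d_in_cyc[OF P a(1)]) auto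
      moreover have "v = ((v - d a - x *s h) + d a) + x *s h" by simp
      ultimately show "v \<in> S" using h(1) unfolding S_def by blast
    qed
    fix z assume "z \<in> cyc Ix"
    then have "(F ^^ l) z \<in> cyc (P l)"
      using F_funpow_cyc cyc_mono[OF ideal_adjoin_power_mono[OF le]] by blast
    then have "(F ^^ l) z + x *s 0 \<in> S" unfolding S_def using A_intros(4) by blast
    then show "(F ^^ l) z \<in> S" by simp
  qed
  then show ?thesis using g cyc_le_Fspan unfolding S_def by blast
qed

text \<open>Multiplication by \<open>x\<close> from \<open>H(R/x^(l+1))\<close> to
  \<open>H(R/x^(l+2))\<close> is injective: its kernel is the image of the connecting map from
  \<open>H(R/x)\<close>, which vanishes because \<open>H(R/x^(l+2))\<close> maps onto
  \<open>H(R/x)\<close>. The claim is this for the class of \<open>x ^ l *s w\<close>.\<close>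

lemma bnd_cancel:
  assumes w: "w \<in> A" and xw: "x ^ Suc l *s w \<in> bnd (P (Suc (Suc l)))"
  shows "x ^ l *s w \<in> bnd (P (Suc l))"
proof -
  note i = E_intros[OF I0_self]
  obtain a where a: "a \<in> A" "x ^ Suc l *s w - d a \<in> E (P (Suc (Suc l)))"
    using xw by (elim bndE[OF P])
  obtain b where b: "b \<in> A" "x ^ Suc l *s w - d a - x ^ Suc (Suc l) *s b \<in> E I0"
    using E_adjoin[OF I0_self a(2)] by blast
  have "x ^ Suc l *s w - (x ^ Suc l *s w - d a) \<in> E Ix"
  proof (rule E_intros(2)[OF Ix])
    show "x ^ Suc l *s w \<in> E Ix" using scale_mem_E_P[OF w] E_mono[OF P_le_Ix[of "Suc l"]] by blast
    show "x ^ Suc l *s w - d a \<in> E Ix" using a(2) E_mono[OF P_le_Ix[of "Suc (Suc l)"]] by blast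
  qed
  then have "a \<in> cyc Ix" using a(1) by (simp add: cyc_def)
  \<comment> \<open>Lifting the cocycle \<open>a\<close> modulo \<open>x\<close> to one modulo
    \<open>x ^ (l + 2)\<close> leaves a remainder \<open>x *s c\<close>, and this \<open>c\<close>
    is the cochain that bounds \<open>x ^ l *s w\<close>.\<close>
  then obtain a' c where a': "a' \<in> cyc (P (Suc (Suc l)))" "c \<in> A" "a = a' + x *s c"
    using cyc_lift by blast
  have "d a' \<in> E (P (Suc (Suc l)))" using a'(1) by (simp add: cyc_def)
  then obtain b' where b': "b' \<in> A" "d a' - x ^ Suc (Suc l) *s b' \<in> E I0"
    using E_adjoin[OF I0_self] by blast
  \<comment> \<open>The expression is chosen so that \<open>x *s v\<close> is the sum of the two
    relations defining \<open>b\<close> and \<open>b'\<close>; regularity of \<open>x\<close> then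
    cancels the factor.\<close>
  define v where "v = x ^ l *s w - d c - x ^ Suc l *s (b + b')"
  have "x *s v = (x ^ Suc l *s w - d a - x ^ Suc (Suc l) *s b) + (d a' - x ^ Suc (Suc l) *s b')"
    unfolding v_def a'(3) by (simp add: d_add d_scale algebra_simps)
  then have "x *s v \<in> E I0" using i(1)[OF b(2) b'(2)] by simp
  moreover have "v \<in> A" unfolding v_def using w a'(2) b(1) b'(1) by (intro A_intros) auto
  ultimately have "v \<in> E I0" using E_quotient[OF I0_self, of v x] x_regular by simp
  then show ?thesis
    using a'(2) b(1) b'(1) unfolding v_def
    by (intro bndI[OF P, of _ c] E_PI[of _ "Suc l" "b + b'"]) (auto intro: A_intros)
qed

text \<open>\<open>H(R) \<rightarrow> H(R/x)\<close> is zero.\<close>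

lemma cyc_I0_le_bnd: "cyc I0 \<subseteq> bnd Ix"
proof
  fix w assume w: "w \<in> cyc I0"
  then have wA: "w \<in> A" "d w \<in> E I0" by (auto simp: cyc_def)
  obtain k h where "h \<in> A" "x ^ k *s w - d h \<in> E I0" using torsion[OF I0_self x_m wA] by blast
  \<comment> \<open>Torsion makes \<open>x ^ k *s w\<close> a coboundary over \<open>R\<close>,
    hence modulo any power of \<open>x\<close>. The exponent \<open>Suc k\<close> is the one from
    which \<open>bnd_cancel\<close> descends to \<open>x ^ 0\<close> modulo
    \<open>x ^ 1\<close>.\<close>
  then have "x ^ k *s w \<in> bnd (P (Suc k))" using bndI[OF P] E_I0_le(1) by blast
  then have "x ^ 0 *s w \<in> bnd (P (Suc 0))"
    by (induction k) (simp, metis bnd_cancel[OF wA(1)])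
  then show "w \<in> bnd Ix" by simp
qed

text \<open>A cochain \<open>a\<close> with \<open>d a = x *s z\<close> represents a class modulo
  \<open>x\<close> whose image under the connecting map is the class of \<open>z\<close>. It is
  enough to show that \<open>a\<close> is a coboundary modulo \<open>x\<close>.\<close>

lemma F_injective_step:
  assumes z: "z \<in> cyc I0" "F z \<in> bnd I0" and xz: "x *s z \<in> bnd I0"
  shows "z \<in> bnd I0"
proof -
  note i = E_intros[OF I0_self]
  have zA: "z \<in> A" using z(1) by (simp add: cyc_def)
  obtain a where a: "a \<in> A" "x *s z - d a \<in> E I0" using xz by (elim bndE[OF I0_self])
  obtain c where c: "c \<in> A" "F z - d c \<in> E I0" using z(2) by (elim bndE[OF I0_self])
  \<comment> \<open>From \<open>d (F a) = x ^ p *s F z = x ^ p *s d c\<close> modulo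
    \<open>E I0\<close>, the cochain \<open>w\<close> is a cocycle over \<open>R\<close> that agrees
    with \<open>F a\<close> modulo \<open>x\<close>. It is therefore a coboundary modulo
    \<open>x\<close>.\<close>
  define w where "w = F a - x ^ p *s c"
  have "F (x *s z) - F (d a) \<in> E I0" using a by (intro F_cong A_intros zA)
  then have 1: "x ^ p *s F z - F (d a) \<in> E I0" by (simp add: F_scale)
  have "(x ^ p *s F z - F (d a)) + (F (d a) - d (F a)) - x ^ p *s (F z - d c) \<in> E I0"
    by (intro i(1,2,3) 1 F_d a c)
  then have "- (d w) \<in> E I0" by (simp add: w_def d_diff d_scale algebra_simps)
  then have "d w \<in> E I0" using i(5) by fastforce
  then have "w \<in> cyc I0" using a(1) c(1) by (simp add: cyc_def w_def A_intros F_A)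
  then have "w \<in> bnd Ix" using cyc_I0_le_bnd by blast
  moreover have "x ^ p *s c \<in> bnd Ix"
    using scale_mem_E_P[OF c(1), of p] E_mono[OF P_le_Ix[of p]] p E_le_bnd[OF Ix] by auto
  ultimately have "w + x ^ p *s c \<in> bnd Ix" by (rule subspace_add[OF subspace_bnd[OF Ix]])
  then have "\<phi> (F a) \<in> bnd Ix" by (simp add: w_def phi_bnd)
  then have "\<phi> (F a) - (\<phi> (F a) - a) \<in> bnd Ix"
    by (rule subspace_diff[OF subspace_bnd[OF Ix] _ subsetD[OF E_le_bnd[OF Ix] phi_F[OF a(1)]]])
  then have "a \<in> bnd Ix" by simp
  then obtain b where b: "b \<in> A" "a - d b \<in> E Ix" by (elim bndE[OF Ix])
  obtain h where h: "h \<in> A" "a - d b - x *s h \<in> E I0" using E_adjoin[OF I0_self b(2)] by blast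
  \<comment> \<open>Differentiating \<open>a = d b + x *s h\<close> gives
    \<open>x *s z = x *s d h\<close> modulo \<open>E I0\<close>, and \<open>x\<close> can be
    cancelled.\<close>
  have "(x *s z - d a) + d (a - d b - x *s h) \<in> E I0"
    by (intro i(1,6) a h)
  then have "x *s (z - d h) \<in> E I0" by (simp add: d_add d_diff d_d d_scale algebra_simps)
  then have "z - d h \<in> E I0"
    using E_quotient[OF I0_self, of "z - d h" x] x_regular zA h(1) A_intros by simp
  then show ?thesis using h(1) bndI[OF I0_self] by blast
qed

text \<open>Some \<open>x ^ k\<close> kills the class of \<open>z\<close>. All
  \<open>x ^ j *s z\<close> remain in the kernel of \<open>F\<close>, so the previous lemma removes
  one factor \<open>x\<close> at a time.\<close>

theorem F_injective_modulo:
  assumes z: "z \<in> cyc I0" "F z \<in> bnd I0"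
  shows "z \<in> bnd I0"
proof -
  have "z \<in> A" "d z \<in> E I0" using z by (auto simp: cyc_def)
  then obtain k h where h: "h \<in> A" "x ^ k *s z - d h \<in> E I0" using torsion[OF I0_self x_m] by blast
  then have "x ^ k *s z \<in> bnd I0" using bndI[OF I0_self] by blast
  then show ?thesis
  proof (induction k)
    case 0
    then show ?case by simp
  next
    case (Suc k)
    have "x ^ k *s z \<in> bnd I0"
    proof (rule F_injective_step)
      show "x ^ k *s z \<in> cyc I0" using subspace_scale[OF subspace_cyc[OF I0_self] z(1)] .
      show "F (x ^ k *s z) \<in> bnd I0"
        unfolding F_scale using subspace_scale[OF subspace_bnd[OF I0_self] z(2)] .
      show "x *s (x ^ k *s z) \<in> bnd I0" using Suc.prems by simp
    qed
    then show ?case by (rule Suc.IH)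
  qed
qed

end

section \<open>Congruence modulo an ideal\<close>

definition ideal_cong :: "'t::comm_ring_1 set \<Rightarrow> 't \<Rightarrow> 't \<Rightarrow> bool" where
  "ideal_cong I a b \<longleftrightarrow> a - b \<in> I"

context
  fixes I :: "'t::comm_ring_1 set"
  assumes I: "is_ideal I"
begin

lemma ideal_cong_refl: "ideal_cong I a a"
  by (simp add: ideal_cong_def ideal_0[OF I])

lemma ideal_cong_sym: "ideal_cong I a b \<Longrightarrow> ideal_cong I b a"
  unfolding ideal_cong_def using ideal_minus[OF I, of "a - b"] by simp

lemma ideal_cong_trans: "ideal_cong I a b \<Longrightarrow> ideal_cong I b c \<Longrightarrow> ideal_cong I a c"
  unfolding ideal_cong_def using ideal_add[OF I, of "a - b" "b - c"] by simp

lemma ideal_cong_add: "ideal_cong I a b \<Longrightarrow> ideal_cong I a' b' \<Longrightarrow> ideal_cong I (a + a') (b + b')"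
  unfolding ideal_cong_def using ideal_add[OF I, of "a - b" "a' - b'"] by (simp add: algebra_simps)

lemma ideal_cong_mult_left: "ideal_cong I a b \<Longrightarrow> ideal_cong I (c * a) (c * b)"
  unfolding ideal_cong_def using ideal_mult[OF I, of "a - b" c] by (simp add: algebra_simps)

lemma ideal_cong_mult: "ideal_cong I a b \<Longrightarrow> ideal_cong I a' b' \<Longrightarrow> ideal_cong I (a * a') (b * b')"
  using ideal_cong_trans[of "a * a'" "a * b'" "b * b'"] ideal_cong_mult_left[of a' b' a]
    ideal_cong_mult_left[of a b b']
  by (simp add: mult.commute[of _ b'])

lemma ideal_cong_power: "ideal_cong I a b \<Longrightarrow> ideal_cong I (a ^ k) (b ^ k)"
  by (induction k) (auto intro: ideal_cong_refl ideal_cong_mult)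

lemma ideal_cong_sum: "(\<And>k. k \<in> K \<Longrightarrow> ideal_cong I (g k) (h k)) \<Longrightarrow> ideal_cong I (sum g K) (sum h K)"
  by (induction K rule: infinite_finite_induct) (auto intro: ideal_cong_refl ideal_cong_add)

lemma ideal_cong_mem: "ideal_cong I a b \<Longrightarrow> b \<in> I \<Longrightarrow> a \<in> I"
  unfolding ideal_cong_def using ideal_add[OF I, of "a - b" b] by simp

text \<open>Every binomial coefficient strictly between the end terms is divisible by
  \<open>p\<close>, hence lies in \<open>I\<close>.\<close>

lemma ideal_freshman:
  assumes p: "Factorial_Ring.prime p" "of_nat p \<in> I"
  shows "ideal_cong I ((a + b) ^ p) (a ^ p + b ^ p)"
proof -
  have 1: "1 < p" by (rule prime_gt_1_nat[OF p(1)])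
  let ?t = "\<lambda>k. of_nat (p choose k) * a ^ k * b ^ (p - k)"
  have "(a + b) ^ p = (\<Sum>k\<le>p. ?t k)" by (rule binomial_ring)
  also have "{..p} = insert 0 (insert p {1..<p})" using 1 by auto
  also have "sum ?t \<dots> = b ^ p + (a ^ p + sum ?t {1..<p})" using 1 by simp
  finally have eq: "(a + b) ^ p = b ^ p + (a ^ p + sum ?t {1..<p})" .
  have "sum ?t {1..<p} \<in> I"
  proof (rule ideal_sum[OF I])
    fix k assume "k \<in> {1..<p}"
    then have "p dvd p choose k" using p(1) by (intro dvd_choose_prime) auto
    then obtain q where "p choose k = p * q" by (elim dvdE)
    then have "?t k = of_nat q * a ^ k * b ^ (p - k) * of_nat p" by simp
    then show "?t k \<in> I" using ideal_mult[OF I p(2)] by metis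
  qed
  then show ?thesis by (simp add: ideal_cong_def eq algebra_simps)
qed

lemma ideal_freshman_sum:
  assumes p: "Factorial_Ring.prime p" "of_nat p \<in> I"
  shows "ideal_cong I ((\<Sum>k\<in>K. h k) ^ p) (\<Sum>k\<in>K. h k ^ p)"
proof (induction K rule: infinite_finite_induct)
  case (insert k K)
  then show ?case
    using ideal_cong_trans[OF ideal_freshman[OF p] ideal_cong_add[OF ideal_cong_refl insert.IH]]
    by simp
qed (use prime_gt_0_nat[OF p(1)] in \<open>auto simp: zero_power intro: ideal_cong_refl\<close>)

text \<open>For \<open>p = 2\<close> the two sides differ by \<open>2\<close>, which lies in
  \<open>I\<close>; other primes are odd. This lets the Frobenius commute with the signs of the
  differential.\<close>

lemma ideal_cong_neg_one_power:
  assumes p: "Factorial_Ring.prime p" "of_nat p \<in> I"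
  shows "ideal_cong I ((- 1) ^ p) (- 1)"
proof (cases "p = 2")
  case True
  then show ?thesis using p(2) by (simp add: ideal_cong_def)
next
  case False
  then have "odd p" using p(1) primes_dvd_imp_eq two_is_prime_nat by blast
  then show ?thesis by (simp add: ideal_cong_refl)
qed

end

text \<open>In the expansion of \<open>(a + b) ^ (i + j)\<close> each term is divisible by
  \<open>a ^ i\<close> or by \<open>b ^ j\<close>. The lemma extends nilpotence statements from the
  generators \<open>f k\<close> to all of \<open>m\<close>.\<close>

lemma radical_ideal:
  fixes B :: "'t::comm_ring_1 set"
  assumes B: "is_ideal B"
  shows "is_ideal {y. \<exists>k. y ^ k \<in> B}"
proof -
  have "\<exists>k. (a + b) ^ k \<in> B" if ab: "a ^ i \<in> B" "b ^ j \<in> B" for a b :: 't and i j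
  proof -
    have "of_nat ((i + j) choose k) * a ^ k * b ^ (i + j - k) \<in> B" if "k \<le> i + j" for k
    proof (cases "i \<le> k")
      case True
      then have "a ^ k = a ^ (k - i) * a ^ i" by (simp flip: power_add)
      then have "a ^ k \<in> B" using ideal_mult[OF B ab(1)] by metis
      then show ?thesis by (intro ideal_mult_right[OF B] ideal_mult[OF B])
    next
      case False
      then have "b ^ (i + j - k) = b ^ (i - k) * b ^ j" by (simp flip: power_add)
      then have "b ^ (i + j - k) \<in> B" using ideal_mult[OF B ab(2)] by metis
      then show ?thesis by (intro ideal_mult[OF B])
    qed
    then have "(a + b) ^ (i + j) \<in> B" by (auto simp: binomial_ring intro: ideal_sum[OF B])
    then show ?thesis by blast
  qed
  moreover have "\<exists>k. (a * b) ^ k \<in> B" if "b ^ j \<in> B" for a b :: 't and j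
    using ideal_mult[OF B that, of "a ^ j"] by (auto simp: power_mult_distrib intro: exI[of _ j])
  moreover have "\<exists>k. (0::'t) ^ k \<in> B" using ideal_0[OF B] by (intro exI[of _ 1]) simp
  ultimately show ?thesis unfolding is_ideal_def by blast
qed


section \<open>Koszul complexes\<close>

text \<open>The differential of the Koszul complex of the powers \<open>f k ^ e\<close>, in all degrees at once.\<close>

definition cech_sign :: "nat \<Rightarrow> nat set \<Rightarrow> 't::comm_ring_1" where
  "cech_sign k J = (- 1) ^ card {l \<in> J. l < k}"

definition koszul :: "(nat \<Rightarrow> 't::comm_ring_1) \<Rightarrow> nat \<Rightarrow> (nat set \<Rightarrow> 't) \<Rightarrow> nat set \<Rightarrow> 't" where
  "koszul f e c J = (\<Sum>k\<in>J. cech_sign k J * f k ^ e * c (J - {k}))"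

text \<open>Contraction along the \<open>k\<close>-th generator: the null-homotopy of multiplication
  by \<open>f k ^ e\<close> on the Koszul complex.\<close>

definition koszul_homotopy :: "nat \<Rightarrow> (nat set \<Rightarrow> 't::comm_ring_1) \<Rightarrow> nat set \<Rightarrow> 't" where
  "koszul_homotopy k c J = (if k \<in> J then 0 else cech_sign k J * c (insert k J))"

lemma cech_sign_square: "cech_sign k J * cech_sign k J = (1 :: 't::comm_ring_1)"
  unfolding cech_sign_def by (simp flip: power_add mult_2)

lemma cech_sign_remove: "cech_sign k (J - {k}) = cech_sign k J" "cech_sign k (insert k J) = cech_sign k J"
proof -
  have "{l \<in> J - {k}. l < k} = {l \<in> J. l < k}" "{l \<in> insert k J. l < k} = {l \<in> J. l < k}" by auto
  then show "cech_sign k (J - {k}) = cech_sign k J" "cech_sign k (insert k J) = cech_sign k J"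
    by (simp_all only: cech_sign_def)
qed

text \<open>Removing the smaller of the two indices shifts the position of the larger one by one;
  removing the larger leaves the position of the smaller unchanged.\<close>

lemma cech_sign_anticommute:
  assumes "finite J" "k \<in> J" "l \<in> J" "k \<noteq> l"
  shows "cech_sign k J * cech_sign l (J - {k}) = - (cech_sign l J * cech_sign k (J - {l}) :: 't::comm_ring_1)"
proof -
  have *: "cech_sign k J * cech_sign l (J - {k}) = - (cech_sign l J * cech_sign k (J - {l}) :: 't)"
    if "k < l" "k \<in> J" for k l
  proof -
    have "{i \<in> J. i < l} = insert k {i \<in> J - {k}. i < l}" using that by auto
    then have "card {i \<in> J. i < l} = Suc (card {i \<in> J - {k}. i < l})"
      using assms(1) by simp
    moreover have "{i \<in> J - {l}. i < k} = {i \<in> J. i < k}" using that by auto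
    ultimately show ?thesis by (simp add: cech_sign_def)
  qed
  show ?thesis using *[of k l] *[of l k] assms by (cases "k < l") auto
qed

text \<open>Swapping the indices shows only that twice the sum vanishes, which says nothing in
  characteristic \<open>2\<close>. The induction cancels the pairs that involve the new element
  \<open>a\<close>.\<close>

lemma sum_alternating:
  fixes t :: "nat \<Rightarrow> nat \<Rightarrow> 't::comm_ring_1"
  assumes "finite J" "\<And>k l. k \<in> J \<Longrightarrow> l \<in> J \<Longrightarrow> k \<noteq> l \<Longrightarrow> t k l = - t l k"
  shows "(\<Sum>k\<in>J. \<Sum>l\<in>J - {k}. t k l) = 0"
  using assms
proof (induction J rule: finite_induct)
  case (insert a K)
  have "(\<Sum>l\<in>insert a K - {k}. t k l) = t k a + (\<Sum>l\<in>K - {k}. t k l)" if "k \<in> K" for k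
  proof -
    have "insert a K - {k} = insert a (K - {k})" "a \<notin> K - {k}" using insert.hyps that by auto
    then show ?thesis using insert.hyps by simp
  qed
  moreover have "insert a K - {a} = K" using insert.hyps by auto
  ultimately have "(\<Sum>k\<in>insert a K. \<Sum>l\<in>insert a K - {k}. t k l)
      = (\<Sum>k\<in>K. t a k + t k a) + (\<Sum>k\<in>K. \<Sum>l\<in>K - {k}. t k l)"
    using insert.hyps by (simp add: sum.distrib)
  also have "(\<Sum>k\<in>K. t a k + t k a) = 0"
  proof (intro sum.neutral ballI)
    fix k assume "k \<in> K"
    then have "t a k = - t k a" using insert.hyps by (intro insert.prems) auto
    then show "t a k + t k a = 0" by simp
  qed
  also have "(\<Sum>k\<in>K. \<Sum>l\<in>K - {k}. t k l) = 0"
    by (rule insert.IH, rule insert.prems) simp_all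
  finally show ?case by simp
qed simp

lemma koszul_koszul: "koszul f e (koszul f e c) J = 0"
proof (cases "finite J")
  case True
  define t where "t k l = cech_sign k J * cech_sign l (J - {k}) * (f k ^ e * f l ^ e * c (J - {k} - {l}))" for k l
  have "t k l = - t l k" if "k \<in> J" "l \<in> J" "k \<noteq> l" for k l
  proof -
    have "J - {l} - {k} = J - {k} - {l}" by auto
    then show ?thesis
      using arg_cong[OF cech_sign_anticommute[OF True that], of "\<lambda>s. s * (f k ^ e * f l ^ e * c (J - {k} - {l}))"]
      by (simp only: t_def mult_minus_left) (simp only: mult_ac)
  qed
  then have "(\<Sum>k\<in>J. \<Sum>l\<in>J - {k}. t k l) = 0" by (rule sum_alternating[OF True])
  then show ?thesis by (simp add: koszul_def t_def sum_distrib_left mult_ac)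
qed (simp add: koszul_def)

lemma koszul_add: "koszul f e (\<lambda>J. c J + c' J) J = koszul f e c J + koszul f e c' J"
  by (simp add: koszul_def algebra_simps sum.distrib)

lemma koszul_scale: "koszul f e (\<lambda>J. a * c J) J = a * koszul f e c J"
  by (simp add: koszul_def sum_distrib_left mult_ac)

lemma koszul_minus: "koszul f e (\<lambda>J. - c J) J = - koszul f e c J"
  using koszul_scale[of f e "- 1" c J] by simp

lemma koszul_diff: "koszul f e (\<lambda>J. c J - c' J) J = koszul f e c J - koszul f e c' J"
  using koszul_add[of f e c "\<lambda>J. - c' J" J] by (simp add: koszul_minus)

text \<open>Multiplication by \<open>prod f J ^ k\<close> is the transition map between the Koszul
  complexes of the powers \<open>e\<close> and \<open>e + k\<close>. It commutes with the
  differentials because \<open>prod f J = f i * prod f (J - {i})\<close>.\<close>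

lemma koszul_shift:
  assumes "finite J"
  shows "koszul f (e + k) (\<lambda>J. prod f J ^ k * c J) J = prod f J ^ k * koszul f e c J"
proof -
  have "prod f J = f i * prod f (J - {i})" if "i \<in> J" for i
    using assms that by (rule prod.remove)
  then show ?thesis
    unfolding koszul_def sum_distrib_left
    by (intro sum.cong refl) (simp add: power_add power_mult_distrib mult_ac)
qed

lemma koszul_ideal_cong:
  assumes "is_ideal I" "\<And>K. K \<subseteq> J \<Longrightarrow> ideal_cong I (c K) (c' K)"
  shows "ideal_cong I (koszul f e c J) (koszul f e c' J)"
  unfolding koszul_def
  by (intro ideal_cong_sum ideal_cong_mult ideal_cong_refl assms) auto

text \<open>For \<open>i \<in> J\<close> only the index \<open>k = i\<close> survives. For
  \<open>i \<notin> J\<close> the index \<open>i\<close> in the differential at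
  \<open>insert i J\<close> produces the right-hand side, and the other terms cancel by
  anticommutation of signs.\<close>

lemma koszul_homotopy:
  assumes J: "finite J"
  shows "koszul f e (koszul_homotopy i c) J + koszul_homotopy i (koszul f e c) J = f i ^ e * c J"
proof (cases "i \<in> J")
  case True
  have "koszul f e (koszul_homotopy i c) J
      = (\<Sum>k\<in>J. if k = i then cech_sign i J * f i ^ e * (cech_sign i J * c J) else 0)"
    unfolding koszul_def using True
    by (intro sum.cong refl) (auto simp: koszul_homotopy_def cech_sign_remove insert_absorb)
  also have "\<dots> = (cech_sign i J * cech_sign i J) * f i ^ e * c J"
    using True J by (simp add: mult_ac)
  finally show ?thesis using True by (simp add: koszul_homotopy_def cech_sign_square)
next
  case False
  let ?J = "insert i J"
  have *: "cech_sign k J * cech_sign i (J - {k}) + cech_sign i J * cech_sign k ?J = (0 :: 'a)"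
    if "k \<in> J" for k
  proof -
    have neq: "k \<noteq> i" using that False by blast
    have r: "?J - {i} = J" "?J - {k} = insert i (J - {k})" using False neq by auto
    define s1 s2 s3 s4 :: 'a where s: "s1 = cech_sign k ?J" "s2 = cech_sign i (J - {k})"
      "s3 = cech_sign i J" "s4 = cech_sign k J"
    have "s1 * s2 = - (s3 * s4)"
      using cech_sign_anticommute[of ?J k i] that J neq
      unfolding r cech_sign_remove s by simp
    then have "s1 * s2 * (s2 * s3) = - (s3 * s4) * (s2 * s3)" by simp
    then have "(s2 * s2) * (s1 * s3) = - ((s3 * s3) * (s4 * s2))" by (simp add: mult_ac)
    then show ?thesis by (simp add: s cech_sign_square mult_ac)
  qed
  have "koszul f e (koszul_homotopy i c) J
      = (\<Sum>k\<in>J. (cech_sign k J * cech_sign i (J - {k})) * (f k ^ e * c (?J - {k})))"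
    unfolding koszul_def
  proof (intro sum.cong refl)
    fix k assume "k \<in> J"
    then have "insert i (J - {k}) = ?J - {k}" using False by auto
    then show "cech_sign k J * f k ^ e * koszul_homotopy i c (J - {k})
        = cech_sign k J * cech_sign i (J - {k}) * (f k ^ e * c (?J - {k}))"
      using False by (simp add: koszul_homotopy_def mult_ac)
  qed
  moreover have "?J - {i} = J" using False by auto
  then have "koszul_homotopy i (koszul f e c) J
      = (cech_sign i J * cech_sign i J) * f i ^ e * c J
        + (\<Sum>k\<in>J. (cech_sign i J * cech_sign k ?J) * (f k ^ e * c (?J - {k})))"
    using False J
    by (simp add: koszul_homotopy_def koszul_def cech_sign_remove distrib_left sum_distrib_left mult_ac)
  ultimately have "koszul f e (koszul_homotopy i c) J + koszul_homotopy i (koszul f e c) J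
      = f i ^ e * c J + (\<Sum>k\<in>J. (cech_sign k J * cech_sign i (J - {k}) + cech_sign i J * cech_sign k ?J)
          * (f k ^ e * c (?J - {k})))"
    by (simp add: cech_sign_square distrib_right sum.distrib)
  also have "\<dots> = f i ^ e * c J" using * by simp
  finally show ?thesis .
qed

section \<open>The Cech complex as a colimit of Koszul complexes\<close>

text \<open>A cochain \<open>c\<close> of the Cech complex is encoded by the sequence of functions
  \<open>J \<mapsto> (\<Prod>k\<in>J. f k) ^ e * c J\<close>, which has values in the ring for large \<open>e\<close>.\<close>

type_synonym 't cochain_seq = "nat \<Rightarrow> nat set \<Rightarrow> 't"

definition seq_scale :: "'t::comm_ring_1 \<Rightarrow> 't cochain_seq \<Rightarrow> 't cochain_seq" where
  "seq_scale a g = (\<lambda>e J. a * g e J)"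

lemma eventually_div:
  assumes "eventually Q sequentially" "0 < (p::nat)"
  shows "eventually (\<lambda>e. Q (e div p)) sequentially"
proof -
  obtain N where N: "\<And>e. e \<ge> N \<Longrightarrow> Q e" using assms(1) by (auto simp: eventually_sequentially)
  have "N \<le> e div p" if "p * N \<le> e" for e
    using div_le_mono[OF that, of p] assms(2) by simp
  then show ?thesis using N by (auto simp: eventually_sequentially)
qed

lemma eventually_mult:
  assumes "eventually Q sequentially" "0 < (p::nat)"
  shows "eventually (\<lambda>e. Q (p * e)) sequentially"
proof -
  obtain N where N: "\<And>e. e \<ge> N \<Longrightarrow> Q e" using assms(1) by (auto simp: eventually_sequentially)
  show ?thesis
  proof (rule eventually_sequentiallyI[of N])
    fix e assume "N \<le> e"
    also have "e \<le> p * e" using assms(2) by simp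
    finally show "Q (p * e)" by (rule N)
  qed
qed

text \<open>The local ring is the type modulo \<open>I0\<close>. The axioms \<open>f_m\<close> and
  \<open>m_least\<close> say that the \<open>f k\<close> generate its maximal ideal
  \<open>m\<close>. The function \<open>\<phi>0\<close> lifts a splitting on the quotient by
  \<open>x\<close>, so it is additive and Frobenius-semilinear only modulo
  \<open>I0 + x\<close>.\<close>

locale frobenius_local_data =
  fixes I0 m :: "'t::comm_ring_1 set" and n p :: nat and f :: "nat \<Rightarrow> 't" and x :: 't
    and \<phi>0 :: "'t \<Rightarrow> 't"
  assumes I0: "is_ideal I0"
    and noeth: "wf {(J, I). is_ideal I \<and> is_ideal J \<and> I0 \<subseteq> I \<and> I \<subset> J}"
    and m: "is_ideal m" "I0 \<subseteq> m"
    and unit: "a \<notin> m \<Longrightarrow> \<exists>b. a * b - 1 \<in> I0"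
    and f_m: "k < n \<Longrightarrow> f k \<in> m"
    and m_least: "is_ideal Q \<Longrightarrow> I0 \<subseteq> Q \<Longrightarrow> f ` {..<n} \<subseteq> Q \<Longrightarrow> m \<subseteq> Q"
    and p: "Factorial_Ring.prime p" "of_nat p \<in> I0"
    and x_m: "x \<in> m"
    and x_regular: "x * a \<in> I0 \<Longrightarrow> a \<in> I0"
    and phi0_add: "\<phi>0 (a + b) - (\<phi>0 a + \<phi>0 b) \<in> ideal_adjoin I0 x"
    and phi0_mem: "a \<in> ideal_adjoin I0 x \<Longrightarrow> \<phi>0 a \<in> ideal_adjoin I0 x"
    and phi0_scale: "\<phi>0 (a ^ p * b) - a * \<phi>0 b \<in> ideal_adjoin I0 x"
    and phi0_one: "\<phi>0 1 - 1 \<in> ideal_adjoin I0 x"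
begin

abbreviation Ix :: "'t set" where
  "Ix \<equiv> ideal_adjoin I0 x"

lemma Ix: "is_ideal Ix" "I0 \<subseteq> Ix"
  by (rule ideal_adjoin[OF I0], rule ideal_adjoin_ge[OF I0])

lemma p_pos: "0 < p"
  using p(1) by (rule prime_gt_0_nat)

text \<open>The relation between consecutive numerators is asked only for large \<open>e\<close> and
  modulo \<open>I0\<close>, so initial terms carry no information. All subsets \<open>J\<close>
  occur, which gives the total complex.\<close>

definition cochains :: "'t cochain_seq set" where
  "cochains = {g. \<forall>\<^sub>F e in sequentially. \<forall>J\<subseteq>{..<n}. ideal_cong I0 (g (Suc e) J) (prod f J * g e J)}"

definition ideal_cochains :: "'t set \<Rightarrow> 't cochain_seq set" where
  "ideal_cochains I = {g \<in> cochains. \<forall>\<^sub>F e in sequentially. \<forall>J\<subseteq>{..<n}. g e J \<in> I}"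

definition diff :: "'t cochain_seq \<Rightarrow> 't cochain_seq" where
  "diff g = (\<lambda>e J. koszul f e (g e) J)"

text \<open>The cochain with components \<open>c J / prod f J ^ e0\<close>. For
  \<open>e < e0\<close> truncated subtraction gives the harmless value \<open>c J\<close>.\<close>

definition stage :: "nat \<Rightarrow> (nat set \<Rightarrow> 't) \<Rightarrow> 't cochain_seq" where
  "stage e0 c = (\<lambda>e J. prod f J ^ (e - e0) * c J)"

text \<open>With \<open>e = q * p + r\<close>, the \<open>p\<close>-th power of a fraction with
  numerator \<open>g q J\<close> over \<open>prod f J ^ q\<close> has numerator
  \<open>prod f J ^ r * g q J ^ p\<close> over \<open>prod f J ^ e\<close>.\<close>

definition frob :: "'t cochain_seq \<Rightarrow> 't cochain_seq" where
  "frob g = (\<lambda>e J. prod f J ^ (e mod p) * g (e div p) J ^ p)"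

lemma finite_index: "J \<subseteq> {..<n} \<Longrightarrow> finite J"
  by (rule finite_subset) auto

sublocale seqs: Modules.module seq_scale
  by standard (auto simp: seq_scale_def fun_eq_iff algebra_simps)

lemma seq_diff: "(g - h) e J = g e J - h e J" for g h :: "'t cochain_seq"
  by simp

lemma cochainsI:
  "\<forall>\<^sub>F e in sequentially. \<forall>J\<subseteq>{..<n}. ideal_cong I0 (g (Suc e) J) (prod f J * g e J) \<Longrightarrow> g \<in> cochains"
  by (simp add: cochains_def)

lemma cochainsD:
  "g \<in> cochains \<Longrightarrow> \<forall>\<^sub>F e in sequentially. \<forall>J\<subseteq>{..<n}. ideal_cong I0 (g (Suc e) J) (prod f J * g e J)"
  by (simp add: cochains_def)

lemma ideal_cochainsI:
  "g \<in> cochains \<Longrightarrow> \<forall>\<^sub>F e in sequentially. \<forall>J\<subseteq>{..<n}. g e J \<in> I \<Longrightarrow> g \<in> ideal_cochains I"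
  by (simp add: ideal_cochains_def)

lemma ideal_cochainsD:
  "g \<in> ideal_cochains I \<Longrightarrow> \<forall>\<^sub>F e in sequentially. \<forall>J\<subseteq>{..<n}. g e J \<in> I"
  by (simp add: ideal_cochains_def)

lemma ideal_cochains_le: "ideal_cochains I \<subseteq> cochains"
  by (auto simp: ideal_cochains_def)

lemma stage_cochain: "stage e0 c \<in> cochains"
proof (rule cochainsI)
  have "stage e0 c (Suc e) J = prod f J * stage e0 c e J" if "e0 \<le> e" for e J
    using that by (simp add: stage_def Suc_diff_le mult_ac)
  then show "\<forall>\<^sub>F e in sequentially. \<forall>J\<subseteq>{..<n}.
      ideal_cong I0 (stage e0 c (Suc e) J) (prod f J * stage e0 c e J)"
    using ideal_cong_refl[OF I0] by (auto intro!: eventually_sequentiallyI[of e0])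
qed

text \<open>Beyond the threshold in the definition of a cochain, one numerator determines all later
  ones. Thus each cochain comes from a single Koszul complex of the colimit.\<close>

lemma cochain_stage:
  assumes "g \<in> cochains"
  shows "\<forall>\<^sub>F e0 in sequentially. \<forall>e\<ge>e0. \<forall>J\<subseteq>{..<n}. ideal_cong I0 (g e J) (stage e0 (g e0) e J)"
proof -
  obtain N where N: "\<And>e J. e \<ge> N \<Longrightarrow> J \<subseteq> {..<n} \<Longrightarrow> ideal_cong I0 (g (Suc e) J) (prod f J * g e J)"
    using cochainsD[OF assms] by (auto simp: eventually_sequentially)
  have "ideal_cong I0 (g e J) (stage e0 (g e0) e J)" if "e0 \<ge> N" "e \<ge> e0" "J \<subseteq> {..<n}" for e0 e J
    using that(2)
  proof (induction e rule: dec_induct)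
    case base
    then show ?case by (simp add: stage_def ideal_cong_refl[OF I0])
  next
    case (step e)
    have "ideal_cong I0 (g (Suc e) J) (prod f J * g e J)" using N step.hyps that by simp
    moreover have "ideal_cong I0 (prod f J * g e J) (prod f J * stage e0 (g e0) e J)"
      by (rule ideal_cong_mult_left[OF I0 step.IH])
    moreover have "prod f J * stage e0 (g e0) e J = stage e0 (g e0) (Suc e) J"
      using step.hyps by (simp add: stage_def Suc_diff_le mult_ac)
    ultimately show ?case by (auto intro: ideal_cong_trans[OF I0])
  qed
  then show ?thesis by (auto intro!: eventually_sequentiallyI[of N])
qed

lemma ideal_cong_mono: "I0 \<subseteq> I \<Longrightarrow> ideal_cong I0 a b \<Longrightarrow> ideal_cong I a b"
  by (auto simp: ideal_cong_def)

lemma stage_ideal_cochain: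
  assumes I: "is_ideal I" "I0 \<subseteq> I" and g: "g \<in> cochains"
    and e0: "\<forall>e\<ge>e0. \<forall>J\<subseteq>{..<n}. ideal_cong I0 (g e J) (stage e0 (g e0) e J)"
    and mem: "\<And>J. J \<subseteq> {..<n} \<Longrightarrow> g e0 J \<in> I"
  shows "g \<in> ideal_cochains I"
proof (rule ideal_cochainsI[OF g])
  have "g e J \<in> I" if "e \<ge> e0" "J \<subseteq> {..<n}" for e J
  proof (rule ideal_cong_mem[OF I(1)])
    show "ideal_cong I (g e J) (stage e0 (g e0) e J)" using e0 that ideal_cong_mono[OF I(2)] by blast
    show "stage e0 (g e0) e J \<in> I" using mem[OF that(2)] by (simp add: stage_def ideal_mult[OF I(1)])
  qed
  then show "\<forall>\<^sub>F e in sequentially. \<forall>J\<subseteq>{..<n}. g e J \<in> I" by (auto simp: eventually_sequentially)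
qed

lemma seq_subspaceI:
  assumes "S = {g. \<forall>\<^sub>F e in sequentially. \<forall>J\<subseteq>{..<n}. R J (g e J) (g (Suc e) J)}"
    and "\<And>J. R J 0 0"
    and "\<And>J a b a' b'. R J a b \<Longrightarrow> R J a' b' \<Longrightarrow> R J (a + a') (b + b')"
    and "\<And>J a b c. R J a b \<Longrightarrow> R J (c * a) (c * b)"
  shows "seqs.subspace S"
proof (rule seqs.subspaceI)
  show "0 \<in> S" using assms(2) by (simp add: assms(1))
  show "g + h \<in> S" if "g \<in> S" "h \<in> S" for g h
    using that assms(3) unfolding assms(1) by (auto elim: eventually_elim2)
  show "seq_scale c g \<in> S" if "g \<in> S" for c g
    using that assms(4) unfolding assms(1) by (auto simp: seq_scale_def elim: eventually_mono)
qed

lemma subspace_cochains: "seqs.subspace cochains"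
proof (rule seq_subspaceI[where R = "\<lambda>J a b. ideal_cong I0 b (prod f J * a)"])
  show "ideal_cong I0 (b + b') (prod f J * (a + a'))"
    if "ideal_cong I0 b (prod f J * a)" "ideal_cong I0 b' (prod f J * a')" for J a b a' b'
    using ideal_cong_add[OF I0 that] by (simp add: distrib_left)
  show "ideal_cong I0 (c * b) (prod f J * (c * a))" if "ideal_cong I0 b (prod f J * a)" for J a b c
    using ideal_cong_mult_left[OF I0 that, of c] by (simp add: mult.left_commute)
qed (auto simp: cochains_def ideal_cong_refl[OF I0])

lemma subspace_ideal_cochains:
  assumes I: "is_ideal I"
  shows "seqs.subspace (ideal_cochains I)"
proof -
  have "seqs.subspace {g. \<forall>\<^sub>F e in sequentially. \<forall>J\<subseteq>{..<n}. g e J \<in> I}"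
    by (rule seq_subspaceI[where R = "\<lambda>J a b. a \<in> I"])
      (auto simp: ideal_0[OF I] ideal_add[OF I] ideal_mult[OF I])
  then have "seqs.subspace (cochains \<inter> {g. \<forall>\<^sub>F e in sequentially. \<forall>J\<subseteq>{..<n}. g e J \<in> I})"
    by (rule seqs.subspace_inter[OF subspace_cochains])
  then show ?thesis by (simp add: ideal_cochains_def Int_def)
qed

lemma stage_diff_ideal_cochain:
  assumes I: "is_ideal I" "I0 \<subseteq> I" and g: "g \<in> cochains"
    and e0: "\<forall>e\<ge>e0. \<forall>J\<subseteq>{..<n}. ideal_cong I0 (g e J) (stage e0 (g e0) e J)"
    and mem: "\<And>J. J \<subseteq> {..<n} \<Longrightarrow> ideal_cong I (g e0 J) (c J)"
  shows "g - stage e0 c \<in> ideal_cochains I"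
proof (rule stage_ideal_cochain[OF I, of _ e0])
  show "g - stage e0 c \<in> cochains"
    by (rule seqs.subspace_diff[OF subspace_cochains g stage_cochain])
  show "\<forall>e\<ge>e0. \<forall>J\<subseteq>{..<n}.
      ideal_cong I0 ((g - stage e0 c) e J) (stage e0 ((g - stage e0 c) e0) e J)"
    using e0 by (simp add: stage_def ideal_cong_def algebra_simps)
  show "(g - stage e0 c) e0 J \<in> I" if "J \<subseteq> {..<n}" for J
    using mem[OF that] by (simp add: stage_def ideal_cong_def)
qed

lemma diff_add: "diff (g + h) = diff g + diff h"
  by (simp add: diff_def koszul_def fun_eq_iff algebra_simps sum.distrib)

lemma diff_scale: "diff (seq_scale a g) = seq_scale a (diff g)"
  by (simp add: diff_def seq_scale_def fun_eq_iff koszul_scale)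

lemma diff_diff: "diff (diff g) = 0"
  by (simp add: diff_def fun_eq_iff koszul_koszul)

lemma diff_zero: "diff 0 = 0"
  by (simp add: diff_def koszul_def fun_eq_iff)

lemma stage_apply: "stage e0 c e J = prod f J ^ (e - e0) * c J"
  by (simp add: stage_def)

lemma diff_stage:
  "J \<subseteq> {..<n} \<Longrightarrow> e0 \<le> e \<Longrightarrow> diff (stage e0 c) e J = stage e0 (koszul f e0 c) e J"
  using koszul_shift[OF finite_index, of J f e0 "e - e0" c] by (simp add: diff_def stage_def)

lemma diff_cochain:
  assumes "g \<in> cochains"
  shows "diff g \<in> cochains"
proof (rule cochainsI)
  show "\<forall>\<^sub>F e in sequentially. \<forall>J\<subseteq>{..<n}. ideal_cong I0 (diff g (Suc e) J) (prod f J * diff g e J)"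
    using cochainsD[OF assms]
  proof (rule eventually_mono, intro allI impI)
    fix e J assume *: "\<forall>J\<subseteq>{..<n}. ideal_cong I0 (g (Suc e) J) (prod f J * g e J)" and J: "J \<subseteq> {..<n}"
    have "ideal_cong I0 (koszul f (Suc e) (g (Suc e)) J) (koszul f (Suc e) (\<lambda>J. prod f J * g e J) J)"
      using * J by (intro koszul_ideal_cong[OF I0]) auto
    then show "ideal_cong I0 (diff g (Suc e) J) (prod f J * diff g e J)"
      using koszul_shift[OF finite_index[OF J], of f e 1 "g e"] by (simp add: diff_def)
  qed
qed

lemma koszul_mem:
  assumes I: "is_ideal I" and J: "J \<subseteq> {..<n}" and c: "\<And>K. K \<subseteq> {..<n} \<Longrightarrow> c K \<in> I"
  shows "koszul f e c J \<in> I"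
  unfolding koszul_def using J by (intro ideal_sum[OF I] ideal_mult[OF I] c) auto

lemma diff_ideal_cochain:
  assumes "is_ideal I" "g \<in> ideal_cochains I"
  shows "diff g \<in> ideal_cochains I"
proof (rule ideal_cochainsI)
  show "diff g \<in> cochains" using assms(2) ideal_cochains_le diff_cochain by blast
  show "\<forall>\<^sub>F e in sequentially. \<forall>J\<subseteq>{..<n}. diff g e J \<in> I"
    using ideal_cochainsD[OF assms(2)] by (rule eventually_mono) (auto simp: diff_def intro: koszul_mem[OF assms(1)])
qed

text \<open>The scalars \<open>a\<close> for which \<open>a\<close> times \<open>g\<close> is a
  coboundary modulo \<open>I\<close> form an ideal \<open>B\<close> containing \<open>I0\<close>.
  The Koszul homotopy puts a power of each generator \<open>f i\<close> into \<open>B\<close>, so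
  the radical of \<open>B\<close> contains \<open>m\<close>.\<close>

lemma torsion:
  assumes I: "is_ideal I" "I0 \<subseteq> I" and y: "y \<in> m" and g: "g \<in> cochains" "diff g \<in> ideal_cochains I"
  shows "\<exists>k. \<exists>h\<in>cochains. seq_scale (y ^ k) g - diff h \<in> ideal_cochains I"
proof -
  note E = subspace_ideal_cochains[OF I(1)]
  define B where "B = {a. \<exists>h\<in>cochains. seq_scale a g - diff h \<in> ideal_cochains I}"
  have B: "is_ideal B"
    unfolding is_ideal_def
  proof (intro conjI ballI allI)
    show "0 \<in> B"
      using seqs.subspace_0[OF E] seqs.subspace_0[OF subspace_cochains]
      by (auto simp: B_def diff_zero intro!: bexI[of _ 0])
  next
    fix a b assume "a \<in> B" "b \<in> B"
    then obtain h h' where h: "h \<in> cochains" "h' \<in> cochains" "seq_scale a g - diff h \<in> ideal_cochains I"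
      "seq_scale b g - diff h' \<in> ideal_cochains I" by (auto simp: B_def)
    have "seq_scale a g - diff h + (seq_scale b g - diff h') = seq_scale (a + b) g - diff (h + h')"
      by (simp add: diff_add seqs.scale_left_distrib)
    then show "a + b \<in> B"
      using seqs.subspace_add[OF E h(3,4)] seqs.subspace_add[OF subspace_cochains h(1,2)]
      unfolding B_def by auto
  next
    fix a b assume "b \<in> B"
    then obtain h where h: "h \<in> cochains" "seq_scale b g - diff h \<in> ideal_cochains I"
      by (auto simp: B_def)
    have "seq_scale a (seq_scale b g - diff h) = seq_scale (a * b) g - diff (seq_scale a h)"
      by (simp add: diff_scale seqs.scale_right_diff_distrib)
    then show "a * b \<in> B"
      using seqs.subspace_scale[OF E h(2), of a] seqs.subspace_scale[OF subspace_cochains h(1), of a]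
      unfolding B_def by auto
  qed
  have I0B: "I0 \<subseteq> B"
  proof
    fix a assume a: "a \<in> I0"
    have "seq_scale a g - diff 0 \<in> ideal_cochains I"
    proof (rule ideal_cochainsI)
      show "seq_scale a g - diff 0 \<in> cochains"
        using seqs.subspace_scale[OF subspace_cochains g(1)] by (simp add: diff_zero)
      show "\<forall>\<^sub>F e in sequentially. \<forall>J\<subseteq>{..<n}. (seq_scale a g - diff 0) e J \<in> I"
        using ideal_mult_right[OF I(1) subsetD[OF I(2) a]] by (simp add: seq_scale_def diff_zero)
    qed
    then show "a \<in> B" using seqs.subspace_0[OF subspace_cochains] by (auto simp: B_def)
  qed
  have f_pow: "\<exists>k. f i ^ k \<in> B" if i: "i < n" for i
  proof -
    \<comment> \<open>The exponent is so late that \<open>g\<close> comes from stage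
      \<open>e0\<close> and the numerators of its coboundary lie in \<open>I\<close>. At this stage
      \<open>f i ^ e0\<close> times \<open>g\<close> differs from a coboundary by the contraction of
      \<open>diff g\<close>.\<close>
    obtain e0 where e0: "\<forall>e\<ge>e0. \<forall>J\<subseteq>{..<n}. ideal_cong I0 (g e J) (stage e0 (g e0) e J)"
      "\<forall>J\<subseteq>{..<n}. diff g e0 J \<in> I"
      using eventually_happens'[OF sequentially_bot eventually_conj[OF cochain_stage[OF g(1)] ideal_cochainsD[OF g(2)]]]
      by blast
    let ?h = "koszul_homotopy i (g e0)" and ?u = "seq_scale (f i ^ e0) g"
    have u: "?u \<in> cochains" by (rule seqs.subspace_scale[OF subspace_cochains g(1)])
    have dh: "diff (stage e0 ?h) \<in> cochains" by (rule diff_cochain[OF stage_cochain])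
    have "?u - diff (stage e0 ?h) \<in> ideal_cochains I"
    proof (rule stage_ideal_cochain[OF I, of _ e0])
      show "?u - diff (stage e0 ?h) \<in> cochains" by (rule seqs.subspace_diff[OF subspace_cochains u dh])
      show "\<forall>e\<ge>e0. \<forall>J\<subseteq>{..<n}. ideal_cong I0 ((?u - diff (stage e0 ?h)) e J)
          (stage e0 ((?u - diff (stage e0 ?h)) e0) e J)"
      proof (intro allI impI)
        fix e J assume *: "e0 \<le> e" "J \<subseteq> {..<n}"
        have "ideal_cong I0 (f i ^ e0 * g e J) (f i ^ e0 * stage e0 (g e0) e J)"
          using ideal_cong_mult_left[OF I0] e0(1) * by blast
        then show "ideal_cong I0 ((?u - diff (stage e0 ?h)) e J)
          (stage e0 ((?u - diff (stage e0 ?h)) e0) e J)"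
          using * by (simp add: diff_stage ideal_cong_def seq_scale_def stage_apply algebra_simps)
      qed
      fix J assume J: "J \<subseteq> {..<n}"
      have "koszul_homotopy i (koszul f e0 (g e0)) J \<in> I"
        using e0(2) J i by (auto simp: koszul_homotopy_def diff_def ideal_0[OF I(1)] intro!: ideal_mult[OF I(1)])
      moreover have "(?u - diff (stage e0 ?h)) e0 J = koszul_homotopy i (koszul f e0 (g e0)) J"
        using koszul_homotopy[OF finite_index[OF J], of f e0 i "g e0"] J
        by (simp add: diff_stage seq_scale_def stage_apply algebra_simps)
      ultimately show "(?u - diff (stage e0 ?h)) e0 J \<in> I" by simp
    qed
    then show ?thesis using stage_cochain by (auto simp: B_def)
  qed
  have "m \<subseteq> {y. \<exists>k. y ^ k \<in> B}"
  proof (intro m_least radical_ideal[OF B])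
    show "I0 \<subseteq> {y. \<exists>k. y ^ k \<in> B}"
      using I0B by (auto intro!: exI[of _ 1])
    show "f ` {..<n} \<subseteq> {y. \<exists>k. y ^ k \<in> B}" using f_pow by auto
  qed
  then show ?thesis using y by (auto simp: B_def)
qed

end

section \<open>Coefficients in quotients and in the residue field\<close>

context frobenius_local_data
begin

lemma ideal_cochains_UNIV: "ideal_cochains UNIV = cochains"
  by (simp add: ideal_cochains_def)

lemma ideal_cochains_mono: "I \<subseteq> J \<Longrightarrow> ideal_cochains I \<subseteq> ideal_cochains J"
proof
  fix g assume "I \<subseteq> J" and g: "g \<in> ideal_cochains I"
  show "g \<in> ideal_cochains J"
  proof (rule ideal_cochainsI)
    show "g \<in> cochains" using g ideal_cochains_le by blast
    show "\<forall>\<^sub>F e in sequentially. \<forall>K\<subseteq>{..<n}. g e K \<in> J"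
      using ideal_cochainsD[OF g] by (rule eventually_mono) (use \<open>I \<subseteq> J\<close> in blast)
  qed
qed

lemma ideal_cochains_quotient:
  "g \<in> cochains \<Longrightarrow> seq_scale y g \<in> ideal_cochains I \<longleftrightarrow> g \<in> ideal_cochains (ideal_quotient I y)"
  using seqs.subspace_scale[OF subspace_cochains, of g y]
  by (simp add: ideal_cochains_def ideal_quotient_def seq_scale_def)

lemma ideal_cochains_adjoin:
  assumes I: "is_ideal I" "I0 \<subseteq> I" and g: "g \<in> ideal_cochains (ideal_adjoin I y)"
  shows "\<exists>h\<in>cochains. g - seq_scale y h \<in> ideal_cochains I"
proof -
  have gc: "g \<in> cochains" using g ideal_cochains_le by blast
  obtain e0 where e0: "\<forall>e\<ge>e0. \<forall>J\<subseteq>{..<n}. ideal_cong I0 (g e J) (stage e0 (g e0) e J)"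
    "\<forall>J\<subseteq>{..<n}. g e0 J \<in> ideal_adjoin I y"
    using eventually_happens'[OF sequentially_bot eventually_conj[OF cochain_stage[OF gc] ideal_cochainsD[OF g]]]
    by blast
  have "\<exists>b. ideal_cong I (g e0 J) (y * b)" if J: "J \<subseteq> {..<n}" for J
  proof -
    from e0(2) J obtain a b where "g e0 J = a + y * b" "a \<in> I"
      unfolding ideal_adjoin_def by blast
    then have "ideal_cong I (g e0 J) (y * b)" by (simp add: ideal_cong_def)
    then show ?thesis by blast
  qed
  then obtain b where b: "\<And>J. J \<subseteq> {..<n} \<Longrightarrow> ideal_cong I (g e0 J) (y * b J)" by metis
  have "g - stage e0 (\<lambda>J. y * b J) \<in> ideal_cochains I"
    using b by (intro stage_diff_ideal_cochain[OF I gc e0(1)]) auto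
  moreover have "stage e0 (\<lambda>J. y * b J) = seq_scale y (stage e0 b)"
    by (simp add: stage_def seq_scale_def mult.left_commute)
  ultimately show ?thesis using stage_cochain by auto
qed

lemma prod_mem_m:
  assumes "J \<subseteq> {..<n}" "J \<noteq> {}"
  shows "prod f J \<in> m"
proof -
  obtain k where "k \<in> J" using assms by blast
  then have "prod f J = f k * prod f (J - {k})" using finite_index[OF assms(1)] by (rule prod.remove[rotated])
  then show ?thesis using f_m \<open>k \<in> J\<close> assms(1) by (auto intro!: ideal_mult_right[OF m(1)])
qed

text \<open>For nonempty \<open>J\<close> each late numerator has the factor
  \<open>prod f J\<close>, an element of \<open>m\<close>. So the localizations vanish modulo
  \<open>m\<close> except at \<open>J = {}\<close>.\<close>

lemma cochain_nonempty_mem_m: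
  assumes "g \<in> cochains"
  shows "\<forall>\<^sub>F e in sequentially. \<forall>J\<subseteq>{..<n}. J \<noteq> {} \<longrightarrow> g e J \<in> m"
proof -
  have "\<forall>\<^sub>F e in sequentially. \<forall>J\<subseteq>{..<n}. J \<noteq> {} \<longrightarrow> g (Suc e) J \<in> m"
    using cochainsD[OF assms]
  proof (rule eventually_mono, intro allI impI)
    fix e J assume *: "\<forall>J\<subseteq>{..<n}. ideal_cong I0 (g (Suc e) J) (prod f J * g e J)" "J \<subseteq> {..<n}" "J \<noteq> {}"
    then have "prod f J * g e J \<in> m" using prod_mem_m ideal_mult_right[OF m(1)] by blast
    then show "g (Suc e) J \<in> m" using ideal_cong_mem[OF m(1)] ideal_cong_mono[OF m(2)] * by blast
  qed
  then show ?thesis using eventually_sequentially_Suc[of "\<lambda>e. \<forall>J\<subseteq>{..<n}. J \<noteq> {} \<longrightarrow> g e J \<in> m"] by simp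
qed

text \<open>Modulo \<open>m\<close>, the complex is the residue field, in degree \<open>0\<close>.\<close>

lemma residue_simple:
  assumes N: "seqs.subspace N" "ideal_cochains m \<subseteq> N" "N \<subseteq> cochains"
  shows "N = ideal_cochains m \<or> N = cochains"
proof (cases "N \<subseteq> ideal_cochains m")
  case True
  then show ?thesis using N by blast
next
  case False
  then obtain u where u: "u \<in> N" "u \<notin> ideal_cochains m" by blast
  have uc: "u \<in> cochains" using u N by blast
  have "a \<in> N" if a: "a \<in> cochains" for a
  proof -
    obtain e0 where
      ua: "\<forall>e\<ge>e0. \<forall>J\<subseteq>{..<n}. ideal_cong I0 (u e J) (stage e0 (u e0) e J)"
        "\<forall>e\<ge>e0. \<forall>J\<subseteq>{..<n}. ideal_cong I0 (a e J) (stage e0 (a e0) e J)"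
      and um: "\<forall>J\<subseteq>{..<n}. J \<noteq> {} \<longrightarrow> u e0 J \<in> m" and am: "\<forall>J\<subseteq>{..<n}. J \<noteq> {} \<longrightarrow> a e0 J \<in> m"
      using eventually_happens'[OF sequentially_bot
        eventually_conj[OF eventually_conj[OF cochain_stage[OF uc] cochain_stage[OF a]]
          eventually_conj[OF cochain_nonempty_mem_m[OF uc] cochain_nonempty_mem_m[OF a]]]]
      by (elim exE conjE) (rule that)
    have "u e0 {} \<notin> m"
    proof
      assume "u e0 {} \<in> m"
      then have "u e0 J \<in> m" if "J \<subseteq> {..<n}" for J using um that by (cases "J = {}") auto
      then show False using stage_ideal_cochain[OF m uc ua(1)] u(2) by blast
    qed
    then obtain b where b: "u e0 {} * b - 1 \<in> I0" using unit by blast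
    \<comment> \<open>As \<open>b\<close> inverts \<open>u e0 {}\<close> modulo \<open>I0\<close>,
      subtracting \<open>s\<close> times \<open>u\<close> from \<open>a\<close> removes the
      component at \<open>{}\<close> modulo \<open>m\<close>; all other components lie in
      \<open>m\<close> already.\<close>
    define s where "s = b * a e0 {}"
    define w where "w = a - seq_scale s u"
    have "w \<in> ideal_cochains m"
    proof (rule stage_ideal_cochain[OF m, of _ e0])
      show "w \<in> cochains" unfolding w_def
        by (intro seqs.subspace_diff[OF subspace_cochains] seqs.subspace_scale[OF subspace_cochains] a uc)
      show "\<forall>e\<ge>e0. \<forall>J\<subseteq>{..<n}. ideal_cong I0 (w e J) (stage e0 (w e0) e J)"
      proof (intro allI impI)
        fix e J assume *: "e0 \<le> e" "J \<subseteq> {..<n}"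
        have "a e J - stage e0 (a e0) e J - s * (u e J - stage e0 (u e0) e J) \<in> I0"
          using ua * unfolding ideal_cong_def by - (rule ideal_diff[OF I0 _ ideal_mult[OF I0]], auto)
        then show "ideal_cong I0 (w e J) (stage e0 (w e0) e J)"
          by (simp add: ideal_cong_def w_def seq_scale_def stage_def algebra_simps)
      qed
      show "w e0 J \<in> m" if "J \<subseteq> {..<n}" for J
      proof (cases "J = {}")
        case True
        have "- (a e0 {} * (u e0 {} * b - 1)) \<in> m"
          using b m by (intro ideal_minus[OF m(1)] ideal_mult[OF m(1)]) auto
        then show ?thesis by (simp add: True w_def s_def seq_scale_def algebra_simps)
      next
        case False
        then show ?thesis
          using um am that by (auto simp: w_def seq_scale_def intro!: ideal_diff[OF m(1)] ideal_mult[OF m(1)])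
      qed
    qed
    then have "w + seq_scale s u \<in> N"
      using N u by (intro seqs.subspace_add[OF N(1)] seqs.subspace_scale[OF N(1)]) auto
    then show ?thesis by (simp add: w_def)
  qed
  then show ?thesis using N by blast
qed

section \<open>The Frobenius on cochains\<close>

lemma frob_cochain:
  assumes "g \<in> cochains"
  shows "frob g \<in> cochains"
proof (rule cochainsI)
  show "\<forall>\<^sub>F e in sequentially. \<forall>J\<subseteq>{..<n}. ideal_cong I0 (frob g (Suc e) J) (prod f J * frob g e J)"
    using eventually_div[OF cochainsD[OF assms] p_pos]
  proof (rule eventually_mono, intro allI impI)
    fix e J assume *: "\<forall>J\<subseteq>{..<n}. ideal_cong I0 (g (Suc (e div p)) J) (prod f J * g (e div p) J)"
      and J: "J \<subseteq> {..<n}"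
    \<comment> \<open>The quotient \<open>e div p\<close> changes only when the remainder is
      \<open>p - 1\<close>; there the relation is the \<open>p\<close>-th power of that for
      \<open>g\<close>. Otherwise both sides are equal.\<close>
    show "ideal_cong I0 (frob g (Suc e) J) (prod f J * frob g e J)"
    proof (cases "Suc (e mod p) = p")
      case True
      then have "frob g (Suc e) J = g (Suc (e div p)) J ^ p" by (simp add: frob_def mod_Suc div_Suc)
      moreover have "prod f J * frob g e J = prod f J ^ Suc (e mod p) * g (e div p) J ^ p"
        by (simp add: frob_def mult.assoc)
      then have "prod f J * frob g e J = (prod f J * g (e div p) J) ^ p"
        unfolding True by (simp add: power_mult_distrib)
      ultimately show ?thesis using ideal_cong_power[OF I0] * J by metis
    next
      case False
      then have "frob g (Suc e) J = prod f J * frob g e J"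
        by (simp add: frob_def mod_Suc div_Suc mult_ac)
      then show ?thesis by (simp add: ideal_cong_refl[OF I0])
    qed
  qed
qed

lemma frob_add:
  assumes "g \<in> cochains" "h \<in> cochains"
  shows "frob (g + h) - (frob g + frob h) \<in> ideal_cochains I0"
proof (rule ideal_cochainsI)
  note A = seqs.subspace_add[OF subspace_cochains]
  show "frob (g + h) - (frob g + frob h) \<in> cochains"
    using assms by (intro seqs.subspace_diff[OF subspace_cochains] A frob_cochain)
  have "(frob (g + h) - (frob g + frob h)) e J \<in> I0" for e J
    using ideal_cong_mult_left[OF I0 ideal_freshman[OF I0 p, of "g (e div p) J" "h (e div p) J"], of "prod f J ^ (e mod p)"]
    by (simp add: ideal_cong_def frob_def algebra_simps)
  then show "\<forall>\<^sub>F e in sequentially. \<forall>J\<subseteq>{..<n}. (frob (g + h) - (frob g + frob h)) e J \<in> I0" by simp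
qed

lemma frob_scale: "frob (seq_scale a g) = seq_scale (a ^ p) (frob g)"
  by (simp add: frob_def seq_scale_def fun_eq_iff power_mult_distrib mult_ac)

lemma frob_ideal_cochain:
  assumes "g \<in> ideal_cochains I0"
  shows "frob g \<in> ideal_cochains I0"
proof (rule ideal_cochainsI)
  show "frob g \<in> cochains" using assms ideal_cochains_le frob_cochain by blast
  have "a ^ p \<in> I0" if "a \<in> I0" for a
    using ideal_mult_right[OF I0 that, of "a ^ (p - 1)"] p_pos by (simp add: power_eq_if)
  then show "\<forall>\<^sub>F e in sequentially. \<forall>J\<subseteq>{..<n}. frob g e J \<in> I0"
    using eventually_div[OF ideal_cochainsD[OF assms] p_pos]
    by (auto simp: frob_def intro!: ideal_mult[OF I0] elim: eventually_mono)
qed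

lemma cech_sign_power_p: "ideal_cong I0 (cech_sign k J ^ p) (cech_sign k J)"
  using ideal_cong_power[OF I0 ideal_cong_neg_one_power[OF I0 p], of "card {l \<in> J. l < k}"]
  by (simp add: cech_sign_def mult.commute flip: power_mult)

text \<open>Taking \<open>p\<close>-th powers distributes over the sum modulo \<open>I0\<close> and
  preserves signs there. The factor \<open>prod f J ^ r\<close> splits off \<open>f k ^ r\<close>,
  which completes the exponent of \<open>f k\<close> to \<open>q * p + r\<close>.\<close>

lemma frob_koszul:
  assumes J: "finite J"
  shows "ideal_cong I0 (prod f J ^ r * koszul f q c J ^ p)
    (koszul f (q * p + r) (\<lambda>J. prod f J ^ r * c J ^ p) J)"
proof -
  let ?t = "\<lambda>k. cech_sign k J * f k ^ q * c (J - {k})"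
  have "ideal_cong I0 (prod f J ^ r * koszul f q c J ^ p) (prod f J ^ r * (\<Sum>k\<in>J. ?t k ^ p))"
    unfolding koszul_def by (intro ideal_cong_mult_left[OF I0] ideal_freshman_sum[OF I0 p])
  moreover have "ideal_cong I0 (\<Sum>k\<in>J. prod f J ^ r * ?t k ^ p)
      (koszul f (q * p + r) (\<lambda>J. prod f J ^ r * c J ^ p) J)"
    unfolding koszul_def
  proof (rule ideal_cong_sum[OF I0])
    fix k assume k: "k \<in> J"
    have "prod f J = f k * prod f (J - {k})" using J k by (rule prod.remove)
    then have "prod f J ^ r * ?t k ^ p
        = cech_sign k J ^ p * (f k ^ (q * p + r) * (prod f (J - {k}) ^ r * c (J - {k}) ^ p))"
      by (simp add: power_mult_distrib power_add mult_ac flip: power_mult)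
    moreover have "ideal_cong I0 (cech_sign k J ^ p * (f k ^ (q * p + r) * (prod f (J - {k}) ^ r * c (J - {k}) ^ p)))
        (cech_sign k J * (f k ^ (q * p + r) * (prod f (J - {k}) ^ r * c (J - {k}) ^ p)))"
      by (intro ideal_cong_mult[OF I0] cech_sign_power_p ideal_cong_refl[OF I0])
    ultimately show "ideal_cong I0 (prod f J ^ r * ?t k ^ p)
        (cech_sign k J * f k ^ (q * p + r) * (prod f (J - {k}) ^ r * c (J - {k}) ^ p))"
      by (simp add: mult.assoc)
  qed
  ultimately show ?thesis by (auto simp: sum_distrib_left intro: ideal_cong_trans[OF I0])
qed

lemma frob_diff:
  assumes "g \<in> cochains"
  shows "frob (diff g) - diff (frob g) \<in> ideal_cochains I0"
proof (rule ideal_cochainsI)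
  show "frob (diff g) - diff (frob g) \<in> cochains"
    using assms by (intro seqs.subspace_diff[OF subspace_cochains] frob_cochain diff_cochain)
  have "(frob (diff g) - diff (frob g)) e J \<in> I0" if "J \<subseteq> {..<n}" for e J
    using frob_koszul[OF finite_index[OF that], of "e mod p" "e div p" "g (e div p)"]
    by (simp add: frob_def diff_def ideal_cong_def)
  then show "\<forall>\<^sub>F e in sequentially. \<forall>J\<subseteq>{..<n}. (frob (diff g) - diff (frob g)) e J \<in> I0" by simp
qed

section \<open>The splitting on cochains\<close>

lemma phi0_zero: "ideal_cong Ix (\<phi>0 0) 0"
  using phi0_mem[OF ideal_0[OF Ix(1)]] by (simp add: ideal_cong_def)

lemma phi0_cong:
  assumes "ideal_cong Ix a b"
  shows "ideal_cong Ix (\<phi>0 a) (\<phi>0 b)"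
proof -
  have "\<phi>0 (a - b + b) - (\<phi>0 (a - b) + \<phi>0 b) + \<phi>0 (a - b) \<in> Ix"
    using assms unfolding ideal_cong_def by (intro ideal_add[OF Ix(1)] phi0_add phi0_mem)
  then show ?thesis by (simp add: ideal_cong_def)
qed

lemma phi0_sum: "ideal_cong Ix (\<phi>0 (sum h K)) (\<Sum>k\<in>K. \<phi>0 (h k))"
proof (induction K rule: infinite_finite_induct)
  case (insert k K)
  have "ideal_cong Ix (\<phi>0 (h k + sum h K)) (\<phi>0 (h k) + \<phi>0 (sum h K))"
    using phi0_add by (simp add: ideal_cong_def)
  moreover have "ideal_cong Ix (\<phi>0 (h k) + \<phi>0 (sum h K)) (\<phi>0 (h k) + (\<Sum>k\<in>K. \<phi>0 (h k)))"
    by (rule ideal_cong_add[OF Ix(1) ideal_cong_refl[OF Ix(1)] insert.IH])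
  ultimately show ?case using insert.hyps ideal_cong_trans[OF Ix(1)] by simp
qed (use phi0_zero in simp_all)

text \<open>On fractions the splitting takes \<open>a / s ^ p\<close> to
  \<open>\<phi>0 a / s\<close>, so the numerator is read at exponent \<open>p * e\<close>. The
  values \<open>\<phi>0 (g (p * e) J)\<close> satisfy the cochain relation only modulo
  \<open>Ix\<close>, not \<open>I0\<close>; hence \<open>h\<close> is a cochain congruent to
  them.\<close>

definition splits_to :: "'t cochain_seq \<Rightarrow> 't cochain_seq \<Rightarrow> bool" where
  "splits_to g h \<longleftrightarrow> h \<in> cochains \<and>
     (\<forall>\<^sub>F e in sequentially. \<forall>J\<subseteq>{..<n}. ideal_cong Ix (\<phi>0 (g (p * e) J)) (h e J))"

definition phi :: "'t cochain_seq \<Rightarrow> 't cochain_seq" where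
  "phi g = (SOME h. splits_to g h)"

text \<open>Every identity for \<open>phi\<close> below follows by exhibiting both sides as values
  of the splitting at the same cochain.\<close>

lemma splits_to_unique:
  assumes "splits_to g h" "splits_to g h'"
  shows "h - h' \<in> ideal_cochains Ix"
proof (rule ideal_cochainsI)
  show "h - h' \<in> cochains"
    using assms by (auto simp: splits_to_def intro: seqs.subspace_diff[OF subspace_cochains])
  have "\<forall>\<^sub>F e in sequentially. \<forall>J\<subseteq>{..<n}. ideal_cong Ix (\<phi>0 (g (p * e) J)) (h e J)"
    "\<forall>\<^sub>F e in sequentially. \<forall>J\<subseteq>{..<n}. ideal_cong Ix (\<phi>0 (g (p * e) J)) (h' e J)"
    using assms by (auto simp: splits_to_def)
  then show "\<forall>\<^sub>F e in sequentially. \<forall>J\<subseteq>{..<n}. (h - h') e J \<in> Ix"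
  proof (rule eventually_elim2, intro allI impI)
    fix e J assume *: "\<forall>J\<subseteq>{..<n}. ideal_cong Ix (\<phi>0 (g (p * e) J)) (h e J)"
      "\<forall>J\<subseteq>{..<n}. ideal_cong Ix (\<phi>0 (g (p * e) J)) (h' e J)" "J \<subseteq> {..<n}"
    have "ideal_cong Ix (h e J) (h' e J)"
      using * ideal_cong_trans[OF Ix(1) ideal_cong_sym[OF Ix(1)]] by blast
    then show "(h - h') e J \<in> Ix" by (simp add: ideal_cong_def)
  qed
qed

text \<open>A witness is the stage at \<open>e0\<close> with numerators
  \<open>\<phi>0 (g (p * e0) J)\<close>: for large exponents \<open>g\<close> is multiplied by
  \<open>p\<close>-th powers of \<open>prod f J ^ (e - e0)\<close>, which leave
  \<open>\<phi>0\<close> as their roots.\<close>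

lemma splits_to_phi:
  assumes g: "g \<in> cochains"
  shows "splits_to g (phi g)"
proof -
  obtain e0 where e0: "\<forall>e\<ge>p * e0. \<forall>J\<subseteq>{..<n}. ideal_cong I0 (g e J) (stage (p * e0) (g (p * e0)) e J)"
    using eventually_happens'[OF sequentially_bot eventually_mult[OF cochain_stage[OF g] p_pos]] by blast
  let ?h = "stage e0 (\<lambda>J. \<phi>0 (g (p * e0) J))"
  have "ideal_cong Ix (\<phi>0 (g (p * e) J)) (?h e J)" if "e0 \<le> e" "J \<subseteq> {..<n}" for e J
  proof (rule ideal_cong_trans[OF Ix(1)])
    have "ideal_cong Ix (g (p * e) J) (stage (p * e0) (g (p * e0)) (p * e) J)"
      using e0 that ideal_cong_mono[OF Ix(2)] by simp
    then show "ideal_cong Ix (\<phi>0 (g (p * e) J)) (\<phi>0 (stage (p * e0) (g (p * e0)) (p * e) J))"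
      by (rule phi0_cong)
    have "stage (p * e0) (g (p * e0)) (p * e) J = (prod f J ^ (e - e0)) ^ p * g (p * e0) J"
      by (simp add: stage_def mult.commute diff_mult_distrib2 flip: power_mult)
    then show "ideal_cong Ix (\<phi>0 (stage (p * e0) (g (p * e0)) (p * e) J)) (?h e J)"
      using phi0_scale by (simp add: ideal_cong_def stage_def)
  qed
  then have "splits_to g ?h"
    unfolding splits_to_def using stage_cochain by (auto intro!: eventually_sequentiallyI[of e0])
  then show ?thesis unfolding phi_def by (metis someI)
qed

lemma splits_to_eventually:
  "splits_to g h \<Longrightarrow> \<forall>\<^sub>F e in sequentially. \<forall>J\<subseteq>{..<n}. ideal_cong Ix (\<phi>0 (g (p * e) J)) (h e J)"
  by (simp add: splits_to_def)

lemma phi_cochain: "g \<in> cochains \<Longrightarrow> phi g \<in> cochains"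
  using splits_to_phi by (simp add: splits_to_def)

lemma phi_add:
  assumes "g \<in> cochains" "h \<in> cochains"
  shows "phi (g + h) - (phi g + phi h) \<in> ideal_cochains Ix"
proof (rule splits_to_unique)
  note A = seqs.subspace_add[OF subspace_cochains]
  show "splits_to (g + h) (phi (g + h))" by (intro splits_to_phi A assms)
  show "splits_to (g + h) (phi g + phi h)"
    unfolding splits_to_def
  proof (intro conjI A phi_cochain assms)
    show "\<forall>\<^sub>F e in sequentially. \<forall>J\<subseteq>{..<n}. ideal_cong Ix (\<phi>0 ((g + h) (p * e) J)) ((phi g + phi h) e J)"
      using splits_to_eventually[OF splits_to_phi[OF assms(1)]] splits_to_eventually[OF splits_to_phi[OF assms(2)]]
    proof (rule eventually_elim2, intro allI impI)
      fix e J assume *: "\<forall>J\<subseteq>{..<n}. ideal_cong Ix (\<phi>0 (g (p * e) J)) (phi g e J)"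
        "\<forall>J\<subseteq>{..<n}. ideal_cong Ix (\<phi>0 (h (p * e) J)) (phi h e J)" "J \<subseteq> {..<n}"
      have "ideal_cong Ix (\<phi>0 (g (p * e) J + h (p * e) J)) (\<phi>0 (g (p * e) J) + \<phi>0 (h (p * e) J))"
        using phi0_add by (simp add: ideal_cong_def)
      then show "ideal_cong Ix (\<phi>0 ((g + h) (p * e) J)) ((phi g + phi h) e J)"
        using ideal_cong_trans[OF Ix(1) _ ideal_cong_add[OF Ix(1)]] * by simp
    qed
  qed
qed

lemma phi_ideal_cochain:
  assumes g: "g \<in> ideal_cochains Ix"
  shows "phi g \<in> ideal_cochains Ix"
proof -
  have gc: "g \<in> cochains" using g ideal_cochains_le by blast
  have "splits_to g 0"
    unfolding splits_to_def
  proof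
    show "0 \<in> cochains" by (rule seqs.subspace_0[OF subspace_cochains])
    show "\<forall>\<^sub>F e in sequentially. \<forall>J\<subseteq>{..<n}. ideal_cong Ix (\<phi>0 (g (p * e) J)) (0 e J)"
      using eventually_mult[OF ideal_cochainsD[OF g] p_pos]
      by (rule eventually_mono) (auto simp: ideal_cong_def phi0_mem)
  qed
  from splits_to_unique[OF splits_to_phi[OF gc] this] show ?thesis by simp
qed

text \<open>Modulo \<open>I0\<close> a sign is its own \<open>p\<close>-th power, so the coefficient
  of the differential at exponent \<open>p * e\<close> is the \<open>p\<close>-th power of that at
  \<open>e\<close> and can be pulled out of \<open>\<phi>0\<close>.\<close>

lemma phi_diff:
  assumes g: "g \<in> cochains"
  shows "phi (diff g) - diff (phi g) \<in> ideal_cochains Ix"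
proof (rule splits_to_unique)
  show "splits_to (diff g) (phi (diff g))" by (intro splits_to_phi diff_cochain g)
  show "splits_to (diff g) (diff (phi g))"
    unfolding splits_to_def
  proof (intro conjI diff_cochain phi_cochain g)
    show "\<forall>\<^sub>F e in sequentially. \<forall>J\<subseteq>{..<n}. ideal_cong Ix (\<phi>0 (diff g (p * e) J)) (diff (phi g) e J)"
      using splits_to_eventually[OF splits_to_phi[OF g]]
    proof (rule eventually_mono, intro allI impI)
      fix e J assume *: "\<forall>J\<subseteq>{..<n}. ideal_cong Ix (\<phi>0 (g (p * e) J)) (phi g e J)" and J: "J \<subseteq> {..<n}"
      let ?t = "\<lambda>k. cech_sign k J * f k ^ (p * e) * g (p * e) (J - {k})"
      have "ideal_cong Ix (\<phi>0 (?t k)) (cech_sign k J * f k ^ e * phi g e (J - {k}))" if "k \<in> J" for k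
      proof -
        have "ideal_cong I0 (cech_sign k J * (f k ^ (p * e) * g (p * e) (J - {k})))
            (cech_sign k J ^ p * (f k ^ (p * e) * g (p * e) (J - {k})))"
          by (rule ideal_cong_mult[OF I0 ideal_cong_sym[OF I0 cech_sign_power_p] ideal_cong_refl[OF I0]])
        moreover have "cech_sign k J ^ p * (f k ^ (p * e) * g (p * e) (J - {k}))
            = (cech_sign k J * f k ^ e) ^ p * g (p * e) (J - {k})"
          by (simp only: power_mult_distrib mult.assoc power_mult[of _ e p, symmetric] mult.commute[of e p])
        ultimately have "ideal_cong Ix (?t k) ((cech_sign k J * f k ^ e) ^ p * g (p * e) (J - {k}))"
          using ideal_cong_mono[OF Ix(2)] by (simp add: mult.assoc)
        from phi0_cong[OF this] have 1:
          "ideal_cong Ix (\<phi>0 (?t k)) (\<phi>0 ((cech_sign k J * f k ^ e) ^ p * g (p * e) (J - {k})))" .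
        have 2: "ideal_cong Ix (\<phi>0 ((cech_sign k J * f k ^ e) ^ p * g (p * e) (J - {k})))
            (cech_sign k J * f k ^ e * \<phi>0 (g (p * e) (J - {k})))"
          using phi0_scale by (simp add: ideal_cong_def)
        have 3: "ideal_cong Ix (cech_sign k J * f k ^ e * \<phi>0 (g (p * e) (J - {k})))
            (cech_sign k J * f k ^ e * phi g e (J - {k}))"
          using * J by (intro ideal_cong_mult_left[OF Ix(1)]) blast
        show ?thesis by (rule ideal_cong_trans[OF Ix(1) 1 ideal_cong_trans[OF Ix(1) 2 3]])
      qed
      then have "ideal_cong Ix (\<Sum>k\<in>J. \<phi>0 (?t k)) (koszul f e (phi g e) J)"
        unfolding koszul_def by (rule ideal_cong_sum[OF Ix(1)])
      then show "ideal_cong Ix (\<phi>0 (diff g (p * e) J)) (diff (phi g) e J)"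
        unfolding diff_def koszul_def[of f "p * e"] by (rule ideal_cong_trans[OF Ix(1) phi0_sum])
    qed
  qed
qed

lemma phi_scale_frob:
  assumes g: "g \<in> cochains"
  shows "phi (seq_scale a (frob g)) - seq_scale (\<phi>0 a) g \<in> ideal_cochains Ix"
proof (rule splits_to_unique)
  note A = seqs.subspace_scale[OF subspace_cochains]
  show "splits_to (seq_scale a (frob g)) (phi (seq_scale a (frob g)))"
    by (intro splits_to_phi A frob_cochain g)
  have "ideal_cong Ix (\<phi>0 (seq_scale a (frob g) (p * e) J)) (seq_scale (\<phi>0 a) g e J)" for e J
    using phi0_scale[of "g e J" a] p_pos by (simp add: ideal_cong_def seq_scale_def frob_def mult.commute)
  then show "splits_to (seq_scale a (frob g)) (seq_scale (\<phi>0 a) g)"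
    by (simp add: splits_to_def A g)
qed

lemma phi_frob:
  assumes g: "g \<in> cochains"
  shows "phi (frob g) - g \<in> ideal_cochains Ix"
proof (rule splits_to_unique)
  show "splits_to (frob g) (phi (frob g))" by (intro splits_to_phi frob_cochain g)
  have "ideal_cong Ix (\<phi>0 (frob g (p * e) J)) (g e J)" for e J
  proof (rule ideal_cong_trans[OF Ix(1)])
    show "ideal_cong Ix (\<phi>0 (frob g (p * e) J)) (g e J * \<phi>0 1)"
      using phi0_scale[of "g e J" 1] p_pos by (simp add: ideal_cong_def frob_def)
    show "ideal_cong Ix (g e J * \<phi>0 1) (g e J)"
      using ideal_cong_mult_left[OF Ix(1), of "\<phi>0 1" 1 "g e J"] phi0_one by (simp add: ideal_cong_def)
  qed
  then show "splits_to (frob g) g" by (simp add: splits_to_def g)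
qed

lemma proper_le_m:
  assumes I: "is_ideal I" "I0 \<subseteq> I" "I \<noteq> UNIV"
  shows "I \<subseteq> m"
proof (rule ccontr)
  assume "\<not> I \<subseteq> m"
  then obtain a b where "a \<in> I" "a * b - 1 \<in> I0" using unit by blast
  then have "a * b - (a * b - 1) \<in> I" using ideal_diff[OF I(1) ideal_mult_right[OF I(1)]] I(2) by blast
  then show False using ideal_one[OF I(1)] I(3) by simp
qed

lemma x_reg: "ideal_quotient I0 x = I0"
  by (auto simp: ideal_quotient_def intro: x_regular ideal_mult[OF I0])

lemma frobenius_complex:
  "frobenius_complex seq_scale I0 m cochains ideal_cochains diff p x frob phi \<phi>0"
  by unfold_locales
    (fact I0, fact noeth, fact proper_le_m, erule subspace_ideal_cochains,
      fact ideal_cochains_UNIV, fact ideal_cochains_mono,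
      rule ideal_cochains_quotient, assumption, fact ideal_cochains_adjoin, fact diff_add,
      fact diff_scale, fact diff_diff, erule diff_ideal_cochain, assumption, fact residue_simple,
      fact torsion, fact prime_gt_1_nat[OF p(1)], fact x_m, fact x_reg, fact frob_cochain,
      fact frob_add, fact frob_scale, fact frob_ideal_cochain, fact frob_diff, fact phi_cochain,
      fact phi_add, fact phi_ideal_cochain, fact phi_diff, fact phi_scale_frob, fact phi_frob)

theorem frob_injective:
  assumes "z \<in> cochains" "diff z \<in> ideal_cochains I0"
    and "c \<in> cochains" "frob z - diff c \<in> ideal_cochains I0"
  shows "\<exists>h\<in>cochains. z - diff h \<in> ideal_cochains I0"
proof -
  interpret frob: frobenius_complex seq_scale I0 m cochains ideal_cochains diff p x frob phi \<phi>0
    by (rule frobenius_complex)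
  have "z \<in> frob.cyc I0" using assms by (simp add: frob.cyc_def)
  moreover have "frob z \<in> frob.bnd I0" using frob.bndI[OF frob.I0_self] assms by blast
  ultimately have "z \<in> frob.bnd I0" by (rule frob.F_injective_modulo)
  then show ?thesis by (auto elim: frob.bndE[OF frob.I0_self])
qed

end

section \<open>Presenting a ring by a type\<close>

text \<open>A surjection from a type onto the carrier of \<open>R\<close>: computations in \<open>R\<close> become congruences
  modulo its kernel.\<close>

locale ring_presentation = cring R for R :: "('a, 'b) ring_scheme" (structure) +
  fixes ev :: "'t::comm_ring_1 \<Rightarrow> 'a"
  assumes ev_closed [simp, intro]: "ev a \<in> carrier R"
    and ev_add: "ev (a + b) = ev a \<oplus> ev b"
    and ev_mult: "ev (a * b) = ev a \<otimes> ev b"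
    and ev_one: "ev 1 = \<one>"
    and ev_surj: "r \<in> carrier R \<Longrightarrow> \<exists>a. ev a = r"
begin

definition ker :: "'t set" where
  "ker = {a. ev a = \<zero>}"

lemma ev_zero: "ev 0 = \<zero>"
  using ev_add[of 0 0] by (simp add: add.l_cancel_one)

lemma ev_minus: "ev (- a) = \<ominus> ev a"
proof -
  have "ev (- a) \<oplus> ev a = \<zero>" using ev_add[of "- a" a] by (simp add: ev_zero)
  then show ?thesis using minus_equality[of "ev (- a)" "ev a"] by simp
qed

lemma ev_diff: "ev (a - b) = ev a \<ominus> ev b"
  using ev_add[of a "- b"] by (simp add: ev_minus a_minus_def)

lemma ev_power: "ev (a ^ k) = ev a [^] k"
  by (induction k) (simp_all add: ev_one ev_mult m_comm)

lemma ev_prod: "ev (prod h K) = finprod R (\<lambda>k. ev (h k)) K"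
  by (induction K rule: infinite_finite_induct) (simp_all add: ev_one ev_mult)

lemma ev_of_nat: "ev (of_nat k) = add_pow R k \<one>"
  by (induction k) (simp_all add: ev_zero ev_add ev_one a_comm)

lemma is_ideal_ker: "is_ideal ker"
  by (auto simp: is_ideal_def ker_def ev_zero ev_add ev_mult)

lemma ev_eq_iff: "ev a = ev b \<longleftrightarrow> a - b \<in> ker"
  by (simp add: ker_def ev_diff)

section \<open>Fractions in terms of numerators and denominators in the type\<close>

definition frac :: "'t set \<Rightarrow> 't \<Rightarrow> 't \<Rightarrow> ('a \<times> 'a) set" where
  "frac U a u = loc_frac R (ev ` U) (ev a) (ev u)"

definition submonoid_set :: "'t set \<Rightarrow> bool" where
  "submonoid_set U \<longleftrightarrow> 1 \<in> U \<and> (\<forall>u\<in>U. \<forall>v\<in>U. u * v \<in> U)"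

lemma loc_rel_ev_iff:
  assumes "u \<in> U" "v \<in> U"
  shows "((ev a, ev u), (ev b, ev v)) \<in> loc_rel R (ev ` U) \<longleftrightarrow> (\<exists>t\<in>U. t * (v * a - u * b) \<in> ker)"
proof -
  have "ev t \<otimes> (ev v \<otimes> ev a \<ominus> ev u \<otimes> ev b) = ev (t * (v * a - u * b))" for t
    by (simp add: ev_mult ev_diff)
  then show ?thesis using assms by (auto simp: loc_rel_def ker_def)
qed

lemma loc_rel_cases:
  assumes "(y, y') \<in> loc_rel R (ev ` U)"
  obtains a u b v where "y = (ev a, ev u)" "y' = (ev b, ev v)" "u \<in> U" "v \<in> U"
  using assms ev_surj unfolding loc_rel_def by (auto, metis)

lemma loc_rel_equiv:
  assumes U: "submonoid_set U"
  shows "equiv (carrier R \<times> ev ` U) (loc_rel R (ev ` U))"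
proof (rule equivI)
  show "loc_rel R (ev ` U) \<subseteq> (carrier R \<times> ev ` U) \<times> (carrier R \<times> ev ` U)"
    by (auto simp: loc_rel_def)
  show "refl_on (carrier R \<times> ev ` U) (loc_rel R (ev ` U))"
  proof (rule refl_onI)
    fix y assume "y \<in> carrier R \<times> ev ` U"
    then obtain a u where "y = (ev a, ev u)" "u \<in> U" using ev_surj by auto metis
    then show "(y, y) \<in> loc_rel R (ev ` U)"
      using U ideal_0[OF is_ideal_ker] by (auto simp: loc_rel_ev_iff submonoid_set_def)
  qed
  show "sym (loc_rel R (ev ` U))"
  proof (rule symI)
    fix y y' assume *: "(y, y') \<in> loc_rel R (ev ` U)"
    then obtain a u b v where y: "y = (ev a, ev u)" "y' = (ev b, ev v)" "u \<in> U" "v \<in> U"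
      by (rule loc_rel_cases)
    then obtain t where "t \<in> U" "t * (v * a - u * b) \<in> ker" using * by (auto simp: loc_rel_ev_iff)
    moreover from this have "t * (u * b - v * a) \<in> ker"
      using ideal_minus[OF is_ideal_ker, of "t * (v * a - u * b)"] by (simp add: algebra_simps)
    ultimately show "(y', y) \<in> loc_rel R (ev ` U)" using y by (auto simp: loc_rel_ev_iff)
  qed
  show "trans (loc_rel R (ev ` U))"
  proof (rule transI)
    fix y1 y2 y3 assume *: "(y1, y2) \<in> loc_rel R (ev ` U)" "(y2, y3) \<in> loc_rel R (ev ` U)"
    obtain a u b v where y: "y1 = (ev a, ev u)" "y2 = (ev b, ev v)" "u \<in> U" "v \<in> U"
      using *(1) by (rule loc_rel_cases)
    obtain b' v' c w where y': "y2 = (ev b', ev v')" "y3 = (ev c, ev w)" "v' \<in> U" "w \<in> U"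
      using *(2) by (rule loc_rel_cases)
    have y3: "(y2, y3) = ((ev b, ev v), (ev c, ev w))" using y y' by simp
    obtain t where t: "t \<in> U" "t * (v * a - u * b) \<in> ker"
      using *(1) y by (auto simp: loc_rel_ev_iff)
    obtain s where s: "s \<in> U" "s * (w * b - v * c) \<in> ker"
      using *(2) y y' unfolding y3 by (auto simp: loc_rel_ev_iff)
    \<comment> \<open>The middle denominator \<open>v\<close> enters the multiplier so that the
      terms with \<open>b\<close> cancel.\<close>
    have "(t * s * v) * (w * a - u * c) = s * w * (t * (v * a - u * b)) + t * u * (s * (w * b - v * c))"
      by (simp add: algebra_simps)
    then have "(t * s * v) * (w * a - u * c) \<in> ker"
      using t s by (simp add: ideal_add[OF is_ideal_ker] ideal_mult[OF is_ideal_ker])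
    moreover have "t * s * v \<in> U" using U t s y by (auto simp: submonoid_set_def)
    ultimately show "(y1, y3) \<in> loc_rel R (ev ` U)"
      using y y' by (auto simp: loc_rel_ev_iff)
  qed
qed

context
  fixes U :: "'t set"
  assumes U: "submonoid_set U"
begin

abbreviation L :: "('a, ('a \<times> 'a) set) module" where
  "L \<equiv> localization R (ev ` U)"

lemma one_U: "1 \<in> U"
  using U by (simp add: submonoid_set_def)

lemma mult_U: "u \<in> U \<Longrightarrow> v \<in> U \<Longrightarrow> u * v \<in> U"
  using U by (simp add: submonoid_set_def)

lemma power_U: "u \<in> U \<Longrightarrow> u ^ k \<in> U"
  by (induction k) (auto simp: one_U mult_U)

lemma frac_eq_iff:
  assumes "u \<in> U" "v \<in> U"
  shows "frac U a u = frac U b v \<longleftrightarrow> (\<exists>t\<in>U. t * (v * a - u * b) \<in> ker)"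
  unfolding frac_def loc_frac_def
  using eq_equiv_class_iff[OF loc_rel_equiv[OF U], of "(ev a, ev u)" "(ev b, ev v)"] assms
  by (simp add: loc_rel_ev_iff)

lemma frac_eqI: "u \<in> U \<Longrightarrow> v \<in> U \<Longrightarrow> v * a = u * b \<Longrightarrow> frac U a u = frac U b v"
  using one_U ideal_0[OF is_ideal_ker] by (auto simp: frac_eq_iff)

lemma mem_frac:
  assumes "y \<in> frac U a u" "u \<in> U"
  obtains b v where "y = (ev b, ev v)" "v \<in> U" "frac U b v = frac U a u"
proof -
  have "((ev a, ev u), y) \<in> loc_rel R (ev ` U)" using assms by (simp add: frac_def loc_frac_def)
  moreover from this obtain a' u' b v where "(ev a, ev u) = (ev a', ev u')" "y = (ev b, ev v)" "u' \<in> U" "v \<in> U"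
    by (rule loc_rel_cases)
  ultimately have "y = (ev b, ev v)" "v \<in> U" "frac U b v = frac U a u"
    using equiv_class_eq[OF loc_rel_equiv[OF U]] by (auto simp: frac_def loc_frac_def)
  then show thesis by (rule that)
qed

lemma self_mem_frac: "u \<in> U \<Longrightarrow> (ev a, ev u) \<in> frac U a u"
  using equiv_class_self[OF loc_rel_equiv[OF U]] by (auto simp: frac_def loc_frac_def)

lemma localization_cases:
  assumes "c \<in> carrier L"
  obtains a u where "u \<in> U" "c = frac U a u"
proof -
  obtain r s where "r \<in> carrier R" "s \<in> ev ` U" "c = loc_rel R (ev ` U) `` {(r, s)}"
    using assms by (auto simp: localization_def elim!: quotientE)
  then show thesis using that ev_surj unfolding frac_def loc_frac_def by (metis imageE)
qed

lemma frac_closed: "u \<in> U \<Longrightarrow> frac U a u \<in> carrier L"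
  by (auto simp: localization_def frac_def loc_frac_def intro!: quotientI)

text \<open>The operations of the localization are unions over representatives; independence of the
  representatives collapses such a union to a single value.\<close>

lemma UN_frac2:
  assumes u: "u \<in> U" "v \<in> U"
    and h: "\<And>a' u' b' v'. u' \<in> U \<Longrightarrow> v' \<in> U \<Longrightarrow> frac U a' u' = frac U a u \<Longrightarrow>
      frac U b' v' = frac U b v \<Longrightarrow> h (ev a') (ev u') (ev b') (ev v') = H"
  shows "(\<Union>(r, s)\<in>frac U a u. \<Union>(r', s')\<in>frac U b v. h r s r' s') = H"
proof -
  have *: "h r s r' s' = H" if rs: "(r, s) \<in> frac U a u" "(r', s') \<in> frac U b v" for r s r' s'
  proof -
    obtain a' u' where 1: "(r, s) = (ev a', ev u')" "u' \<in> U" "frac U a' u' = frac U a u"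
      using rs(1) u(1) by (rule mem_frac)
    obtain b' v' where 2: "(r', s') = (ev b', ev v')" "v' \<in> U" "frac U b' v' = frac U b v"
      using rs(2) u(2) by (rule mem_frac)
    show ?thesis using h 1 2 by simp
  qed
  show ?thesis using self_mem_frac[OF u(1), of a] self_mem_frac[OF u(2), of b] *
    by (fastforce split: prod.splits)
qed

lemma frac_add:
  assumes u: "u \<in> U" "v \<in> U"
  shows "frac U a u \<oplus>\<^bsub>L\<^esub> frac U b v = frac U (v * a + u * b) (u * v)"
proof -
  have "loc_frac R (ev ` U) (ev v' \<otimes> ev a' \<oplus> ev u' \<otimes> ev b') (ev u' \<otimes> ev v') = frac U (v * a + u * b) (u * v)"
    if *: "u' \<in> U" "v' \<in> U" "frac U a' u' = frac U a u" "frac U b' v' = frac U b v" for a' u' b' v'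
  proof -
    obtain t where t: "t \<in> U" "t * (u * a' - u' * a) \<in> ker" using * u by (auto simp: frac_eq_iff)
    obtain s where s: "s \<in> U" "s * (v * b' - v' * b) \<in> ker" using * u by (auto simp: frac_eq_iff)
    have "(t * s) * ((u * v) * (v' * a' + u' * b') - (u' * v') * (v * a + u * b))
        = s * v * v' * (t * (u * a' - u' * a)) + t * u * u' * (s * (v * b' - v' * b))"
      by (simp add: algebra_simps)
    also have "\<dots> \<in> ker"
      by (rule ideal_add[OF is_ideal_ker ideal_mult[OF is_ideal_ker t(2)] ideal_mult[OF is_ideal_ker s(2)]])
    finally have "frac U (v' * a' + u' * b') (u' * v') = frac U (v * a + u * b) (u * v)"
      using t s u * mult_U by (subst frac_eq_iff) auto
    then show ?thesis by (simp add: frac_def ev_add ev_mult)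
  qed
  then show ?thesis unfolding localization_def by (simp add: UN_frac2[OF u])
qed

lemma frac_mult:
  assumes u: "u \<in> U" "v \<in> U"
  shows "frac U a u \<otimes>\<^bsub>L\<^esub> frac U b v = frac U (a * b) (u * v)"
proof -
  have "loc_frac R (ev ` U) (ev a' \<otimes> ev b') (ev u' \<otimes> ev v') = frac U (a * b) (u * v)"
    if *: "u' \<in> U" "v' \<in> U" "frac U a' u' = frac U a u" "frac U b' v' = frac U b v" for a' u' b' v'
  proof -
    obtain t where t: "t \<in> U" "t * (u * a' - u' * a) \<in> ker" using * u by (auto simp: frac_eq_iff)
    obtain s where s: "s \<in> U" "s * (v * b' - v' * b) \<in> ker" using * u by (auto simp: frac_eq_iff)
    have "(t * s) * ((u * v) * (a' * b') - (u' * v') * (a * b))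
        = s * v * b' * (t * (u * a' - u' * a)) + t * u' * a * (s * (v * b' - v' * b))"
      by (simp add: algebra_simps)
    also have "\<dots> \<in> ker"
      by (rule ideal_add[OF is_ideal_ker ideal_mult[OF is_ideal_ker t(2)] ideal_mult[OF is_ideal_ker s(2)]])
    finally have "frac U (a' * b') (u' * v') = frac U (a * b) (u * v)"
      using t s u * mult_U by (subst frac_eq_iff) auto
    then show ?thesis by (simp add: frac_def ev_mult)
  qed
  then show ?thesis unfolding localization_def by (simp add: UN_frac2[OF u])
qed

lemma frac_add_same: "u \<in> U \<Longrightarrow> frac U a u \<oplus>\<^bsub>L\<^esub> frac U b u = frac U (a + b) u"
  by (simp add: frac_add) (intro frac_eqI mult_U; simp add: algebra_simps)

lemma localization_zero: "\<zero>\<^bsub>L\<^esub> = frac U 0 1"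
  by (simp add: localization_def frac_def ev_zero ev_one)

lemma frac_zero: "u \<in> U \<Longrightarrow> frac U 0 u = \<zero>\<^bsub>L\<^esub>"
  unfolding localization_zero by (rule frac_eqI) (auto simp: one_U)

lemma localization_one: "\<one>\<^bsub>L\<^esub> = frac U 1 1"
  by (simp add: localization_def frac_def ev_one)

lemma frac_power: "u \<in> U \<Longrightarrow> frac U a u [^]\<^bsub>L\<^esub> (k::nat) = frac U (a ^ k) (u ^ k)"
  by (induction k) (simp_all add: localization_one frac_mult power_U mult.commute)

lemma abelian_group_localization: "abelian_group L"
proof (rule abelian_groupI)
  show "\<zero>\<^bsub>L\<^esub> \<in> carrier L" unfolding localization_zero by (rule frac_closed[OF one_U])
next
  fix c c' assume "c \<in> carrier L" "c' \<in> carrier L"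
  then obtain a u b v where c: "u \<in> U" "c = frac U a u" "v \<in> U" "c' = frac U b v"
    by (metis localization_cases)
  then show "c \<oplus>\<^bsub>L\<^esub> c' \<in> carrier L" by (simp add: frac_add frac_closed mult_U)
  show "c \<oplus>\<^bsub>L\<^esub> c' = c' \<oplus>\<^bsub>L\<^esub> c" using c by (simp add: frac_add mult.commute add.commute)
  fix c'' assume "c'' \<in> carrier L"
  then obtain d w where "w \<in> U" "c'' = frac U d w" by (metis localization_cases)
  then show "(c \<oplus>\<^bsub>L\<^esub> c') \<oplus>\<^bsub>L\<^esub> c'' = c \<oplus>\<^bsub>L\<^esub> (c' \<oplus>\<^bsub>L\<^esub> c'')"
    using c by (simp add: frac_add mult_U algebra_simps)
next
  fix c assume "c \<in> carrier L"
  then obtain a u where c: "u \<in> U" "c = frac U a u" by (rule localization_cases)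
  show "\<zero>\<^bsub>L\<^esub> \<oplus>\<^bsub>L\<^esub> c = c" using c by (simp add: localization_zero frac_add one_U)
  show "\<exists>b\<in>carrier L. b \<oplus>\<^bsub>L\<^esub> c = \<zero>\<^bsub>L\<^esub>"
    using c frac_closed frac_zero by (intro bexI[of _ "frac U (- a) u"]) (simp_all add: frac_add_same)
qed

lemma frac_neg: "u \<in> U \<Longrightarrow> \<ominus>\<^bsub>L\<^esub> frac U a u = frac U (- a) u"
  by (rule abelian_group.minus_equality[OF abelian_group_localization])
    (simp_all add: frac_add_same frac_zero frac_closed)

lemma finsum_frac:
  assumes "finite K" "u \<in> U"
  shows "finsum L (\<lambda>k. frac U (c k) u) K = frac U (sum c K) u"
  using assms(1)
proof (induction K rule: finite_induct)
  case empty
  show ?case using abelian_group_localization frac_zero[OF assms(2)]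
    by (simp add: abelian_monoid.finsum_empty abelian_group_def)
next
  case (insert k K)
  have "abelian_monoid L" using abelian_group_localization by (simp add: abelian_group_def)
  then show ?case
    using insert assms(2) by (simp add: abelian_monoid.finsum_insert frac_closed frac_add_same)
qed

end

lemma loc_map_frac:
  assumes "submonoid_set U" "submonoid_set V" "U \<subseteq> V" "u \<in> U"
  shows "loc_map R (ev ` V) (frac U a u) = frac V a u"
proof -
  have "loc_rel R (ev ` U) \<subseteq> loc_rel R (ev ` V)" using assms(3) by (fastforce simp: loc_rel_def)
  have "loc_rel R (ev ` V) `` {y} = frac V a u" if "y \<in> frac U a u" for y
  proof -
    have "((ev a, ev u), y) \<in> loc_rel R (ev ` V)"
      using that \<open>loc_rel R (ev ` U) \<subseteq> loc_rel R (ev ` V)\<close> by (auto simp: frac_def loc_frac_def)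
    then show ?thesis
      using equiv_class_eq[OF loc_rel_equiv[OF assms(2)]] by (simp add: frac_def loc_frac_def)
  qed
  moreover have "loc_map R (ev ` V) (frac U a u) = (\<Union>y\<in>frac U a u. loc_rel R (ev ` V) `` {y})"
    by (auto simp: loc_map_def)
  ultimately show ?thesis using self_mem_frac[OF assms(1,4), of a] by auto
qed

end

section \<open>The Cech complex in terms of Koszul cochains\<close>

text \<open>The differential raises degree by one, so extending a homogeneous cochain by zero
  commutes with it. This links a single Cech degree with the total complex.\<close>

lemma koszul_restrict:
  assumes "finite J"
  shows "koszul f e (\<lambda>K. if Suc (card K) = i then c K else 0) J = (if card J = i then koszul f e c J else 0)"
proof -
  have "Suc (card (J - {k})) = card J" if "k \<in> J" for k
    using assms that by (rule card_Suc_Diff1)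
  then show ?thesis by (auto simp: koszul_def intro!: sum.neutral)
qed

locale cech_presentation = ring_presentation R ev
  for R :: "('a, 'b) ring_scheme" (structure) and ev :: "'t::comm_ring_1 \<Rightarrow> 'a" +
  fixes fs :: "'a list" and f :: "nat \<Rightarrow> 't"
  assumes ev_f: "k < length fs \<Longrightarrow> ev (f k) = fs ! k"
begin

abbreviation n :: nat where
  "n \<equiv> length fs"

definition mon :: "nat set \<Rightarrow> 't set" where
  "mon I = range (\<lambda>e :: nat \<Rightarrow> nat. \<Prod>k\<in>I. f k ^ e k)"

lemma index_finite: "I \<subseteq> {..<n} \<Longrightarrow> finite I"
  by (rule finite_subset) auto

lemma cech_monoid_eq:
  assumes "I \<subseteq> {..<n}"
  shows "cech_monoid R fs I = ev ` mon I"
proof -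
  have "finprod R (\<lambda>k. fs ! k [^] e k) I = ev (\<Prod>k\<in>I. f k ^ e k)" for e :: "nat \<Rightarrow> nat"
    unfolding ev_prod
  proof (rule finprod_cong')
    fix k assume "k \<in> I"
    then show "fs ! k [^] e k = ev (f k ^ e k)" using assms by (auto simp: ev_power ev_f)
  qed auto
  then show ?thesis by (auto simp: cech_monoid_def mon_def image_def)
qed

lemma submonoid_mon: "submonoid_set (mon I)"
proof -
  have "(\<Prod>k\<in>I. f k ^ e k) * (\<Prod>k\<in>I. f k ^ e' k) = (\<Prod>k\<in>I. f k ^ (e k + e' k))" for e e' :: "nat \<Rightarrow> nat"
    by (simp add: power_add prod.distrib)
  then show ?thesis unfolding submonoid_set_def mon_def
    by (auto intro: range_eqI[of _ _ "\<lambda>k. 0"] range_eqI[of _ _ "\<lambda>k. _ k + _ k"])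
qed

lemma prod_power_mon: "prod f I ^ e \<in> mon I"
  by (auto simp: mon_def prod_power_distrib)

text \<open>The sum \<open>N\<close> of the exponents bounds each of them, so \<open>u\<close>
  divides \<open>prod f I ^ N\<close>. Powers of the product can therefore serve as the only
  denominators.\<close>

lemma mon_dvd:
  assumes "finite I" "u \<in> mon I"
  shows "\<exists>N v. \<forall>e\<ge>N. prod f I ^ e = u * (v * prod f I ^ (e - N)) \<and> v * prod f I ^ (e - N) \<in> mon I"
proof -
  obtain e where u: "u = (\<Prod>k\<in>I. f k ^ e k)" using assms(2) by (auto simp: mon_def)
  define N where "N = sum e I"
  have le: "e k \<le> N" if "k \<in> I" for k
    unfolding N_def using assms(1) that by (intro member_le_sum) auto
  define v where "v = (\<Prod>k\<in>I. f k ^ (N - e k))"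
  have v: "v \<in> mon I" by (auto simp: v_def mon_def)
  have N: "prod f I ^ N = u * v"
    unfolding u v_def prod_power_distrib prod.distrib[symmetric]
    by (intro prod.cong refl) (simp add: le flip: power_add)
  have "prod f I ^ e = u * (v * prod f I ^ (e - N))" if "e \<ge> N" for e
  proof -
    have "prod f I ^ e = prod f I ^ N * prod f I ^ (e - N)" using that by (simp flip: power_add)
    then show ?thesis by (simp only: N mult.assoc)
  qed
  then show ?thesis using mult_U[OF submonoid_mon v prod_power_mon] by blast
qed

lemma mon_mono:
  assumes "I \<subseteq> J" "finite J"
  shows "mon I \<subseteq> mon J"
proof
  fix u assume "u \<in> mon I"
  then obtain e where u: "u = (\<Prod>k\<in>I. f k ^ e k)" by (auto simp: mon_def)
  have "(\<Prod>k\<in>J. f k ^ (if k \<in> I then e k else 0)) = u"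
    unfolding u using assms by (intro prod.mono_neutral_cong_right) auto
  then show "u \<in> mon J" by (auto simp: mon_def intro: range_eqI)
qed

lemma cech_loc_eq: "I \<subseteq> {..<n} \<Longrightarrow> cech_loc R fs I = localization R (ev ` mon I)"
  by (simp add: cech_loc_def cech_monoid_eq)

definition cf :: "nat set \<Rightarrow> nat \<Rightarrow> 't \<Rightarrow> ('a \<times> 'a) set" where
  "cf I e a = frac (mon I) a (prod f I ^ e)"

lemma cf_raise: "cf I e a = cf I (e + k) (prod f I ^ k * a)"
  unfolding cf_def
  by (rule frac_eqI[OF submonoid_mon prod_power_mon prod_power_mon]) (simp add: power_add mult_ac)

lemma cf_eq_iff:
  assumes "finite I"
  shows "cf I e a = cf I e b \<longleftrightarrow> (\<exists>k. prod f I ^ k * (a - b) \<in> ker)"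
proof -
  have "cf I e a = cf I e b \<longleftrightarrow> (\<exists>t\<in>mon I. t * (prod f I ^ e * a - prod f I ^ e * b) \<in> ker)"
    unfolding cf_def by (rule frac_eq_iff[OF submonoid_mon prod_power_mon prod_power_mon])
  also have "\<dots> \<longleftrightarrow> (\<exists>k. prod f I ^ k * (a - b) \<in> ker)"
  proof
    assume "\<exists>t\<in>mon I. t * (prod f I ^ e * a - prod f I ^ e * b) \<in> ker"
    then obtain t where t: "t \<in> mon I" "t * (prod f I ^ e * a - prod f I ^ e * b) \<in> ker" by blast
    obtain N v where "prod f I ^ N = t * (v * prod f I ^ (N - N))"
      using mon_dvd[OF assms t(1)] by blast
    then have "prod f I ^ (N + e) * (a - b) = v * (t * (prod f I ^ e * a - prod f I ^ e * b))"
      by (simp add: power_add algebra_simps)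
    then show "\<exists>k. prod f I ^ k * (a - b) \<in> ker" using ideal_mult[OF is_ideal_ker t(2)] by metis
  next
    assume "\<exists>k. prod f I ^ k * (a - b) \<in> ker"
    then obtain k where "prod f I ^ k * (a - b) \<in> ker" by blast
    then have "prod f I ^ e * (prod f I ^ k * (a - b)) \<in> ker" by (rule ideal_mult[OF is_ideal_ker])
    then have "prod f I ^ k * (prod f I ^ e * a - prod f I ^ e * b) \<in> ker" by (simp add: algebra_simps)
    then show "\<exists>t\<in>mon I. t * (prod f I ^ e * a - prod f I ^ e * b) \<in> ker" using prod_power_mon by blast
  qed
  finally show ?thesis .
qed

text \<open>Claiming all large exponents, and not just one, lets finitely many components share a
  denominator exponent.\<close>

lemma cech_loc_cases:
  assumes I: "I \<subseteq> {..<n}" and c: "c \<in> carrier (cech_loc R fs I)"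
  shows "\<forall>\<^sub>F e in sequentially. \<exists>a. c = cf I e a"
proof -
  obtain a u where u: "u \<in> mon I" "c = frac (mon I) a u"
    using c I by (auto simp: cech_loc_eq elim: localization_cases[OF submonoid_mon])
  obtain N v where N: "\<And>e. e \<ge> N \<Longrightarrow> prod f I ^ e = u * (v * prod f I ^ (e - N))"
    using mon_dvd[OF index_finite[OF I] u(1)] by blast
  have "c = cf I e (v * prod f I ^ (e - N) * a)" if "e \<ge> N" for e
    unfolding u(2) cf_def
    by (rule frac_eqI[OF submonoid_mon u(1) prod_power_mon]) (simp add: N[OF that] mult_ac)
  then show ?thesis by (intro eventually_sequentiallyI[of N]) blast
qed

lemma cf_closed: "I \<subseteq> {..<n} \<Longrightarrow> cf I e a \<in> carrier (cech_loc R fs I)"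
  by (simp add: cech_loc_eq cf_def frac_closed[OF submonoid_mon prod_power_mon])

lemma cf_add: "I \<subseteq> {..<n} \<Longrightarrow> cf I e a \<oplus>\<^bsub>cech_loc R fs I\<^esub> cf I e b = cf I e (a + b)"
  by (simp add: cech_loc_eq cf_def frac_add_same[OF submonoid_mon prod_power_mon])

lemma cf_zero: "I \<subseteq> {..<n} \<Longrightarrow> \<zero>\<^bsub>cech_loc R fs I\<^esub> = cf I e 0"
  by (simp add: cech_loc_eq cf_def frac_zero[OF submonoid_mon prod_power_mon])

definition cochain :: "nat \<Rightarrow> nat \<Rightarrow> (nat set \<Rightarrow> 't) \<Rightarrow> 'a cech_cochain" where
  "cochain i e c = (\<lambda>I\<in>cech_index fs i. cf I e (c I))"

lemma cech_index_le: "I \<in> cech_index fs i \<Longrightarrow> I \<subseteq> {..<n}"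
  by (simp add: cech_index_def)

lemma finite_cech_index: "finite (cech_index fs i)"
  by (rule finite_subset[of _ "Pow {..<n}"]) (auto simp: cech_index_def)

lemma cochain_raise: "cochain i e c = cochain i (e + k) (\<lambda>I. prod f I ^ k * c I)"
  unfolding cochain_def by (rule restrict_ext) (rule cf_raise)

lemma cochain_eq_iff:
  "cochain i e c = cochain i e c' \<longleftrightarrow> (\<forall>\<^sub>F k in sequentially. \<forall>I\<in>cech_index fs i. prod f I ^ k * (c I - c' I) \<in> ker)"
proof -
  have "cochain i e c = cochain i e c' \<longleftrightarrow> (\<forall>I\<in>cech_index fs i. cf I e (c I) = cf I e (c' I))"
    by (auto simp: cochain_def restrict_def fun_eq_iff)
  also have "\<dots> \<longleftrightarrow> (\<forall>I\<in>cech_index fs i. \<forall>\<^sub>F k in sequentially. prod f I ^ k * (c I - c' I) \<in> ker)"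
  proof (rule ball_cong[OF refl])
    fix I assume I: "I \<in> cech_index fs i"
    have "prod f I ^ j * (c I - c' I) \<in> ker" if "k \<le> j" "prod f I ^ k * (c I - c' I) \<in> ker" for k j
    proof -
      have "prod f I ^ j * (c I - c' I) = prod f I ^ (j - k) * (prod f I ^ k * (c I - c' I))"
        using that(1) by (simp flip: power_add mult.assoc)
      then show ?thesis using ideal_mult[OF is_ideal_ker that(2)] by simp
    qed
    then show "cf I e (c I) = cf I e (c' I) \<longleftrightarrow> (\<forall>\<^sub>F k in sequentially. prod f I ^ k * (c I - c' I) \<in> ker)"
      unfolding cf_eq_iff[OF index_finite[OF cech_index_le[OF I]]] eventually_sequentially by blast
  qed
  also have "\<dots> \<longleftrightarrow> (\<forall>\<^sub>F k in sequentially. \<forall>I\<in>cech_index fs i. prod f I ^ k * (c I - c' I) \<in> ker)"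
    by (simp add: eventually_ball_finite_distrib finite_cech_index)
  finally show ?thesis .
qed

lemma cochain_cong: "(\<And>I. I \<in> cech_index fs i \<Longrightarrow> c I = c' I) \<Longrightarrow> cochain i e c = cochain i e c'"
  unfolding cochain_def by (rule restrict_ext) simp

lemma cech_complex_cases:
  assumes "z \<in> carrier (cech_complex R fs i)"
  shows "\<forall>\<^sub>F e in sequentially. \<exists>c. z = cochain i e c"
proof -
  have z: "z \<in> (\<Pi>\<^sub>E I\<in>cech_index fs i. carrier (cech_loc R fs I))"
    using assms by (simp add: cech_complex_def)
  then have "\<forall>I\<in>cech_index fs i. \<forall>\<^sub>F e in sequentially. \<exists>a. z I = cf I e a"
    using cech_loc_cases[OF cech_index_le] by (auto simp: PiE_iff)
  then have "\<forall>\<^sub>F e in sequentially. \<forall>I\<in>cech_index fs i. \<exists>a. z I = cf I e a"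
    by (simp add: eventually_ball_finite_distrib finite_cech_index)
  then show ?thesis
  proof (rule eventually_mono)
    fix e assume "\<forall>I\<in>cech_index fs i. \<exists>a. z I = cf I e a"
    then obtain c where "\<And>I. I \<in> cech_index fs i \<Longrightarrow> z I = cf I e (c I)" by metis
    then have "z = cochain i e c"
      using z by (auto simp: cochain_def PiE_iff extensional_def restrict_def fun_eq_iff)
    then show "\<exists>c. z = cochain i e c" by blast
  qed
qed

lemma cochain_closed: "cochain i e c \<in> carrier (cech_complex R fs i)"
  by (auto simp: cochain_def cech_complex_def intro: cf_closed[OF cech_index_le])

lemma cochain_add: "cochain i e c \<oplus>\<^bsub>cech_complex R fs i\<^esub> cochain i e c' = cochain i e (\<lambda>I. c I + c' I)"
  unfolding cech_complex_def cochain_def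
  by (auto simp: restrict_def fun_eq_iff cf_add[OF cech_index_le])

lemma cochain_zero: "\<zero>\<^bsub>cech_complex R fs i\<^esub> = cochain i e (\<lambda>I. 0)"
  unfolding cech_complex_def cochain_def
  by (auto simp: restrict_def fun_eq_iff cf_zero[OF cech_index_le])

text \<open>Rewriting a fraction over \<open>prod f (J - {k}) ^ e\<close> with denominator
  \<open>prod f J ^ e\<close> multiplies the numerator by \<open>f k ^ e\<close>, the Koszul
  coefficient.\<close>

lemma cech_diff_cochain: "cech_diff R fs i (cochain i e c) = cochain (Suc i) e (koszul f e c)"
  unfolding cech_diff_def cochain_def[of "Suc i"]
proof (rule restrict_ext)
  fix J assume "J \<in> cech_index fs (Suc i)"
  then have J: "J \<subseteq> {..<n}" "card J = Suc i" by (auto simp: cech_index_def)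
  note fin = index_finite[OF J(1)]
  let ?L = "localization R (ev ` mon J)"
  interpret L: abelian_group ?L by (rule abelian_group_localization[OF submonoid_mon])
  have "(let y = loc_map R (cech_monoid R fs J) (cochain i e c (J - {k}))
        in if even (card {l \<in> J. l < k}) then y else \<ominus>\<^bsub>?L\<^esub> y)
      = frac (mon J) (cech_sign k J * f k ^ e * c (J - {k})) (prod f J ^ e)" if k: "k \<in> J" for k
  proof -
    have K: "J - {k} \<in> cech_index fs i" using J k by (auto simp: cech_index_def)
    have "loc_map R (cech_monoid R fs J) (cochain i e c (J - {k})) = frac (mon J) (c (J - {k})) (prod f (J - {k}) ^ e)"
      using K loc_map_frac[OF submonoid_mon submonoid_mon mon_mono[OF _ fin] prod_power_mon]
      by (simp add: cochain_def cf_def cech_monoid_eq[OF J(1)])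
    also have "\<dots> = frac (mon J) (f k ^ e * c (J - {k})) (prod f J ^ e)"
    proof (rule frac_eqI[OF submonoid_mon _ prod_power_mon])
      show "prod f (J - {k}) ^ e \<in> mon J" using mon_mono[OF _ fin] prod_power_mon by blast
      show "prod f J ^ e * c (J - {k}) = prod f (J - {k}) ^ e * (f k ^ e * c (J - {k}))"
        using prod.remove[OF fin k, of f] by (simp add: power_mult_distrib mult_ac)
    qed
    finally show ?thesis
      by (cases "even (card {l \<in> J. l < k})")
        (simp_all add: cech_sign_def frac_neg[OF submonoid_mon prod_power_mon])
  qed
  then have "finsum ?L (\<lambda>k. let y = loc_map R (cech_monoid R fs J) (cochain i e c (J - {k}))
        in if even (card {l \<in> J. l < k}) then y else \<ominus>\<^bsub>?L\<^esub> y) J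
      = finsum ?L (\<lambda>k. frac (mon J) (cech_sign k J * f k ^ e * c (J - {k})) (prod f J ^ e)) J"
    by (intro L.finsum_cong') (auto intro: frac_closed[OF submonoid_mon prod_power_mon])
  also have "\<dots> = cf J e (koszul f e c J)"
    by (simp add: finsum_frac[OF submonoid_mon fin prod_power_mon] cf_def koszul_def)
  finally have *: "finsum ?L (\<lambda>k. let y = loc_map R (cech_monoid R fs J) (cochain i e c (J - {k}))
        in if even (card {l \<in> J. l < k}) then y else \<ominus>\<^bsub>?L\<^esub> y) J = cf J e (koszul f e c J)" .
  show "finsum (cech_loc R fs J) (\<lambda>k. let y = loc_map R (cech_monoid R fs J) (cochain i e c (J - {k}))
        in if even (card {l \<in> J. l < k}) then y else \<ominus>\<^bsub>cech_loc R fs J\<^esub> y) J = cf J e (koszul f e c J)"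
    unfolding cech_loc_eq[OF J(1)] by (rule *)
qed

lemma cech_frobenius_cochain:
  "cech_frobenius p R fs i (cochain i e c) = cochain i (p * e) (\<lambda>I. c I ^ p)"
  unfolding cech_frobenius_def cochain_def[of i "p * e"]
proof (rule restrict_ext)
  fix I assume I: "I \<in> cech_index fs i"
  show "frobenius p (cech_loc R fs I) (cochain i e c I) = cf I (p * e) (c I ^ p)"
    using I frac_power[OF submonoid_mon prod_power_mon, of I "c I" e p]
    by (simp add: cochain_def cf_def frobenius_def cech_loc_eq[OF cech_index_le[OF I]]
        mult.commute[of p e] power_mult)
qed

section \<open>Cohomology classes and their representatives\<close>

abbreviation bd :: "nat \<Rightarrow> 'a cech_cochain set" where
  "bd i \<equiv> coboundaries (cech_complex R fs) (cech_diff R fs) i"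

text \<open>Degree \<open>0\<close> needs no exception: the only index is the empty set, where the
  Koszul sum is empty and gives the zero cochain.\<close>

lemma bd_iff: "b \<in> bd i \<longleftrightarrow> (\<exists>e c. b = cochain i e (koszul f e c))"
proof (cases i)
  case 0
  have "cochain 0 e (koszul f e c) = \<zero>\<^bsub>cech_complex R fs 0\<^esub>" for e c
    unfolding cochain_zero[of 0 e]
    by (rule cochain_cong) (auto simp: cech_index_def koszul_def dest: finite_subset)
  then show ?thesis by (auto simp: 0 coboundaries_def)
next
  case (Suc j)
  show ?thesis
  proof
    assume "b \<in> bd i"
    then obtain c where c: "c \<in> carrier (cech_complex R fs j)" "b = cech_diff R fs j c"
      by (auto simp: coboundaries_def Suc)
    then obtain e c' where "c = cochain j e c'"
      using eventually_happens'[OF sequentially_bot cech_complex_cases[OF c(1)]] by blast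
    then show "\<exists>e c. b = cochain i e (koszul f e c)" using c by (auto simp: cech_diff_cochain Suc)
  next
    assume "\<exists>e c. b = cochain i e (koszul f e c)"
    then show "b \<in> bd i"
      using cochain_closed cech_diff_cochain by (auto simp: coboundaries_def Suc image_iff) metis
  qed
qed

lemma koszul_raise:
  "I \<in> cech_index fs i \<Longrightarrow> prod f I ^ k * koszul f e c I = koszul f (e + k) (\<lambda>J. prod f J ^ k * c J) I"
  by (rule koszul_shift[OF index_finite[OF cech_index_le], symmetric])

lemma bd_cochain_raise:
  "cochain i e (koszul f e c) = cochain i (e + k) (koszul f (e + k) (\<lambda>J. prod f J ^ k * c J))"
  unfolding cochain_raise[of i e _ k] by (rule cochain_cong) (rule koszul_raise)

lemma cochain_eqI:
  assumes "\<And>I. I \<in> cech_index fs i \<Longrightarrow> c I - c' I \<in> ker"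
  shows "cochain i e c = cochain i e c'"
  using assms by (simp add: cochain_eq_iff ideal_mult[OF is_ideal_ker])

lemma mem_coset: "y \<in> B +>\<^bsub>G\<^esub> z \<longleftrightarrow> (\<exists>b\<in>B. y = b \<oplus>\<^bsub>G\<^esub> z)"
  by (auto simp: a_r_coset_def r_coset_def)

abbreviation coset :: "nat \<Rightarrow> 'a cech_cochain \<Rightarrow> 'a cech_cochain set" where
  "coset i z \<equiv> bd i +>\<^bsub>cech_complex R fs i\<^esub> z"

lemma self_mem_coset: "cochain i e c \<in> coset i (cochain i e c)"
proof -
  have "cochain i e (koszul f e (\<lambda>I. 0)) \<in> bd i" unfolding bd_iff by blast
  moreover have "cochain i e (koszul f e (\<lambda>I. 0)) \<oplus>\<^bsub>cech_complex R fs i\<^esub> cochain i e c = cochain i e c"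
    by (simp add: cochain_add koszul_def)
  ultimately show ?thesis unfolding mem_coset by metis
qed

lemma coset_le:
  "coset i (cochain i e (\<lambda>I. koszul f e g I + c I)) \<subseteq> coset i (cochain i e c)"
proof
  fix y assume "y \<in> coset i (cochain i e (\<lambda>I. koszul f e g I + c I))"
  then obtain e' b where y: "y = cochain i e' (koszul f e' b)
      \<oplus>\<^bsub>cech_complex R fs i\<^esub> cochain i e (\<lambda>I. koszul f e g I + c I)"
    by (auto simp: mem_coset bd_iff)
  let ?M = "e + e'"
  let ?b = "\<lambda>J. prod f J ^ e * b J" and ?g = "\<lambda>J. prod f J ^ e' * g J" and ?c = "\<lambda>J. prod f J ^ e' * c J"
  have "cochain i e' (koszul f e' b) = cochain i ?M (koszul f ?M ?b)"
    using bd_cochain_raise[of i e' b e] by (simp add: add.commute)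
  moreover have "cochain i e (\<lambda>I. koszul f e g I + c I) = cochain i ?M (\<lambda>I. koszul f ?M ?g I + ?c I)"
    unfolding cochain_raise[of i e _ e'] by (rule cochain_cong) (simp add: distrib_left koszul_raise)
  ultimately have "y = cochain i ?M (\<lambda>I. koszul f ?M ?b I + (koszul f ?M ?g I + ?c I))"
    unfolding y by (simp add: cochain_add)
  also have "\<dots> = cochain i ?M (\<lambda>I. koszul f ?M (\<lambda>J. ?b J + ?g J) I + ?c I)"
    by (simp add: koszul_add add.assoc)
  also have "\<dots> = cochain i ?M (koszul f ?M (\<lambda>J. ?b J + ?g J)) \<oplus>\<^bsub>cech_complex R fs i\<^esub> cochain i e c"
    by (simp only: cochain_add cochain_raise[of i e c e'])
  finally have eq: "y = cochain i ?M (koszul f ?M (\<lambda>J. ?b J + ?g J)) \<oplus>\<^bsub>cech_complex R fs i\<^esub> cochain i e c" .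
  have "cochain i ?M (koszul f ?M (\<lambda>J. ?b J + ?g J)) \<in> bd i" unfolding bd_iff by blast
  with eq show "y \<in> coset i (cochain i e c)" unfolding mem_coset by (rule bexI)
qed

lemma coset_eq:
  "coset i (cochain i e (\<lambda>I. koszul f e g I + c I)) = coset i (cochain i e c)"
proof
  have "(\<lambda>I. koszul f e (\<lambda>J. - g J) I + (koszul f e g I + c I)) = c"
    by (simp add: koszul_minus)
  then show "coset i (cochain i e c) \<subseteq> coset i (cochain i e (\<lambda>I. koszul f e g I + c I))"
    using coset_le[of i e "\<lambda>J. - g J" "\<lambda>I. koszul f e g I + c I"] by simp
qed (rule coset_le)

lemma cocycle_cochain:
  assumes "cochain i e c \<in> cocycles (cech_complex R fs) (cech_diff R fs) i"
  shows "\<forall>\<^sub>F k in sequentially. \<forall>J\<in>cech_index fs (Suc i). prod f J ^ k * koszul f e c J \<in> ker"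
proof -
  have "cochain (Suc i) e (koszul f e c) = cochain (Suc i) e (\<lambda>J. 0)"
    using assms by (simp add: cocycles_def cech_diff_cochain cochain_zero[of _ e])
  then show ?thesis by (simp add: cochain_eq_iff)
qed

lemma frobenius_action_coset:
  "frobenius_action p R fs i u = (\<Union>z\<in>u. coset i (cech_frobenius p R fs i z))"
  by (simp add: frobenius_action_def cohomology_map_def)

lemma local_cohomology_cases:
  assumes "u \<in> carrier (local_cohomology R fs i)"
  obtains z where "z \<in> cocycles (cech_complex R fs) (cech_diff R fs) i" "u = coset i z"
  using assms by (auto simp: local_cohomology_def cohomology_def)

text \<open>Extending \<open>v\<close> and \<open>b\<close> by zero to all degrees turns the
  hypotheses into those of \<open>frob_injective\<close> for the total complex. The cochain obtained
  there is read off at one late exponent \<open>e1\<close>.\<close>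

lemma frobenius_injective_numerators:
  assumes T: "frobenius_local_data ker m n p f x \<phi>0"
    and v: "\<forall>\<^sub>F k in sequentially. \<forall>J\<in>cech_index fs (Suc i). prod f J ^ k * koszul f e v J \<in> ker"
    and Fv: "\<forall>\<^sub>F k in sequentially. \<forall>J\<in>cech_index fs i.
      prod f J ^ k * (prod f J ^ r * v J ^ p - koszul f (p * e + r) b J) \<in> ker"
  obtains k h where "\<And>J. J \<in> cech_index fs i \<Longrightarrow> prod f J ^ k * v J - koszul f (e + k) h J \<in> ker"
proof -
  interpret T: frobenius_local_data ker m n p f x \<phi>0 by (rule T)
  define w where "w J = (if Suc (card J) = Suc i then v J else 0)" for J
  define b' where "b' J = (if Suc (card J) = i then b J else 0)" for J
  let ?M = "p * e + r"
  have fin: "finite J" if "J \<subseteq> {..<n}" for J using that by (rule index_finite)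
  have kw: "koszul f e w J = (if card J = Suc i then koszul f e v J else 0)" if "J \<subseteq> {..<n}" for J
    unfolding w_def by (rule koszul_restrict[OF fin[OF that]])
  have kb: "koszul f ?M b' J = (if card J = i then koszul f ?M b J else 0)" if "J \<subseteq> {..<n}" for J
    unfolding b'_def by (rule koszul_restrict[OF fin[OF that]])
  obtain k1 where k1: "\<And>k J. k \<ge> k1 \<Longrightarrow> J \<in> cech_index fs (Suc i) \<Longrightarrow> prod f J ^ k * koszul f e v J \<in> ker"
    using v by (auto simp: eventually_sequentially)
  obtain k2 where k2: "\<And>k J. k \<ge> k2 \<Longrightarrow> J \<in> cech_index fs i \<Longrightarrow>
      prod f J ^ k * (prod f J ^ r * v J ^ p - koszul f ?M b J) \<in> ker"
    using Fv by (auto simp: eventually_sequentially)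
  let ?z = "T.stage e w" and ?c = "T.stage ?M b'"
  have "T.diff ?z \<in> T.ideal_cochains ker"
  proof (rule T.ideal_cochainsI[OF T.diff_cochain[OF T.stage_cochain]])
    have "T.diff ?z e' J \<in> ker" if e': "e + k1 \<le> e'" and J: "J \<subseteq> {..<n}" for e' J
    proof -
      have "T.diff ?z e' J = prod f J ^ (e' - e) * koszul f e w J"
        using T.diff_stage[OF J, of e e' w] e' by (simp add: T.stage_apply)
      also have "\<dots> \<in> ker"
        using k1[of "e' - e" J] e' J by (auto simp: kw[OF J] cech_index_def ideal_0[OF is_ideal_ker])
      finally show ?thesis .
    qed
    then show "\<forall>\<^sub>F e' in sequentially. \<forall>J\<subseteq>{..<n}. T.diff ?z e' J \<in> ker"
      by (intro eventually_sequentiallyI[of "e + k1"]) blast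
  qed
  moreover have "T.frob ?z - T.diff ?c \<in> T.ideal_cochains ker"
  proof (rule T.ideal_cochainsI)
    show "T.frob ?z - T.diff ?c \<in> T.cochains"
      by (intro T.seqs.subspace_diff[OF T.subspace_cochains] T.frob_cochain T.diff_cochain T.stage_cochain)
    have "(T.frob ?z - T.diff ?c) e' J \<in> ker" if e': "?M + k2 \<le> e'" and J: "J \<subseteq> {..<n}" for e' J
    proof -
      have "e * p \<le> e'" using e' by (simp add: mult.commute)
      then have "e \<le> e' div p" using div_le_mono[of "e * p" e' p] T.p_pos by simp
      then obtain q where q: "e' div p = e + q" using le_Suc_ex by blast
      then have "e' = e' mod p + (e + q) * p" using mod_div_mult_eq[of e' p] by simp
      \<comment> \<open>Both sides equal \<open>e' - e * p\<close>. This matches the power of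
        \<open>prod f J\<close> in the Frobenius of stage \<open>e\<close> with the one in stage
        \<open>?M\<close>.\<close>
      then have "e' mod p + q * p = r + (e' - ?M)" using e' by (simp add: algebra_simps)
      then have "e' mod p + (e' div p - e) * p = r + (e' - ?M)" by (simp add: q)
      then have "prod f J ^ (e' mod p) * (prod f J ^ (e' div p - e)) ^ p = prod f J ^ r * prod f J ^ (e' - ?M)"
        by (simp flip: power_add power_mult)
      then have 1: "T.frob ?z e' J = prod f J ^ r * prod f J ^ (e' - ?M) * w J ^ p"
        by (simp add: T.frob_def T.stage_apply power_mult_distrib flip: mult.assoc)
      have 2: "T.diff ?c e' J = prod f J ^ (e' - ?M) * koszul f ?M b' J"
        unfolding T.stage_apply[symmetric] using e' by (intro T.diff_stage J) simp
      have "(T.frob ?z - T.diff ?c) e' J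
          = prod f J ^ (e' - ?M) * (prod f J ^ r * w J ^ p - koszul f ?M b' J)"
        unfolding T.seq_diff 1 2 by (simp add: algebra_simps)
      also have "\<dots> \<in> ker"
      proof (cases "card J = i")
        case True
        then show ?thesis using k2[of "e' - ?M" J] e' J by (simp add: w_def kb cech_index_def)
      next
        case False
        then show ?thesis using T.p_pos J by (simp add: w_def kb zero_power ideal_0[OF is_ideal_ker])
      qed
      finally show ?thesis .
    qed
    then show "\<forall>\<^sub>F e' in sequentially. \<forall>J\<subseteq>{..<n}. (T.frob ?z - T.diff ?c) e' J \<in> ker"
      by (intro eventually_sequentiallyI[of "?M + k2"]) blast
  qed
  ultimately obtain h where h: "h \<in> T.cochains" "?z - T.diff h \<in> T.ideal_cochains ker"
    using T.frob_injective[OF T.stage_cochain _ T.stage_cochain] by blast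
  obtain e1 where e1: "e \<le> e1" "\<forall>J\<subseteq>{..<n}. (?z - T.diff h) e1 J \<in> ker"
    using eventually_happens'[OF sequentially_bot
        eventually_conj[OF eventually_ge_at_top T.ideal_cochainsD[OF h(2)]]] by blast
  have "prod f J ^ (e1 - e) * v J - koszul f (e + (e1 - e)) (h e1) J \<in> ker" if "J \<in> cech_index fs i" for J
    using e1 that by (auto simp: T.stage_apply T.diff_def w_def cech_index_def)
  then show thesis by (rule that)
qed

text \<open>Injectivity is reduced to triviality of the kernel on numerators: over a common
  denominator the difference \<open>v\<close> of two representatives is a cocycle whose Frobenius is
  a coboundary.\<close>

theorem frobenius_action_inj:
  assumes T: "frobenius_local_data ker m n p f x \<phi>0"
  shows "inj_on (frobenius_action p R fs i) (carrier (local_cohomology R fs i))"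
proof (rule inj_onI)
  interpret T: frobenius_local_data ker m n p f x \<phi>0 by (rule T)
  let ?F = "cech_frobenius p R fs i"
  fix u u' assume "u \<in> carrier (local_cohomology R fs i)" "u' \<in> carrier (local_cohomology R fs i)"
    and eq: "frobenius_action p R fs i u = frobenius_action p R fs i u'"
  then obtain z z' where z: "z \<in> cocycles (cech_complex R fs) (cech_diff R fs) i" "u = coset i z"
    and z': "z' \<in> cocycles (cech_complex R fs) (cech_diff R fs) i" "u' = coset i z'"
    by (metis local_cohomology_cases)
  have ev_z: "\<forall>\<^sub>F e in sequentially. \<exists>c. z = cochain i e c" "\<forall>\<^sub>F e in sequentially. \<exists>c. z' = cochain i e c"
    using z z' by (auto simp: cocycles_def intro: cech_complex_cases)
  obtain e0 c0 where "z = cochain i e0 c0" using eventually_happens'[OF sequentially_bot ev_z(1)] by blast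
  then have "z \<in> u" "?F z \<in> coset i (?F z)" using z(2) self_mem_coset by (auto simp: cech_frobenius_cochain)
  then have "?F z \<in> frobenius_action p R fs i u'" unfolding eq[symmetric] unfolding frobenius_action_coset
    by (rule UN_I[where B = "\<lambda>z. coset i (?F z)"])
  then obtain y where y: "y \<in> u'" "?F z \<in> coset i (?F y)" by (auto simp: frobenius_action_coset)
  obtain e' b where b: "y = cochain i e' (koszul f e' b) \<oplus>\<^bsub>cech_complex R fs i\<^esub> z'"
    using y(1) z'(2) by (auto simp: mem_coset bd_iff)
  obtain r b' where b': "?F z = cochain i r (koszul f r b') \<oplus>\<^bsub>cech_complex R fs i\<^esub> ?F y"
    using y(2) by (auto simp: mem_coset bd_iff)
  obtain e c c' where e: "e' \<le> e" "z = cochain i e c" "z' = cochain i e c'"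
    using eventually_happens'[OF sequentially_bot eventually_conj[OF eventually_ge_at_top eventually_conj[OF ev_z]]]
    by blast
  define g where "g = (\<lambda>J. prod f J ^ (e - e') * b J)"
  have "cochain i e' (koszul f e' b) = cochain i e (koszul f e g)"
    using bd_cochain_raise[of i e' b "e - e'"] e(1) by (simp add: g_def)
  then have y_eq: "y = cochain i e (\<lambda>I. koszul f e g I + c' I)" unfolding b e(3) by (simp add: cochain_add)
  define s where "s = (\<lambda>I. koszul f e g I + c' I)"
  define v where "v = (\<lambda>I. c I - s I)"
  let ?M = "p * e + r" and ?b = "\<lambda>J. prod f J ^ (p * e) * b' J"
  have "cochain i r (koszul f r b') = cochain i ?M (koszul f ?M ?b)"
    using bd_cochain_raise[of i r b' "p * e"] by (simp add: add.commute)
  moreover have "?F z = cochain i ?M (\<lambda>I. prod f I ^ r * c I ^ p)" "?F y = cochain i ?M (\<lambda>I. prod f I ^ r * s I ^ p)"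
    unfolding e(2) y_eq cech_frobenius_cochain cochain_raise[of i "p * e" _ r] s_def by simp_all
  ultimately have "cochain i ?M (\<lambda>I. prod f I ^ r * c I ^ p)
      = cochain i ?M (\<lambda>I. koszul f ?M ?b I + prod f I ^ r * s I ^ p)"
    using b' by (simp add: cochain_add)
  then have "\<forall>\<^sub>F k in sequentially. \<forall>I\<in>cech_index fs i.
      prod f I ^ k * (prod f I ^ r * c I ^ p - (koszul f ?M ?b I + prod f I ^ r * s I ^ p)) \<in> ker"
    by (simp add: cochain_eq_iff)
  then have Fv: "\<forall>\<^sub>F k in sequentially. \<forall>I\<in>cech_index fs i.
      prod f I ^ k * (prod f I ^ r * v I ^ p - koszul f ?M ?b I) \<in> ker"
  proof (rule eventually_mono, intro ballI)
    fix k I assume *: "\<forall>I\<in>cech_index fs i.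
      prod f I ^ k * (prod f I ^ r * c I ^ p - (koszul f ?M ?b I + prod f I ^ r * s I ^ p)) \<in> ker"
      and I: "I \<in> cech_index fs i"
    \<comment> \<open>Additivity of the Frobenius turns the relation between the \<open>p\<close>-th
      powers of \<open>c\<close> and \<open>s\<close> into one for their difference
      \<open>v\<close>.\<close>
    have "(v I + s I) ^ p - (v I ^ p + s I ^ p) \<in> ker"
      using ideal_freshman[OF is_ideal_ker T.p, of "v I" "s I"] by (simp add: ideal_cong_def)
    then have "c I ^ p - (v I ^ p + s I ^ p) \<in> ker" by (simp add: v_def)
    then have "prod f I ^ k * (prod f I ^ r * c I ^ p - (koszul f ?M ?b I + prod f I ^ r * s I ^ p))
        - prod f I ^ k * prod f I ^ r * (c I ^ p - (v I ^ p + s I ^ p)) \<in> ker"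
      using * I by (intro ideal_diff[OF is_ideal_ker _ ideal_mult[OF is_ideal_ker]]) auto
    then show "prod f I ^ k * (prod f I ^ r * v I ^ p - koszul f ?M ?b I) \<in> ker"
      by (simp add: algebra_simps)
  qed
  have kv: "\<forall>\<^sub>F k in sequentially. \<forall>J\<in>cech_index fs (Suc i). prod f J ^ k * koszul f e v J \<in> ker"
    using cocycle_cochain[OF z(1)[unfolded e(2)]] cocycle_cochain[OF z'(1)[unfolded e(3)]]
  proof (rule eventually_elim2, intro ballI)
    fix k J assume *: "\<forall>J\<in>cech_index fs (Suc i). prod f J ^ k * koszul f e c J \<in> ker"
      "\<forall>J\<in>cech_index fs (Suc i). prod f J ^ k * koszul f e c' J \<in> ker" "J \<in> cech_index fs (Suc i)"
    have "koszul f e v J = koszul f e c J - koszul f e c' J"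
      unfolding v_def s_def koszul_diff koszul_add koszul_koszul by simp
    then show "prod f J ^ k * koszul f e v J \<in> ker"
      using * ideal_diff[OF is_ideal_ker] by (simp add: right_diff_distrib)
  qed
  obtain k h where h: "\<And>J. J \<in> cech_index fs i \<Longrightarrow> prod f J ^ k * v J - koszul f (e + k) h J \<in> ker"
    by (rule frobenius_injective_numerators[OF T kv Fv]) blast
  \<comment> \<open>The bounding cochain combines \<open>h\<close>, which bounds \<open>v\<close>,
    with the cochain \<open>g\<close> by which \<open>y\<close> differs from
    \<open>z'\<close>.\<close>
  let ?g = "\<lambda>J. h J + prod f J ^ k * g J" and ?c = "\<lambda>J. prod f J ^ k * c' J"
  have "z = cochain i (e + k) (\<lambda>I. prod f I ^ k * c I)" unfolding e(2) by (rule cochain_raise)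
  also have "\<dots> = cochain i (e + k) (\<lambda>I. koszul f (e + k) ?g I + ?c I)"
  proof (rule cochain_eqI)
    fix I assume I: "I \<in> cech_index fs i"
    show "prod f I ^ k * c I - (koszul f (e + k) ?g I + ?c I) \<in> ker"
      using h[OF I] unfolding koszul_add koszul_raise[OF I, symmetric]
      by (simp add: v_def s_def algebra_simps)
  qed
  finally have "coset i z = coset i (cochain i (e + k) ?c)" by (simp only: coset_eq)
  also have "cochain i (e + k) ?c = z'" unfolding e(3) by (rule cochain_raise[symmetric])
  finally show "u = u'" using z(2) z'(2) by simp
qed

end

section \<open>Every commutative ring is a quotient of a polynomial ring type\<close>

lemma poly_mapping_add_single_induct:
  fixes P :: "'m \<Rightarrow>\<^sub>0 'c::comm_monoid_add"
  assumes "Q 0" "\<And>P m k. Q P \<Longrightarrow> Q (P + Poly_Mapping.single m k)"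
  shows "Q P"
proof (induction P rule: update_induct)
  case (update P m k)
  then have "Poly_Mapping.update m k P = P + Poly_Mapping.single m k"
    by (intro poly_mapping_eqI) (auto simp: lookup_update lookup_add lookup_single in_keys_iff when_def)
  then show ?case using assms(2) update by simp
qed (rule assms(1))

context cring
begin

text \<open>Every element of the type is a variable; those outside the carrier are evaluated at
  \<open>\<one>\<close>, so that all values lie in \<open>R\<close>.\<close>

definition monomial_value :: "'a multiset \<Rightarrow> 'a" where
  "monomial_value m = finprod R (\<lambda>a. (if a \<in> carrier R then a else \<one>) [^] count m a) (set_mset m)"

text \<open>Multisets are the monomials, so finitely supported functions from them to the integers
  form a polynomial ring that is a commutative ring as a type.\<close>

definition poly_value :: "('a multiset \<Rightarrow>\<^sub>0 int) \<Rightarrow> 'a" where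
  "poly_value P = finsum R (\<lambda>m. add_pow R (Poly_Mapping.lookup P m) (monomial_value m)) (Poly_Mapping.keys P)"

lemma monomial_value_superset:
  assumes "finite K" "set_mset m \<subseteq> K"
  shows "monomial_value m = finprod R (\<lambda>a. (if a \<in> carrier R then a else \<one>) [^] count m a) K"
  unfolding monomial_value_def using assms
  by (intro finprod_mono_neutral_cong_left) (auto simp: not_in_iff)

lemma monomial_value_closed [simp, intro]: "monomial_value m \<in> carrier R"
  unfolding monomial_value_def by (intro finprod_closed) auto

lemma monomial_value_add: "monomial_value (m + m') = monomial_value m \<otimes> monomial_value m'"
proof -
  let ?K = "set_mset m \<union> set_mset m'" and ?g = "\<lambda>a. if a \<in> carrier R then a else \<one>"
  have "monomial_value (m + m') = finprod R (\<lambda>a. ?g a [^] count (m + m') a) ?K"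
    by (rule monomial_value_superset) auto
  also have "\<dots> = finprod R (\<lambda>a. ?g a [^] count m a \<otimes> ?g a [^] count m' a) ?K"
    by (intro finprod_cong') (auto simp: nat_pow_mult)
  also have "\<dots> = finprod R (\<lambda>a. ?g a [^] count m a) ?K \<otimes> finprod R (\<lambda>a. ?g a [^] count m' a) ?K"
    by (intro finprod_multf) auto
  also have "\<dots> = monomial_value m \<otimes> monomial_value m'"
    using monomial_value_superset[of ?K m] monomial_value_superset[of ?K m'] by simp
  finally show ?thesis .
qed

lemma int_mult_closed [simp, intro]: "a \<in> carrier R \<Longrightarrow> add_pow R (k::int) a \<in> carrier R"
  by (rule add.int_pow_closed)

lemma int_mult_zero: "add_pow R (0::int) a = \<zero>"
  by (simp add: add_pow_def)

lemma poly_value_superset: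
  assumes "finite K" "Poly_Mapping.keys P \<subseteq> K"
  shows "poly_value P = finsum R (\<lambda>m. add_pow R (Poly_Mapping.lookup P m) (monomial_value m)) K"
  unfolding poly_value_def using assms
  by (intro add.finprod_mono_neutral_cong_left) (auto simp: in_keys_iff int_mult_zero)

lemma poly_value_closed [simp, intro]: "poly_value P \<in> carrier R"
  unfolding poly_value_def by (intro finsum_closed) auto

lemma poly_value_add: "poly_value (P + Q) = poly_value P \<oplus> poly_value Q"
proof -
  let ?K = "Poly_Mapping.keys P \<union> Poly_Mapping.keys Q"
  let ?t = "\<lambda>P m. add_pow R (Poly_Mapping.lookup P m) (monomial_value m)"
  have "poly_value (P + Q) = finsum R (?t (P + Q)) ?K"
    using keys_add[of P Q] by (intro poly_value_superset) auto
  also have "\<dots> = finsum R (\<lambda>m. ?t P m \<oplus> ?t Q m) ?K"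
    by (intro finsum_cong') (auto simp: lookup_add add.int_pow_mult)
  also have "\<dots> = finsum R (?t P) ?K \<oplus> finsum R (?t Q) ?K"
    by (intro finsum_addf) auto
  also have "\<dots> = poly_value P \<oplus> poly_value Q"
    using poly_value_superset[of ?K P] poly_value_superset[of ?K Q] by simp
  finally show ?thesis .
qed

lemma poly_value_single: "poly_value (Poly_Mapping.single m k) = add_pow R k (monomial_value m)"
proof -
  have "poly_value (Poly_Mapping.single m k)
      = finsum R (\<lambda>m'. add_pow R (Poly_Mapping.lookup (Poly_Mapping.single m k) m') (monomial_value m')) {m}"
    by (intro poly_value_superset) auto
  then show ?thesis by simp
qed

lemma poly_value_zero: "poly_value 0 = \<zero>"
  by (simp add: poly_value_def)

lemma poly_value_mult_single:
  "poly_value (Poly_Mapping.single m k * Poly_Mapping.single m' k')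
    = poly_value (Poly_Mapping.single m k) \<otimes> poly_value (Poly_Mapping.single m' k')"
  by (simp add: mult_single poly_value_single monomial_value_add add_pow_ldistr_int add_pow_rdistr_int
      add.int_pow_pow mult.commute)

lemma poly_value_mult: "poly_value (P * Q) = poly_value P \<otimes> poly_value Q"
proof (induction P rule: poly_mapping_add_single_induct)
  case (2 P m k)
  have "poly_value (Poly_Mapping.single m k * Q) = poly_value (Poly_Mapping.single m k) \<otimes> poly_value Q"
    by (induction Q rule: poly_mapping_add_single_induct)
      (simp_all add: poly_value_zero distrib_left poly_value_add r_distr poly_value_mult_single)
  then show ?case using 2 by (simp add: distrib_right poly_value_add l_distr)
qed (simp add: poly_value_zero)

lemma poly_value_one: "poly_value 1 = \<one>"
proof -
  have "poly_value 1 = poly_value (Poly_Mapping.single 0 1)" by (simp only: single_one)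
  also have "\<dots> = \<one>" unfolding poly_value_single by (simp add: monomial_value_def)
  finally show ?thesis .
qed

lemma poly_value_surj:
  assumes "r \<in> carrier R"
  shows "\<exists>P. poly_value P = r"
proof -
  have "poly_value (Poly_Mapping.single {#r#} 1) = r"
    using assms by (simp add: poly_value_single monomial_value_def)
  then show ?thesis by blast
qed

lemma ring_presentation_poly_value: "ring_presentation R poly_value"
  by unfold_locales (auto intro: poly_value_add poly_value_mult poly_value_one poly_value_surj)

end


section \<open>Local rings with an F-split quotient\<close>

context ring_presentation
begin

lemma ker_coset:
  assumes "is_ideal I" "ker \<subseteq> I" "ev a \<in> ev ` I"
  shows "a \<in> I"
proof -
  obtain b where "b \<in> I" "a - b \<in> ker" using assms(3) ev_eq_iff by auto
  then have "a - b + b \<in> I" using assms by (intro ideal_add) auto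
  then show ?thesis by simp
qed

lemma ideal_image:
  assumes I: "is_ideal I"
  shows "ideal (ev ` I) R"
proof (rule idealI[OF ring_axioms])
  show "subgroup (ev ` I) (add_monoid R)"
  proof (rule add.subgroupI)
    show "ev ` I \<noteq> {}" using ideal_0[OF I] by blast
    show "\<ominus> r \<in> ev ` I" if "r \<in> ev ` I" for r
      using that ideal_minus[OF I] by (auto simp flip: ev_minus)
    show "r \<oplus> s \<in> ev ` I" if "r \<in> ev ` I" "s \<in> ev ` I" for r s
      using that ideal_add[OF I] by (auto simp flip: ev_add)
  qed auto
  show 1: "s \<otimes> r \<in> ev ` I" if rs: "r \<in> ev ` I" "s \<in> carrier R" for r s
  proof -
    obtain a where a: "r = ev a" "a \<in> I" using rs(1) by blast
    obtain b where b: "s = ev b" using ev_surj[OF rs(2)] by blast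
    have "s \<otimes> r = ev (b * a)" by (simp add: a b ev_mult)
    then show ?thesis using ideal_mult[OF I a(2)] by blast
  qed
  show "r \<otimes> s \<in> ev ` I" if "r \<in> ev ` I" "s \<in> carrier R" for r s
    using 1[OF that] that by (auto simp: m_comm)
qed

lemma ideal_vimage:
  assumes "ideal I R"
  shows "is_ideal (ev -` I)" "ker \<subseteq> ev -` I"
proof -
  interpret ideal I R by (rule assms)
  show "is_ideal (ev -` I)"
    by (auto simp: is_ideal_def ev_zero ev_add ev_mult I_l_closed)
  show "ker \<subseteq> ev -` I" by (auto simp: ker_def)
qed

text \<open>An ideal containing \<open>ker\<close> is recovered from its image in \<open>R\<close>,
  so a strictly increasing sequence would contradict the chain condition for the images.\<close>

lemma wf_ideals:
  assumes "noetherian_ring R"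
  shows "wf {(J, I). is_ideal I \<and> is_ideal J \<and> ker \<subseteq> I \<and> I \<subset> J}"
  unfolding wf_iff_no_infinite_down_chain
proof
  assume "\<exists>I. \<forall>i. (I (Suc i), I i) \<in> {(J, I). is_ideal I \<and> is_ideal J \<and> ker \<subseteq> I \<and> I \<subset> J}"
  then obtain I where *: "\<forall>i. is_ideal (I i) \<and> is_ideal (I (Suc i)) \<and> ker \<subseteq> I i \<and> I i \<subset> I (Suc i)"
    by auto
  then have I: "is_ideal (I i)" "ker \<subseteq> I i" "I i \<subset> I (Suc i)" for i by simp_all
  have Suc_le: "I i \<subseteq> I (Suc i)" for i using I(3)[of i] by (rule psubset_imp_subset)
  have mono: "I i \<subseteq> I j" if "i \<le> j" for i j
    by (rule lift_Suc_mono_le[of I, OF Suc_le that])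
  have "I i \<subseteq> I j \<or> I j \<subseteq> I i" for i j using mono[of i j] mono[of j i] by linarith
  then have "ev ` I i \<subseteq> ev ` I j \<or> ev ` I j \<subseteq> ev ` I i" for i j by blast
  then have chain: "subset.chain {I. ideal I R} (range (\<lambda>i. ev ` I i))"
    unfolding subset_chain_def ball_simps using ideal_image[OF I(1)] by blast
  obtain k where k: "(\<Union>i. ev ` I i) = ev ` I k"
    using noetherian_ring.ideal_chain_is_trivial[OF assms _ chain] by auto
  have "I (Suc k) \<subseteq> I k"
  proof
    fix a assume "a \<in> I (Suc k)"
    then have "ev a \<in> ev ` I k" unfolding k[symmetric] by blast
    then show "a \<in> I k" by (rule ker_coset[OF I(1,2)])
  qed
  then show False using I(3)[of k] by blast
qed

text \<open>If \<open>a\<close> were not invertible modulo \<open>ker\<close>, then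
  \<open>ker + a\<close> would be proper. By \<open>wf_ideals\<close> it would lie in an ideal
  maximal among the proper ones containing \<open>a\<close>, whose image would be a maximal ideal
  other than \<open>\<mm>\<close>.\<close>

lemma local_ring_unit:
  assumes N: "noetherian_ring R" and M: "\<And>J. maximalideal J R \<Longrightarrow> J = \<mm>" and a: "ev a \<notin> \<mm>"
  shows "\<exists>b. a * b - 1 \<in> ker"
proof (rule ccontr)
  assume nb: "\<not> (\<exists>b. a * b - 1 \<in> ker)"
  let ?S = "{J. is_ideal J \<and> ker \<subseteq> J \<and> a \<in> J \<and> 1 \<notin> J}"
  have "1 \<notin> ideal_adjoin ker a"
  proof
    assume "1 \<in> ideal_adjoin ker a"
    then obtain c b where c: "1 = c + a * b" "c \<in> ker" by (auto simp: ideal_adjoin_def)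
    have "a * b - 1 = - c" by (subst c(1)) simp
    then show False using nb ideal_minus[OF is_ideal_ker c(2)] by metis
  qed
  then have "ideal_adjoin ker a \<in> ?S"
    using ideal_adjoin[OF is_ideal_ker] ideal_adjoin_ge[OF is_ideal_ker] mem_ideal_adjoin[OF is_ideal_ker]
    by simp
  then obtain J where J: "J \<in> ?S" and max: "\<And>K. (K, J) \<in> {(J, I). is_ideal I \<and> is_ideal J \<and> ker \<subseteq> I \<and> I \<subset> J} \<Longrightarrow> K \<notin> ?S"
    by (rule wfE_min[OF wf_ideals[OF N]]) (rule that)
  have "maximalideal (ev ` J) R"
  proof (rule maximalidealI)
    show "ideal (ev ` J) R" using ideal_image J by blast
    show "carrier R \<noteq> ev ` J"
    proof
      assume "carrier R = ev ` J"
      then have "ev 1 \<in> ev ` J" using ev_closed[of 1] by simp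
      then show False using ker_coset[of J 1] J by simp
    qed
    fix K assume K: "ideal K R" "ev ` J \<subseteq> K" "K \<subseteq> carrier R"
    note v = ideal_vimage[OF K(1)]
    have K_eq: "K = ev ` (ev -` K)" using K(3) ev_surj by blast
    show "K = ev ` J \<or> K = carrier R"
    proof (cases "1 \<in> ev -` K")
      case True
      then have "ev -` K = UNIV" using ideal_one[OF v(1)] by simp
      then show ?thesis using K(3) ev_closed ev_surj by blast
    next
      case False
      have "J \<subseteq> ev -` K" using K(2) by blast
      then have "ev -` K \<in> ?S" using False v J by auto
      then have "\<not> J \<subset> ev -` K" using max[of "ev -` K"] J v by blast
      then show ?thesis using \<open>J \<subseteq> ev -` K\<close> K_eq by blast
    qed
  qed
  then have "ev ` J = \<mm>" by (rule M)
  then show False using J a by blast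
qed

lemma principal_quotient:
  assumes x: "ev y = x"
  shows "PIdl x +> ev a = PIdl x +> ev b \<longleftrightarrow> a - b \<in> ideal_adjoin ker y"
proof -
  have "PIdl x +> ev a = PIdl x +> ev b \<longleftrightarrow> ev (a - b) \<in> PIdl x"
    using quotient_eq_iff_same_a_r_cos[OF cgenideal_ideal, of x "ev a" "ev b"] x by (auto simp: ev_diff)
  also have "\<dots> \<longleftrightarrow> a - b \<in> ideal_adjoin ker y"
  proof
    assume "ev (a - b) \<in> PIdl x"
    then obtain r where "r \<in> carrier R" "ev (a - b) = r \<otimes> x" by (auto simp: cgenideal_def)
    then obtain c where "ev (a - b) = ev (c * y)" using ev_surj x ev_mult by metis
    then have "(a - b) - c * y \<in> ker" by (simp add: ev_eq_iff)
    moreover have "a - b = ((a - b) - c * y) + y * c" by (simp add: mult.commute)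
    ultimately show "a - b \<in> ideal_adjoin ker y" unfolding ideal_adjoin_def by blast
  next
    assume "a - b \<in> ideal_adjoin ker y"
    then obtain c d where "a - b = c + y * d" "c \<in> ker" by (auto simp: ideal_adjoin_def)
    then have "ev (a - b) = ev d \<otimes> x"
      unfolding x[symmetric] by (simp add: ev_add ev_mult ker_def m_comm)
    then show "ev (a - b) \<in> PIdl x" by (auto simp: cgenideal_def)
  qed
  finally show ?thesis .
qed

text \<open>Choosing a representative of each value of the splitting gives a mere function, so the
  splitting identities hold as congruences.\<close>

lemma F_split_lift:
  assumes x: "ev y = x" and p: "0 < p" and split: "F_split p (R Quot (PIdl x))"
  obtains \<phi> where
    "\<And>a b. \<phi> (a + b) - (\<phi> a + \<phi> b) \<in> ideal_adjoin ker y"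
    "\<And>a. a \<in> ideal_adjoin ker y \<Longrightarrow> \<phi> a \<in> ideal_adjoin ker y"
    "\<And>a b. \<phi> (a ^ p * b) - a * \<phi> b \<in> ideal_adjoin ker y"
    "\<phi> 1 - 1 \<in> ideal_adjoin ker y"
proof -
  let ?I = "PIdl x" and ?Q = "R Quot (PIdl x)"
  have I: "ideal ?I R" using x cgenideal_ideal by blast
  define cl where "cl a = ?I +> ev a" for a
  have cl_closed: "cl a \<in> carrier ?Q" for a
    by (auto simp: cl_def FactRing_def A_RCOSETS_def')
  have cl_surj: "\<exists>a. cl a = c" if "c \<in> carrier ?Q" for c
    using that ev_surj by (auto simp: cl_def FactRing_def A_RCOSETS_def')
  note hom = ideal.rcos_ring_hom[OF I]
  have cl_add: "cl (a + b) = cl a \<oplus>\<^bsub>?Q\<^esub> cl b" for a b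
    using ring_hom_add[OF hom] by (simp add: cl_def ev_add)
  have cl_mult: "cl (a * b) = cl a \<otimes>\<^bsub>?Q\<^esub> cl b" for a b
    using ring_hom_mult[OF hom] by (simp add: cl_def ev_mult)
  have cl_one: "cl 1 = \<one>\<^bsub>?Q\<^esub>"
    using ring_hom_one[OF hom] by (simp add: cl_def ev_one)
  have cl_power: "cl (a ^ k) = cl a [^]\<^bsub>?Q\<^esub> k" for a and k :: nat
    by (induction k) (simp_all add: cl_one cl_mult power_Suc2 del: power_Suc)
  have cl_eq: "cl a = cl b \<longleftrightarrow> a - b \<in> ideal_adjoin ker y" for a b
    unfolding cl_def by (rule principal_quotient[OF x])
  obtain s where s: "s \<in> module_homs ?Q (frobenius_pushforward p ?Q) (self_module ?Q)"
    "\<And>c. c \<in> carrier ?Q \<Longrightarrow> s (frobenius p ?Q c) = c"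
    using split by (auto simp: F_split_def)
  have s_closed: "s c \<in> carrier ?Q" if "c \<in> carrier ?Q" for c
    using s(1) that by (auto simp: module_homs_def frobenius_pushforward_def self_module_def)
  have s_add: "s (cl a \<oplus>\<^bsub>?Q\<^esub> cl b) = s (cl a) \<oplus>\<^bsub>?Q\<^esub> s (cl b)" for a b
    using s(1) cl_closed by (auto simp: module_homs_def frobenius_pushforward_def self_module_def)
  have s_scale: "s ((cl a [^]\<^bsub>?Q\<^esub> p) \<otimes>\<^bsub>?Q\<^esub> cl b) = cl a \<otimes>\<^bsub>?Q\<^esub> s (cl b)" for a b
    using s(1) cl_closed by (auto simp: module_homs_def frobenius_pushforward_def self_module_def)
  have s_power: "s (cl (a ^ p)) = cl a" for a
    using s(2)[OF cl_closed] by (simp add: frobenius_def cl_power)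
  have "\<forall>a. \<exists>b. cl b = s (cl a)" using cl_surj s_closed cl_closed by blast
  then obtain \<phi> where \<phi>: "\<And>a. cl (\<phi> a) = s (cl a)" by metis
  show thesis
  proof (rule that[of \<phi>])
    show "\<phi> (a + b) - (\<phi> a + \<phi> b) \<in> ideal_adjoin ker y" for a b
      unfolding cl_eq[symmetric] by (simp add: cl_add \<phi> s_add)
    show "\<phi> a \<in> ideal_adjoin ker y" if "a \<in> ideal_adjoin ker y" for a
    proof -
      \<comment> \<open>Writing zero as a \<open>p\<close>-th power lets the splitting identity
        itself show that the zero class goes to zero.\<close>
      have "cl a = cl (0 ^ p)" using that p by (simp add: cl_eq zero_power)
      then have "cl (\<phi> a) = cl 0" by (simp only: \<phi> s_power)
      then show ?thesis by (simp add: cl_eq)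
    qed
    show "\<phi> (a ^ p * b) - a * \<phi> b \<in> ideal_adjoin ker y" for a b
      unfolding cl_eq[symmetric] by (simp add: cl_mult cl_power \<phi> s_scale)
    show "\<phi> 1 - 1 \<in> ideal_adjoin ker y"
      unfolding cl_eq[symmetric] using s_power[of 1] by (simp add: \<phi>)
  qed
qed

end

theorem mainTheorem3:
  fixes R :: "('a, 'b) ring_scheme" and \<mm> :: "'a set" and x :: 'a and p :: nat
  assumes "noetherian_local_ring R \<mm>"
    and "has_prime_char p R"
    and "x \<in> \<mm>"
    and "regular_element R x"
    and "F_split p (R Quot (PIdl\<^bsub>R\<^esub> x))"
  shows "F_injective p R \<mm>"
  unfolding F_injective_def
proof (intro allI impI)
  fix fs :: "'a list" and i
  assume fs: "set fs \<subseteq> carrier R \<and> genideal R (set fs) = \<mm>"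
  interpret noetherian_local_ring R \<mm> by (rule assms(1))
  interpret ring_presentation R poly_value by (rule ring_presentation_poly_value)
  have prime: "Factorial_Ring.prime p" and char: "add_pow R p \<one>\<^bsub>R\<^esub> = \<zero>\<^bsub>R\<^esub>"
    using assms(2) by (auto simp: has_prime_char_def)
  have mI: "ideal \<mm> R" by (rule ideal_axioms)
  note m = ideal_vimage[OF mI]
  obtain y where y: "poly_value y = x" using assms(3) ev_surj[OF a_Hcarr] by blast
  \<comment> \<open>The bound sits inside the existential so that choice yields a function on all
    indices.\<close>
  have "\<exists>a. k < length fs \<longrightarrow> poly_value a = fs ! k" for k
    using fs ev_surj[of "fs ! k"] nth_mem[of k fs] by blast
  then obtain f where f: "\<And>k. k < length fs \<Longrightarrow> poly_value (f k) = fs ! k" by metis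
  interpret cech_presentation R poly_value fs f by unfold_locales (rule f)
  obtain \<phi> where \<phi>:
    "\<And>a b. \<phi> (a + b) - (\<phi> a + \<phi> b) \<in> ideal_adjoin ker y"
    "\<And>a. a \<in> ideal_adjoin ker y \<Longrightarrow> \<phi> a \<in> ideal_adjoin ker y"
    "\<And>a b. \<phi> (a ^ p * b) - a * \<phi> b \<in> ideal_adjoin ker y"
    "\<phi> 1 - 1 \<in> ideal_adjoin ker y"
    using F_split_lift[OF y prime_gt_0_nat[OF prime] assms(5)] by blast
  have "frobenius_local_data ker (poly_value -` \<mm>) (length fs) p f y \<phi>"
  proof unfold_locales
    show "wf {(J, I). is_ideal I \<and> is_ideal J \<and> ker \<subseteq> I \<and> I \<subset> J}"
      by (rule wf_ideals) (rule noetherian_ring_axioms)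
    show "\<exists>b. a * b - 1 \<in> ker" if "a \<notin> poly_value -` \<mm>" for a
      using that by (intro local_ring_unit[OF noetherian_ring_axioms maximal_unique]) auto
    show "f k \<in> poly_value -` \<mm>" if "k < length fs" for k
      using f[OF that] nth_mem[OF that] fs genideal_self[of "set fs"] by auto
    show "poly_value -` \<mm> \<subseteq> Q" if Q: "is_ideal Q" "ker \<subseteq> Q" "f ` {..<length fs} \<subseteq> Q" for Q
    proof
      fix a assume a: "a \<in> poly_value -` \<mm>"
      have "set fs \<subseteq> poly_value ` Q"
        using Q(3) f by (force simp: in_set_conv_nth)
      then have "\<mm> \<subseteq> poly_value ` Q" using genideal_minimal[OF ideal_image[OF Q(1)]] fs by blast
      then show "a \<in> Q" using a ker_coset[OF Q(1,2)] by blast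
    qed
    show "of_nat p \<in> ker" using char by (simp add: ker_def ev_of_nat)
    show "y \<in> poly_value -` \<mm>" using y assms(3) by simp
    show "a \<in> ker" if "y * a \<in> ker" for a
      using that assms(4) y by (simp add: ker_def ev_mult regular_element_def)
  qed (use is_ideal_ker m prime \<phi> in auto)
  then show "inj_on (frobenius_action p R fs i) (carrier (local_cohomology R fs i))"
    by (rule frobenius_action_inj)
qed

end
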